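(* Let $n\geq 2$, let $\Gamma\subset\mathrm{SU}((n,1),\mathbb{C})$ be a discrete, torsion-free, cocompact subgroup, $X_\Gamma=\Gamma\backslash\mathbb{B}^n$, with injectivity radius $r_X$. Then for $k\geq 2n+2$, \[ \sup_{z\in X_{\Gamma}}\big|\mathcal{B}_\Gamma^k(z)\big|_{\mathrm{pet}}\leq C_{\Gamma,k}+ \frac{C_{\Gamma,k}\cosh^{2n}\big(r_X/ 4\big) }{\big(k-2n-1\big)\sinh^{2n}\big(r_X/ 4\big)} +\frac{C_{\Gamma,k}\sinh^{2n}\big(5r_X/ 8\big)}{\sinh^{2n}\big(r_X/ 4\big)\cosh^{k}\big(3r_X/ 8\big)}. \]
   Context: $\mathbb{B}^n=\{z\in\mathbb{C}^n:|z|^2<1\}$ with hyperbolic metric $\mu_{\mathrm{hyp}}=-2i\partial\overline\partial\log(1-|z|^2)$, volume form $\mu^{\mathrm{vol}}_{\mathrm{hyp}}$, and distance $d_{\mathrm{hyp}}$ with $\cosh^2(d_{\mathrm{hyp}}(z,w)/2)=\frac{|\langle\tilde z,\tilde w\rangle_H|^2}{\langle\tilde z,\tilde z\rangle_H\langle\tilde w,\tilde w\rangle_H}$, $\langle\tilde z,\tilde w\rangle_H=\sum_jz_j\overline{w_j}-1$. $\mathrm{SU}((n,1),\mathbb{C})$ preserves $H=\mathrm{diag}(\mathrm{Id}_n,-1)$ and acts by $\gamma z=(Az+B)/(Cz+D)$, $\gamma=\begin{pmatrix}A&B\\C&D\end{pmatrix}$. $r_X=\inf\{d_{\mathrm{hyp}}(z,\gamma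 z): z\in\mathbb{B}^n,\gamma\in\Gamma\setminus\{\mathrm{Id}\}\}$. $\mathcal{S}_k(\Gamma)$: holomorphic $f$ on $\mathbb{B}^n$ with $f(\gamma z)=(Cz+D)^kf(z)$ ($\gamma\in\Gamma$), Petersson inner product $\int_{\mathcal F}(1-|z|^2)^kf\overline g\,\mu^{\mathrm{vol}}_{\mathrm{hyp}}$. For an orthonormal basis $\{f_j\}$, $\mathcal{B}_\Gamma^k(z,w)=\sum_jf_j(z)\overline{f_j(w)}$ and $|\mathcal{B}_\Gamma^k(z)|_{\mathrm{pet}}=(1-|z|^2)^k|\mathcal{B}_\Gamma^k(z,z)|$. $C_{\Gamma,k}$ denotes the constant (depending on $\Gamma$ and $k$) in the paper's series expression of the Bergman kernel, valid for $k\geq 2n+1$: $\mathcal{B}_\Gamma^k(z,w)=\sum_{\gamma\in\Gamma}\frac{C_{\Gamma,k}}{|\langle z,\gamma w\rangle|^k(Cw+D)^k}$ with $\langle z,w\rangle=1-\sum_jz_j\overline{w_j}$; the paper asserts $C_{\Gamma,k}=O_\Gamma(k^n)$.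
   Formalization: The printed kernel series defining C_{Γ,k} cannot hold for a nonzero kernel (wrong automorphy in w, not holomorphic in z); C_{Γ,k} is instead the nonnegative constant in the corrected series Σ C/(⟨z,γw⟩^k · conj(Cw+D)^k). *)

theory Defs
  imports "HOL-Analysis.Analysis" "HOL-Algebra.Group"
begin

section \<open>The group \<open>SU(n,1)\<close> and its action on the ball\<close>

text \<open>The dimension is \<open>n = CARD('n)\<close>. Matrices of size \<open>n+1\<close> are indexed by \<open>'n option\<close>:
  \<open>Some i\<close> are the first \<open>n\<close> coordinates, \<open>None\<close> is the last one. In block form, \<open>A\<close>, \<open>B\<close>,
  \<open>C\<close>, \<open>D\<close> are the entries indexed by (\<open>Some\<close>, \<open>Some\<close>), (\<open>Some\<close>, \<open>None\<close>), (\<open>None\<close>, \<open>Some\<close>),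
  (\<open>None\<close>, \<open>None\<close>).\<close>

type_synonym 'n cmat1 = "complex ^ ('n option) ^ ('n option)"

definition unit_ball :: "(complex ^ 'n::finite) set" where
  "unit_ball = {z. (norm z)\<^sup>2 < 1}"

definition conj_transpose :: "complex ^ 'm ^ 'm \<Rightarrow> complex ^ 'm ^ 'm" where
  "conj_transpose A = (\<chi> i j. cnj (A $ j $ i))"

definition H_mat :: "('n::finite) cmat1" where
  "H_mat = (\<chi> i j. if i = j then (if i = None then -1 else 1) else 0)"

definition SU_n1 :: "('n::finite) cmat1 monoid" where
  "SU_n1 = \<lparr>carrier = {g. conj_transpose g ** H_mat ** g = H_mat \<and> det g = 1},
            mult = (**), one = mat 1\<rparr>"

definition aut_factor :: "('n::finite) cmat1 \<Rightarrow> complex ^ 'n \<Rightarrow> complex" where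
  "aut_factor g z = (\<Sum>j\<in>UNIV. g $ None $ Some j * z $ j) + g $ None $ None"

definition ball_act :: "('n::finite) cmat1 \<Rightarrow> complex ^ 'n \<Rightarrow> complex ^ 'n" where
  "ball_act g z =
     (\<chi> i. ((\<Sum>j\<in>UNIV. g $ Some i $ Some j * z $ j) + g $ Some i $ None) / aut_factor g z)"

section \<open>The quotient and the conditions on the group\<close>

definition orbit_of :: "('n::finite) cmat1 set \<Rightarrow> complex ^ 'n \<Rightarrow> (complex ^ 'n) set" where
  "orbit_of \<Gamma> z = (\<lambda>g. ball_act g z) ` \<Gamma>"

definition X_quot :: "('n::finite) cmat1 set \<Rightarrow> (complex ^ 'n) set set" where
  "X_quot \<Gamma> = orbit_of \<Gamma> ` unit_ball"

definition X_top :: "('n::finite) cmat1 set \<Rightarrow> (complex ^ 'n) set topology" where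
  "X_top \<Gamma> = topology (\<lambda>U. U \<subseteq> X_quot \<Gamma> \<and> open {z \<in> unit_ball. orbit_of \<Gamma> z \<in> U})"

definition torsion_free :: "('n::finite) cmat1 set \<Rightarrow> bool" where
  "torsion_free \<Gamma> \<longleftrightarrow>
     (\<forall>g\<in>\<Gamma>. \<forall>m::nat. m > 0 \<longrightarrow> g [^]\<^bsub>SU_n1\<^esub> m = \<one>\<^bsub>SU_n1\<^esub> \<longrightarrow> g = \<one>\<^bsub>SU_n1\<^esub>)"

definition cocompact :: "('n::finite) cmat1 set \<Rightarrow> bool" where
  "cocompact \<Gamma> \<longleftrightarrow> compact_space (X_top \<Gamma>)"

section \<open>Hyperbolic distance, injectivity radius and volume\<close>

definition herm_form :: "complex ^ 'n::finite \<Rightarrow> complex ^ 'n \<Rightarrow> complex" where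
  "herm_form z w = (\<Sum>j\<in>UNIV. z $ j * cnj (w $ j)) - 1"

text \<open>The nonnegative solution \<open>d\<close> of \<open>cosh\<^sup>2 (d/2) = \<dots>\<close>; see lemma \<open>cosh_hyp_dist\<close>.\<close>

definition hyp_dist :: "complex ^ 'n::finite \<Rightarrow> complex ^ 'n \<Rightarrow> real" where
  "hyp_dist z w = 2 * arcosh (sqrt ((cmod (herm_form z w))\<^sup>2 /
                     (Re (herm_form z z) * Re (herm_form w w))))"

definition inj_radius :: "('n::finite) cmat1 set \<Rightarrow> real" where
  "inj_radius \<Gamma> = Inf {hyp_dist z (ball_act g z) | z g. z \<in> unit_ball \<and> g \<in> \<Gamma> - {mat 1}}"

definition wirtinger :: "'n::finite \<Rightarrow> (complex ^ 'n \<Rightarrow> complex) \<Rightarrow> complex ^ 'n \<Rightarrow> complex" where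
  "wirtinger j F z = (frechet_derivative F (at z) (axis j 1)
                      - \<i> * frechet_derivative F (at z) (axis j \<i>)) / 2"

definition wirtinger_bar :: "'n::finite \<Rightarrow> (complex ^ 'n \<Rightarrow> complex) \<Rightarrow> complex ^ 'n \<Rightarrow> complex" where
  "wirtinger_bar j F z = (frechet_derivative F (at z) (axis j 1)
                          + \<i> * frechet_derivative F (at z) (axis j \<i>)) / 2"

text \<open>The Hermitian matrix \<open>h\<close> with \<open>-2\<i>\<partial>\<partial>\<close>-bar \<open>log (1 - |z|\<^sup>2) = (\<i>/2) \<Sum> h\<^sub>j\<^sub>k dz\<^sub>j \<and> d(cnj z\<^sub>k)\<close>.
  Since \<open>(\<i>/2) dz \<and> d(cnj z) = dx \<and> dy\<close>, the volume form (the \<open>n\<close>-th exterior power of this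
  (1,1)-form divided by \<open>n!\<close>) is \<open>det h\<close> times Lebesgue measure.\<close>

definition hyp_metric :: "complex ^ 'n::finite \<Rightarrow> complex ^ 'n ^ 'n" where
  "hyp_metric z =
     (\<chi> j k. -4 * wirtinger j (wirtinger_bar k (\<lambda>v. complex_of_real (ln (1 - (norm v)\<^sup>2)))) z)"

definition hyp_vol :: "(complex ^ 'n::finite) measure" where
  "hyp_vol = density lborel (\<lambda>z. indicator unit_ball z * ennreal (Re (det (hyp_metric z))))"

section \<open>Automorphic forms and the Bergman kernel\<close>

definition holomorphic_n :: "(complex ^ 'n::finite \<Rightarrow> complex) \<Rightarrow> (complex ^ 'n) set \<Rightarrow> bool" where
  "holomorphic_n f S \<longleftrightarrow>
     (\<forall>z\<in>S. \<exists>D. (f has_derivative D) (at z) \<and> (\<forall>c v. D (c *s v) = c * D v))"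

text \<open>Functions on the ball are represented by functions vanishing outside it, so that equality
  of functions is equality on the ball.\<close>

definition aut_forms :: "('n::finite) cmat1 set \<Rightarrow> nat \<Rightarrow> (complex ^ 'n \<Rightarrow> complex) set" where
  "aut_forms \<Gamma> k = {f. holomorphic_n f unit_ball \<and>
     (\<forall>g\<in>\<Gamma>. \<forall>z\<in>unit_ball. f (ball_act g z) = aut_factor g z ^ k * f z) \<and>
     (\<forall>z. z \<notin> unit_ball \<longrightarrow> f z = 0)}"

definition fundamental_domain :: "('n::finite) cmat1 set \<Rightarrow> (complex ^ 'n) set \<Rightarrow> bool" where
  "fundamental_domain \<Gamma> F \<longleftrightarrow>
     F \<in> sets borel \<and> F \<subseteq> unit_ball \<and>
     (\<Union>g\<in>\<Gamma>. ball_act g ` F) = unit_ball \<and>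
     (\<forall>g\<in>\<Gamma> - {mat 1}. negligible (F \<inter> ball_act g ` F))"

definition petersson ::
    "(complex ^ 'n::finite) set \<Rightarrow> nat \<Rightarrow> (complex ^ 'n \<Rightarrow> complex) \<Rightarrow> (complex ^ 'n \<Rightarrow> complex) \<Rightarrow> complex" where
  "petersson F k f g =
     (LINT z:F|hyp_vol. complex_of_real ((1 - (norm z)\<^sup>2) ^ k) * f z * cnj (g z))"

text \<open>The space of forms is finite-dimensional because the quotient is compact, hence \<open>finite\<close>.\<close>

definition petersson_onb ::
    "('n::finite) cmat1 set \<Rightarrow> (complex ^ 'n) set \<Rightarrow> nat \<Rightarrow> (complex ^ 'n \<Rightarrow> complex) set \<Rightarrow> bool" where
  "petersson_onb \<Gamma> F k \<B> \<longleftrightarrow>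
     finite \<B> \<and> \<B> \<subseteq> aut_forms \<Gamma> k \<and>
     (\<forall>f\<in>\<B>. \<forall>g\<in>\<B>. petersson F k f g = (if f = g then 1 else 0)) \<and>
     (\<forall>f\<in>aut_forms \<Gamma> k. \<exists>c. f = (\<lambda>z. \<Sum>g\<in>\<B>. c g * g z))"

definition bergman_kernel ::
    "(complex ^ 'n::finite \<Rightarrow> complex) set \<Rightarrow> complex ^ 'n \<Rightarrow> complex ^ 'n \<Rightarrow> complex" where
  "bergman_kernel \<B> z w = (\<Sum>f\<in>\<B>. f z * cnj (f w))"

definition bergman_pet ::
    "(complex ^ 'n::finite \<Rightarrow> complex) set \<Rightarrow> nat \<Rightarrow> complex ^ 'n \<Rightarrow> real" where
  "bergman_pet \<B> k z = (1 - (norm z)\<^sup>2) ^ k * cmod (bergman_kernel \<B> z z)"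

definition ball_pairing :: "complex ^ 'n::finite \<Rightarrow> complex ^ 'n \<Rightarrow> complex" where
  "ball_pairing z w = 1 - (\<Sum>j\<in>UNIV. z $ j * cnj (w $ j))"

text \<open>\<open>C\<close> is the nonnegative constant in the expansion of the Bergman kernel as a series over
  \<open>\<Gamma>\<close>. The kernel is holomorphic in \<open>z\<close>, antiholomorphic in \<open>w\<close>, and transforms in \<open>w\<close> by the
  conjugate of the automorphy factor; this forces the \<open>k\<close>-th power of the pairing itself (not of
  its modulus) and the conjugated factor. The sign condition only matters if there are no
  nonzero forms: then the expansion would hold for every \<open>C\<close>.\<close>

definition bergman_series_const ::
    "('n::finite) cmat1 set \<Rightarrow> nat \<Rightarrow> (complex ^ 'n \<Rightarrow> complex) set \<Rightarrow> real \<Rightarrow> bool" where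
  "bergman_series_const \<Gamma> k \<B> C \<longleftrightarrow> 0 \<le> C \<and>
     (\<forall>z\<in>unit_ball. \<forall>w\<in>unit_ball.
        ((\<lambda>g. complex_of_real C / (ball_pairing z (ball_act g w) ^ k * cnj (aut_factor g w) ^ k))
           has_sum bergman_kernel \<B> z w) \<Gamma>)"

section \<open>Basic facts\<close>


lemma herm_form_self: "herm_form z z = complex_of_real ((norm z)\<^sup>2 - 1)"
  by (simp add: herm_form_def norm_vec_def L2_set_def sum_nonneg complex_norm_square
      del: of_real_power add: of_real_power[symmetric])

lemma cmod_sum_le_norm: "cmod (\<Sum>j\<in>UNIV. z $ j * cnj (w $ j)) \<le> norm z * norm w"
proof -
  have "cmod (\<Sum>j\<in>UNIV. z $ j * cnj (w $ j)) \<le> (\<Sum>j\<in>UNIV. norm (z $ j) * norm (w $ j))"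
    by (rule order_trans[OF norm_sum]) (simp add: norm_mult)
  also have "\<dots> \<le> norm z * norm w"
    using L2_set_mult_ineq[of "\<lambda>j. norm (z $ j)" "\<lambda>j. norm (w $ j)" UNIV]
    by (simp add: norm_vec_def)
  finally show ?thesis .
qed

lemma hyp_ratio_ge_1:
  assumes "z \<in> unit_ball" "w \<in> unit_ball"
  shows "1 \<le> (cmod (herm_form z w))\<^sup>2 / (Re (herm_form z z) * Re (herm_form w w))"
proof -
  define a b where "a = norm z" and "b = norm w"
  have ab: "0 \<le> a" "0 \<le> b" "a < 1" "b < 1" "a\<^sup>2 < 1" "b\<^sup>2 < 1"
    using assms by (auto simp: unit_ball_def a_def b_def abs_square_less_1)
  have "a * b < 1" using ab mult_strict_mono'[of a 1 b 1] by simp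
  moreover have "1 - a * b \<le> cmod (herm_form z w)"
    using norm_triangle_ineq2[of 1 "\<Sum>j\<in>UNIV. z $ j * cnj (w $ j)"] cmod_sum_le_norm[of z w]
    by (simp add: herm_form_def a_def b_def norm_minus_commute)
  ultimately have "(1 - a * b)\<^sup>2 \<le> (cmod (herm_form z w))\<^sup>2"
    by (intro power_mono) auto
  moreover have "(a\<^sup>2 - 1) * (b\<^sup>2 - 1) \<le> (1 - a * b)\<^sup>2"
    using zero_le_power2[of "a - b"] by (simp add: power2_eq_square algebra_simps)
  moreover have "0 < (a\<^sup>2 - 1) * (b\<^sup>2 - 1)" using ab by (simp add: mult_neg_neg)
  ultimately show ?thesis by (simp add: herm_form_self a_def b_def)
qed

lemma cosh_hyp_dist:
  assumes "z \<in> unit_ball" "w \<in> unit_ball"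
  shows "(cosh (hyp_dist z w / 2))\<^sup>2
           = (cmod (herm_form z w))\<^sup>2 / (Re (herm_form z z) * Re (herm_form w w))"
    and "0 \<le> hyp_dist z w"
  using hyp_ratio_ge_1[OF assms]
  by (auto simp: hyp_dist_def cosh_arcosh_real real_sqrt_ge_1_iff arcosh_nonneg_real)

lemma open_unit_ball: "open unit_ball"
  unfolding unit_ball_def by (intro open_Collect_less continuous_intros)

lemma openin_X_top:
  "openin (X_top \<Gamma>) U \<longleftrightarrow> U \<subseteq> X_quot \<Gamma> \<and> open {z \<in> unit_ball. orbit_of \<Gamma> z \<in> U}"
proof -
  have "istopology (\<lambda>U. U \<subseteq> X_quot \<Gamma> \<and> open {z \<in> unit_ball. orbit_of \<Gamma> z \<in> U})"
    unfolding istopology_def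
  proof (intro conjI allI impI; (elim conjE)?)
    fix S T assume "open {z \<in> unit_ball. orbit_of \<Gamma> z \<in> S}" "open {z \<in> unit_ball. orbit_of \<Gamma> z \<in> T}"
    then have "open ({z \<in> unit_ball. orbit_of \<Gamma> z \<in> S} \<inter> {z \<in> unit_ball. orbit_of \<Gamma> z \<in> T})" by blast
    also have "\<dots> = {z \<in> unit_ball. orbit_of \<Gamma> z \<in> S \<inter> T}" by blast
    finally show "open {z \<in> unit_ball. orbit_of \<Gamma> z \<in> S \<inter> T}" .
  next
    fix K assume "\<forall>S\<in>K. S \<subseteq> X_quot \<Gamma> \<and> open {z \<in> unit_ball. orbit_of \<Gamma> z \<in> S}"
    then have "open (\<Union>S\<in>K. {z \<in> unit_ball. orbit_of \<Gamma> z \<in> S})" by blast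
    also have "\<dots> = {z \<in> unit_ball. orbit_of \<Gamma> z \<in> \<Union>K}" by blast
    finally show "open {z \<in> unit_ball. orbit_of \<Gamma> z \<in> \<Union>K}" .
  qed blast+
  then show ?thesis by (simp add: X_top_def topology_inverse')
qed

lemma quotient_map_X_top: "quotient_map (top_of_set unit_ball) (X_top \<Gamma>) (orbit_of \<Gamma>)"
proof -
  have "{z \<in> unit_ball. orbit_of \<Gamma> z \<in> X_quot \<Gamma>} = unit_ball" by (auto simp: X_quot_def)
  then have "topspace (X_top \<Gamma>) = X_quot \<Gamma>"
    unfolding topspace_def openin_X_top using open_unit_ball by auto
  then show ?thesis
    unfolding quotient_map_def openin_X_top
    by (auto simp: X_quot_def openin_open_eq[OF open_unit_ball])
qed

lemma conj_transpose_mult: "conj_transpose (A ** B) = conj_transpose B ** conj_transpose A"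
  by (simp add: conj_transpose_def matrix_matrix_mult_def vec_eq_iff mult.commute)
lemma conj_transpose_twice: "conj_transpose (conj_transpose A) = A"
  by (simp add: conj_transpose_def vec_eq_iff)
lemma conj_transpose_mat_1: "conj_transpose (mat 1) = mat 1"
  by (simp add: conj_transpose_def vec_eq_iff mat_def)
lemma conj_transpose_H: "conj_transpose H_mat = H_mat"
  by (simp add: conj_transpose_def vec_eq_iff H_mat_def)
lemma H_mat_H_mat: "H_mat ** H_mat = mat 1"
proof -
  have "(\<Sum>k\<in>UNIV. H_mat $ i $ k * H_mat $ k $ j) = mat 1 $ i $ j" for i j :: "'a option"
  proof -
    have "(\<Sum>k\<in>UNIV. H_mat $ i $ k * H_mat $ k $ j)
        = (\<Sum>k\<in>UNIV. if k = i then mat 1 $ i $ j else 0 :: complex)"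
      by (rule sum.cong) (auto simp: H_mat_def mat_def)
    then show ?thesis by simp
  qed
  then show ?thesis by (simp add: vec_eq_iff matrix_matrix_mult_def)
qed

lemma group_SU_n1: "group SU_n1"
proof (rule groupI)
  fix x y :: "'a cmat1" assume x: "x \<in> carrier SU_n1" and y: "y \<in> carrier SU_n1"
  have "conj_transpose (x ** y) ** H_mat ** (x ** y)
      = conj_transpose y ** (conj_transpose x ** H_mat ** x) ** y"
    by (simp add: conj_transpose_mult matrix_mul_assoc)
  with x y show "x \<otimes>\<^bsub>SU_n1\<^esub> y \<in> carrier SU_n1" by (simp add: SU_n1_def det_mul)
next
  fix x :: "'a cmat1" assume x: "x \<in> carrier SU_n1"
  define y where "y = H_mat ** conj_transpose x ** H_mat"
  have xx: "conj_transpose x ** H_mat ** x = H_mat" "det x = 1" using x by (auto simp: SU_n1_def)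
  have yx: "y ** x = mat 1"
    using xx(1) by (metis y_def H_mat_H_mat matrix_mul_assoc)
  then have xy: "x ** y = mat 1" by (simp add: matrix_left_right_inverse)
  have "det y = 1" using yx xx(2) by (metis det_I det_mul mult.right_neutral)
  moreover have "conj_transpose y ** H_mat ** y = H_mat"
  proof -
    have "conj_transpose y ** H_mat ** y = H_mat ** x ** (H_mat ** H_mat) ** y"
      by (simp add: y_def conj_transpose_mult conj_transpose_twice conj_transpose_H matrix_mul_assoc)
    also have "\<dots> = H_mat ** (x ** y)" by (simp add: H_mat_H_mat matrix_mul_assoc)
    finally show ?thesis by (simp add: xy)
  qed
  ultimately show "\<exists>y\<in>carrier SU_n1. y \<otimes>\<^bsub>SU_n1\<^esub> x = \<one>\<^bsub>SU_n1\<^esub>"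
    using yx by (auto simp: SU_n1_def)
qed (auto simp: SU_n1_def conj_transpose_mat_1 matrix_mul_assoc)

lemma det_mat_1_plus_rank_1:
  fixes u v :: "complex ^ 'n::finite"
  shows "det (\<chi> i j. (if i = j then 1 else 0) + u $ i * v $ j) = 1 + (\<Sum>i\<in>UNIV. u $ i * v $ i)"
proof -
  define A where "A S = ((\<chi> i. axis i 1 + (if i \<in> S then u $ i else 0) *s v) :: complex ^ 'n ^ 'n)" for S
  have "det (A S) = 1 + (\<Sum>i\<in>S. u $ i * v $ i)" for S
  proof -
    have "finite S" by simp
    then show ?thesis
    proof (induction S)
      case empty
      have "A {} = mat 1" by (simp add: A_def vec_eq_iff mat_def axis_def)
      then show ?case by simp
    next
      case (insert a S)
      define R where "R T = (\<chi> i. if i = a then v else A T $ i)" for T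
      have R: "det (R T) = v $ a" if "finite T" "a \<notin> T" for T using that
      proof (induction T)
        case empty
        have "det (R {}) = (\<Sum>i\<in>UNIV. v $ i * det ((\<chi> j. if j = a then axis i 1 else axis j 1) :: complex ^ 'n ^ 'n))"
        proof -
          have "R {} = (\<chi> j. if j = a then (\<Sum>i\<in>UNIV. v $ i *s axis i 1) else axis j 1)"
            unfolding basis_expansion by (simp add: R_def A_def fun_eq_iff)
          then show ?thesis by (simp add: det_linear_row_sum det_row_mul)
        qed
        also have "\<dots> = (\<Sum>i\<in>UNIV. if i = a then v $ i else 0)"
        proof (rule sum.cong[OF refl])
          fix i
          show "v $ i * det ((\<chi> j. if j = a then axis i 1 else axis j 1) :: complex ^ 'n ^ 'n) = (if i = a then v $ i else 0)"
          proof (cases "i = a")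
            case True
            then have "((\<chi> j. if j = a then axis i 1 else axis j 1) :: complex ^ 'n ^ 'n) = mat 1"
              by (simp add: vec_eq_iff mat_def axis_def)
            with True show ?thesis by simp
          next
            case False
            then have "det ((\<chi> j. if j = a then axis i 1 else axis j 1) :: complex ^ 'n ^ 'n) = 0"
              by (intro det_identical_rows[of i a]) (auto simp: row_def vec_eq_iff)
            with False show ?thesis by simp
          qed
        qed
        finally show ?case by simp
      next
        case (insert b T)
        have "R (insert b T) = (\<chi> k. if k = b then row b (R T) + u $ b *s row a (R T) else row k (R T))"
          using insert by (auto simp: R_def A_def row_def vec_eq_iff)
        moreover have "b \<noteq> a" using insert by auto
        ultimately show ?case using insert by (simp add: det_row_operation)
      qed
      have 1: "A (insert a S) = (\<chi> i. if i = a then axis a 1 + u $ a *s v else A S $ i)"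
        by (auto simp: A_def vec_eq_iff)
      have 2: "(\<chi> i. if i = a then axis a 1 else A S $ i) = A S"
        using insert by (auto simp: A_def vec_eq_iff)
      show ?case unfolding 1 using R[OF insert(1,2)] insert
        by (simp add: det_row_add det_row_mul 2 R_def)
    qed
  qed
  moreover have "A UNIV = (\<chi> i j. (if i = j then 1 else 0) + u $ i * v $ j)"
    by (simp add: A_def axis_def vec_eq_iff)
  ultimately show ?thesis by metis
qed


lemma inner_axis_1: "z \<bullet> axis k 1 = Re (z $ k)" for z :: "complex ^ 'n::finite"
  by (simp add: inner_axis inner_complex_def)
lemma inner_axis_ii: "z \<bullet> axis k \<i> = Im (z $ k)" for z :: "complex ^ 'n::finite"
  by (simp add: inner_axis inner_complex_def)

lemma wirtinger_bar_log:
  assumes "z \<in> unit_ball"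
  shows "wirtinger_bar k (\<lambda>v. complex_of_real (ln (1 - (norm v)\<^sup>2))) z
           = - (z $ k) / complex_of_real (1 - (norm z)\<^sup>2)"
proof -
  have s: "1 - z \<bullet> z > 0" using assms by (simp add: unit_ball_def power2_norm_eq_inner)
  have "((\<lambda>v. complex_of_real (ln (1 - v \<bullet> v))) has_derivative
         (\<lambda>h. complex_of_real (- 2 * (z \<bullet> h) / (1 - z \<bullet> z)))) (at z)"
    using s by (auto intro!: derivative_eq_intros ext simp: inner_commute field_simps)
  then have "frechet_derivative (\<lambda>v. complex_of_real (ln (1 - v \<bullet> v))) (at z)
         = (\<lambda>h. complex_of_real (- 2 * (z \<bullet> h) / (1 - z \<bullet> z)))"
    by (rule frechet_derivative_at[symmetric])
  then show ?thesis
    using s by (simp add: wirtinger_bar_def power2_norm_eq_inner inner_axis_1 inner_axis_ii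
        complex_eq_iff) (simp add: field_simps)
qed

lemma wirtinger_algebra_aux:
  fixes e p q a b :: complex
  shows "-4 * ((- e * p - 2 * a * q - \<i> * (- (\<i> * e) * p - 2 * b * q)) / 2)
    = 4 * (e * p + (a - \<i> * b) * q)"
proof -
  have "\<i> * (- (\<i> * e) * p - 2 * b * q) = e * p - 2 * \<i> * b * q"
    by (simp only: right_diff_distrib mult_minus_left mult_minus_right mult.assoc[symmetric] complex_i_mult_minus i_times_eq_iff) (simp add: mult_ac)
  then show ?thesis by (simp add: diff_divide_distrib add_divide_distrib left_diff_distrib right_diff_distrib mult_ac)
qed

lemma hyp_metric_entry:
  assumes "z \<in> unit_ball"
  shows "hyp_metric z $ j $ k = 4 * ((if j = k then 1 else 0) / complex_of_real (1 - (norm z)\<^sup>2)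
           + cnj (z $ j) * z $ k / (complex_of_real (1 - (norm z)\<^sup>2))\<^sup>2)"
proof -
  let ?L = "\<lambda>v::complex^'n. complex_of_real (ln (1 - (norm v)\<^sup>2))"
  let ?s = "complex_of_real (1 - z \<bullet> z)"
  have s: "1 - z \<bullet> z > 0" using assms by (simp add: unit_ball_def power2_norm_eq_inner)
  then have s0: "?s \<noteq> 0" by (metis of_real_eq_0_iff less_irrefl)
  have "((\<lambda>v. - (v $ k) / complex_of_real (1 - v \<bullet> v)) has_derivative
         (\<lambda>h. - (h $ k) / ?s - z $ k * complex_of_real (2 * (z \<bullet> h)) / ?s\<^sup>2)) (at z)"
  proof -
    have 1: "((\<lambda>v. complex_of_real (1 - v \<bullet> v)) has_derivative
            (\<lambda>h. complex_of_real (- (2 * (z \<bullet> h))))) (at z)"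
      by (auto intro!: derivative_eq_intros ext simp: inner_commute)
    have 2: "((\<lambda>v. - (v $ k)) has_derivative (\<lambda>h. - (h $ k))) (at z)"
      by (intro derivative_intros bounded_linear_imp_has_derivative bounded_linear_vec_nth)
    have e: "(- (h $ k) * ?s - - (z $ k) * complex_of_real (- (2 * (z \<bullet> h)))) / (?s * ?s)
        = - (h $ k) / ?s - z $ k * complex_of_real (2 * (z \<bullet> h)) / ?s\<^sup>2" for h
      using s0 by (simp add: divide_simps power2_eq_square del: of_real_diff)
    show ?thesis
      using has_derivative_divide'[OF 2 1 s0] unfolding e .
  qed
  then have "(wirtinger_bar k ?L has_derivative
         (\<lambda>h. - (h $ k) / ?s - z $ k * complex_of_real (2 * (z \<bullet> h)) / ?s\<^sup>2)) (at z)"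
    by (rule has_derivative_transform_within_open[OF _ open_unit_ball assms])
       (simp add: wirtinger_bar_log[unfolded power2_norm_eq_inner] power2_norm_eq_inner)
  then have F: "frechet_derivative (wirtinger_bar k ?L) (at z)
         = (\<lambda>h. - (h $ k) / ?s - z $ k * complex_of_real (2 * (z \<bullet> h)) / ?s\<^sup>2)"
    by (rule frechet_derivative_at[symmetric])
  have zj: "cnj (z $ j) = complex_of_real (Re (z $ j)) - \<i> * complex_of_real (Im (z $ j))"
    by (simp add: complex_eq_iff)
  have ax: "axis j c $ k = (if j = k then c else 0)" for c :: complex by (auto simp: axis_def)
  define e p q :: complex where "e = (if j = k then 1 else 0)" and "p = 1 / ?s" and "q = z $ k / ?s\<^sup>2"
  have e1: "- (if j = k then 1 else 0) / ?s = - e * p" "(if j = k then 1 else 0) / ?s = e * p"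
    and e2: "- (if j = k then \<i> else 0) / ?s = - (\<i> * e) * p"
    by (simp_all add: e_def p_def)
  have e3: "z $ k * complex_of_real (2 * x) / ?s\<^sup>2 = 2 * complex_of_real x * q"
    and e4: "c * z $ k / ?s\<^sup>2 = c * q" for x c
    by (simp_all add: q_def)
  have G: "hyp_metric z $ j $ k
      = -4 * wirtinger j (wirtinger_bar k ?L) z" by (simp add: hyp_metric_def)
  show ?thesis
    unfolding G wirtinger_def F ax inner_axis_1 inner_axis_ii zj
    unfolding power2_norm_eq_inner e1 e2 e3 e4
    by (rule wirtinger_algebra_aux)
qed

lemma det_hyp_metric:
  fixes z :: "complex ^ 'n::finite"
  assumes "z \<in> unit_ball"
  shows "det (hyp_metric z) = complex_of_real (4 ^ CARD('n) / (1 - (norm z)\<^sup>2) ^ (CARD('n) + 1))"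
proof -
  define s where "s = 1 - (norm z)\<^sup>2"
  have s: "s > 0" using assms by (simp add: unit_ball_def s_def)
  define u where "u = (\<chi> j. cnj (z $ j) / complex_of_real s)"
  have "hyp_metric z = (\<chi> i. (4 / complex_of_real s) *s
          ((\<chi> i j. (if i = j then 1 else 0) + u $ i * z $ j) :: complex ^ 'n ^ 'n) $ i)"
    using s by (simp add: vec_eq_iff hyp_metric_entry[OF assms, folded s_def] u_def
        field_simps power2_eq_square)
  then have "det (hyp_metric z) = (4 / complex_of_real s) ^ CARD('n)
      * (1 + (\<Sum>i\<in>UNIV. u $ i * z $ i))"
    by (simp add: det_rows_mul) (simp add: det_mat_1_plus_rank_1)
  also have "(\<Sum>i\<in>UNIV. u $ i * z $ i) = (\<Sum>i\<in>UNIV. z $ i * cnj (z $ i)) / complex_of_real s"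
    by (simp add: u_def sum_divide_distrib mult.commute)
  also have "(\<Sum>i\<in>UNIV. z $ i * cnj (z $ i)) = complex_of_real (1 - s)"
    using herm_form_self[of z] by (simp add: herm_form_def s_def algebra_simps)
  also have "1 + complex_of_real (1 - s) / complex_of_real s = complex_of_real (1 / s)"
    using s by (simp add: field_simps)
  finally show ?thesis
    by (simp add: s_def[symmetric] power_divide)
qed

end

theory Submission
  imports Defs
begin

text \<open>In absolute value, the term of the Bergman series for \<open>g\<close> contributes
  \<open>C / cosh (d (z, g z) / 2)\<^sup>k\<close> to the Petersson norm on the diagonal, so a bound is needed for the
  sum of \<open>cosh (d (z, \<cdot>) / 2)\<^sup>-\<^sup>k\<close> over an orbit. Any two points of the orbit have distance at least
  \<open>r\<close>, and \<open>r > 0\<close> because the quotient is compact and the group is discrete and torsion-free.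

  The function \<open>cosh (d (z, \<cdot>) / 2)\<^sup>-\<^sup>k\<close> satisfies a sub-mean-value inequality on hyperbolic balls.
  The balls of radius \<open>r / 2\<close> around the orbit are disjoint, so integrating over them bounds the sum
  by a quotient of incomplete beta integrals, and the theorem reduces to an inequality between
  functions of one real variable. That inequality fails only for \<open>n = 2\<close>, \<open>k \<in> {7, 8}\<close> and small
  \<open>r\<close>; there the balls are replaced by larger, overlapping weights whose sum is at most 1 by
  Blichfeldt's argument.

  All integrals are taken over the shell \<open>1 < - \<langle>v, v\<rangle> < 2\<close> of \<open>\<complex>\<^sup>n\<^sup>+\<^sup>1\<close> with Lebesgue measure. The
  linear group preserves both, hence no Jacobian of the action on the ball is ever needed.\<close>

section \<open>Linear maps preserving Lebesgue measure\<close>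

lemma borel_measurable_linear:
  fixes f :: "'a::euclidean_space \<Rightarrow> 'b::euclidean_space"
  shows "linear f \<Longrightarrow> f \<in> borel_measurable borel"
  by (simp add: borel_measurable_continuous_onI linear_continuous_on linear_linear)

lemma lborel_distr_basis_bij:
  fixes f :: "'a::euclidean_space \<Rightarrow> 'b::euclidean_space"
  assumes f: "linear f" and bij: "bij_betw f Basis Basis"
  shows "distr lborel borel f = lborel"
proof (rule lborel_eqI[symmetric])
  have f_Basis: "f i \<in> Basis" if "i \<in> Basis" for i
    using bij that by (auto simp: bij_betw_def)
  have inner_f: "f x \<bullet> f i = x \<bullet> i" if "i \<in> Basis" for x i
  proof -
    have "f x = (\<Sum>j\<in>Basis. (x \<bullet> j) *\<^sub>R f j)"
      by (subst euclidean_representation[of x, symmetric])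
        (simp add: linear_sum[OF f] linear_cmul[OF f])
    then have "f x \<bullet> f i = (\<Sum>j\<in>Basis. (x \<bullet> j) * (f j \<bullet> f i))"
      by (simp add: inner_sum_left)
    also have "\<dots> = (\<Sum>j\<in>Basis. if j = i then x \<bullet> j else 0)"
      using bij that
      by (intro sum.cong refl) (auto simp: inner_Basis f_Basis bij_betw_def dest: inj_onD)
    finally show ?thesis using that by simp
  qed
  fix l u :: 'b assume l_le_u: "\<And>b. b \<in> Basis \<Longrightarrow> l \<bullet> b \<le> u \<bullet> b"
  define pull where "pull y = (\<Sum>i\<in>Basis. (y \<bullet> f i) *\<^sub>R i)" for y
  have inner_pull: "pull y \<bullet> i = y \<bullet> f i" if "i \<in> Basis" for y i
    using that by (simp add: pull_def inner_sum_left inner_Basis if_distrib cong: if_cong)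
  have "(\<forall>c\<in>Basis. P c) \<longleftrightarrow> (\<forall>i\<in>Basis. P (f i))" for P
    using bij unfolding bij_betw_def by (metis image_iff)
  then have "f -` box l u = box (pull l) (pull u)"
    unfolding box_def by (auto simp: inner_f inner_pull)
  then have "emeasure (distr lborel borel f) (box l u) = emeasure lborel (box (pull l) (pull u))"
    using borel_measurable_linear[OF f] by (simp add: emeasure_distr)
  also have "\<dots> = (\<Prod>i\<in>Basis. (u - l) \<bullet> f i)"
    by (subst emeasure_lborel_box)
      (use l_le_u f_Basis in \<open>auto simp: inner_pull inner_diff_left intro!: prod.cong\<close>)
  also have "\<dots> = (\<Prod>c\<in>Basis. (u - l) \<bullet> c)"
    using prod.reindex_bij_betw[OF bij, of "(\<bullet>) (u - l)"] by simp
  finally show "emeasure (distr lborel borel f) (box l u) = (\<Prod>c\<in>Basis. (u - l) \<bullet> c)" .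
qed simp

lemma lborel_distr_linear_det:
  fixes f :: "real ^ 'i::{finite,wellorder} \<Rightarrow> real ^ 'i::_"
  assumes f: "linear f" and det: "\<bar>det (matrix f)\<bar> = 1"
  shows "distr lborel borel f = lborel"
proof (rule lborel_eqI[symmetric])
  have "det (matrix f) \<noteq> 0" using det by force
  then have "inj f" using det_nz_iff_inj[OF f] by blast
  then obtain g where g: "linear g" "\<And>x. g (f x) = x" "\<And>x. f (g x) = x"
    using linear_injective_isomorphism[OF f] by blast
  have "g \<circ> f = id" using g(2) by auto
  then have "det (matrix g) * det (matrix f) = 1"
    by (metis matrix_compose[OF f g(1)] det_mul matrix_id_mat_1 det_I)
  then have det_g: "\<bar>det (matrix g)\<bar> = 1" using det by (metis abs_mult abs_one mult.right_neutral)
  fix l u :: "real ^ 'i::_" assume l_le_u: "\<And>b. b \<in> Basis \<Longrightarrow> l \<bullet> b \<le> u \<bullet> b"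
  have vimage: "f -` box l u = g ` box l u" using g by (auto simp: image_iff) metis+
  have "g ` box l u \<in> sets borel"
    using measurable_sets[OF borel_measurable_linear[OF f], of "box l u"] by (simp add: vimage)
  then have "emeasure (distr lborel borel f) (box l u) = emeasure lebesgue (g ` box l u)"
    using borel_measurable_linear[OF f] by (simp add: emeasure_distr vimage)
  also have "\<dots> = ennreal (measure lebesgue (box l u))"
    using measurable_linear_image[OF g(1), of "box l u"] measure_linear_image[OF g(1), of "box l u"]
    by (simp add: emeasure_eq_measure2 det_g)
  also have "\<dots> = (\<Prod>b\<in>Basis. (u - l) \<bullet> b)"
    using l_le_u by (simp add: measure_lborel_box_eq)
  finally show "emeasure (distr lborel borel f) (box l u) = (\<Prod>b\<in>Basis. (u - l) \<bullet> b)" .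
qed simp

text \<open>The library computes the measure of linear images only over well-ordered index types;
  this type supplies one for an arbitrary Euclidean space.\<close>

typedef (overloaded) ('a::euclidean_space) basis_index = "{..<DIM('a)}"
  morphisms index_nat nat_index
  by (auto intro!: exI[of _ 0])

instantiation basis_index :: (euclidean_space) wellorder
begin
definition "x \<le> y \<longleftrightarrow> index_nat x \<le> index_nat y"
definition "x < y \<longleftrightarrow> index_nat x < index_nat y"
instance
proof
  fix P :: "'a basis_index \<Rightarrow> bool" and a
  assume step: "\<And>x. (\<And>y. y < x \<Longrightarrow> P y) \<Longrightarrow> P x"
  show "P a"
    by (induction a rule: measure_induct_rule[of index_nat])
      (rule step, simp add: less_basis_index_def)
qed (auto simp: less_eq_basis_index_def less_basis_index_def index_nat_inject)
end

lemma bij_index_nat: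
  "bij_betw index_nat (UNIV :: 'a::euclidean_space basis_index set) {..<DIM('a)}"
  using type_definition.Rep_range[OF type_definition_basis_index]
  by (auto simp: bij_betw_def inj_on_def index_nat_inject)

instance basis_index :: (euclidean_space) finite
  by standard (use bij_betw_finite[OF bij_index_nat] in auto)

lemma euclidean_coordinates:
  obtains \<phi> :: "real ^ 'a::euclidean_space basis_index \<Rightarrow> 'a"
  where "linear \<phi>" "bij \<phi>" "\<And>x y. \<phi> x \<bullet> \<phi> y = x \<bullet> y" "distr lborel borel \<phi> = lborel"
proof -
  have "\<exists>e. bij_betw e (UNIV :: 'a basis_index set) (Basis :: 'a set)"
    using bij_betw_trans[OF bij_index_nat] ex_bij_betw_nat_finite[of "Basis :: 'a set"]
    by (metis atLeast0LessThan finite_Basis)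
  then obtain e where e: "bij_betw e (UNIV :: 'a basis_index set) (Basis :: 'a set)" by blast
  then have "e i \<in> Basis" "e i = e j \<longleftrightarrow> i = j" for i j
    by (auto simp: bij_betw_def inj_on_def)
  then have inner_e: "e i \<bullet> e j = (if i = j then 1 else 0)" for i j
    by (simp add: inner_Basis)
  define \<phi> :: "real ^ 'a basis_index \<Rightarrow> 'a" where "\<phi> x = (\<Sum>i\<in>UNIV. x $ i *\<^sub>R e i)" for x
  have linear: "linear \<phi>"
    by (auto simp: \<phi>_def linear_iff scaleR_add_left sum.distrib scaleR_sum_right)
  have inner: "\<phi> x \<bullet> \<phi> y = x \<bullet> y" for x y
    by (simp add: \<phi>_def inner_sum_left inner_sum_right inner_e inner_vec_def if_distrib mult_ac
        cong: if_cong)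
  have right_inverse: "\<phi> (\<chi> i. y \<bullet> e i) = y" for y
    by (simp add: \<phi>_def sum.reindex_bij_betw[OF e, of "\<lambda>b. (y \<bullet> b) *\<^sub>R b"] euclidean_representation)
  have "inj \<phi>"
    unfolding linear_injective_0[OF linear] by (metis inner inner_eq_zero_iff inner_zero_left)
  moreover have "surj \<phi>" using right_inverse by (rule surjI)
  ultimately have "bij \<phi>" by (rule bijI)
  moreover have "distr lborel borel \<phi> = lborel"
  proof (rule lborel_distr_basis_bij[OF linear])
    have "bij_betw (\<lambda>i::'a basis_index. axis i (1::real)) UNIV Basis"
      by (auto simp: bij_betw_def inj_on_def axis_eq_axis Basis_vec_def)
    moreover have "\<phi> \<circ> (\<lambda>i. axis i 1) = e"
      by (auto simp: \<phi>_def axis_def if_distrib[of "\<lambda>c. c *\<^sub>R _"] cong: if_cong)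
    ultimately show "bij_betw \<phi> Basis Basis"
      using bij_betw_comp_iff e by metis
  qed
  ultimately show ?thesis using that linear inner by blast
qed

text \<open>In coordinates the invariance says \<open>F\<^sup>T K F = K\<close>.\<close>

lemma abs_det_eq_1_of_preserved_form:
  fixes F K :: "real ^ 'i \<Rightarrow> real ^ 'i::_"
  assumes F: "linear F" and K: "linear K" "inj K" and invariant: "\<And>x y. F x \<bullet> K (F y) = x \<bullet> K y"
  shows "\<bar>det (matrix F)\<bar> = 1"
proof -
  have "x \<bullet> ((transpose (matrix F) ** matrix K ** matrix F) *v y) = x \<bullet> (matrix K *v y)" for x y
  proof -
    have "x \<bullet> (transpose (matrix F) *v z) = (matrix F *v x) \<bullet> z" for z
      by (metis dot_lmul_matrix transpose_matrix_vector transpose_transpose)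
    then have "x \<bullet> ((transpose (matrix F) ** matrix K ** matrix F) *v y)
        = (matrix F *v x) \<bullet> (matrix K *v (matrix F *v y))"
      by (simp flip: matrix_vector_mul_assoc)
    then show ?thesis using F K by (simp add: matrix_works invariant)
  qed
  then have "transpose (matrix F) ** matrix K ** matrix F = matrix K"
    by (metis vector_eq_ldot matrix_eq)
  then have "det (matrix F) * det (matrix K) * det (matrix F) = det (matrix K)"
    by (metis det_mul det_transpose)
  moreover have "det (matrix K) \<noteq> 0" using det_nz_iff_inj K by blast
  ultimately have "(det (matrix F))\<^sup>2 = 1" by (simp add: power2_eq_square)
  then show ?thesis by (auto simp: power2_eq_1_iff)
qed

lemma lborel_distr_preserved_form:
  fixes f J :: "'a::euclidean_space \<Rightarrow> 'a"
  assumes f: "linear f" and J: "linear J" "inj J" and invariant: "\<And>x y. f x \<bullet> J (f y) = x \<bullet> J y"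
  shows "distr lborel borel f = lborel"
proof -
  obtain \<phi> :: "real ^ 'a basis_index \<Rightarrow> 'a"
    where \<phi>: "linear \<phi>" "bij \<phi>" "\<And>x y. \<phi> x \<bullet> \<phi> y = x \<bullet> y" "distr lborel borel \<phi> = lborel"
    using euclidean_coordinates by blast
  obtain \<psi> where \<psi>: "linear \<psi>" "\<And>x. \<psi> (\<phi> x) = x"
    using linear_injective_left_inverse[OF \<phi>(1)] \<phi>(2) by (metis bij_is_inj comp_apply id_apply)
  have \<phi>_\<psi>: "\<phi> (\<psi> x) = x" for x using \<phi>(2) \<psi>(2) by (metis bij_pointE)
  define F where "F = \<psi> \<circ> f \<circ> \<phi>"
  define K where "K = \<psi> \<circ> J \<circ> \<phi>"
  have linear: "linear F" "linear K"
    by (auto simp: F_def K_def intro!: linear_compose \<phi> \<psi> f J)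
  have "inj K"
    unfolding K_def by (metis J(2) \<phi>(2) \<phi>_\<psi> bij_is_inj inj_compose inj_on_inverseI)
  moreover have "F x \<bullet> K (F y) = x \<bullet> K y" for x y
    using \<phi>(3) by (simp add: F_def K_def \<phi>_\<psi> invariant flip: \<phi>(3))
  ultimately have F_lborel: "distr lborel borel F = lborel"
    using linear by (intro lborel_distr_linear_det abs_det_eq_1_of_preserved_form[of F K])
  note measurable = borel_measurable_linear[OF f] borel_measurable_linear[OF \<phi>(1)]
    borel_measurable_linear[OF linear(1)]
  have "distr lborel borel f = distr (distr lborel borel \<phi>) borel f" by (simp add: \<phi>(4))
  also have "\<dots> = distr lborel borel (f \<circ> \<phi>)" using measurable by (simp add: distr_distr)
  also have "f \<circ> \<phi> = \<phi> \<circ> F" by (auto simp: F_def \<phi>_\<psi>)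
  also have "distr lborel borel (\<phi> \<circ> F) = distr (distr lborel borel F) borel \<phi>"
    using measurable by (simp add: distr_distr)
  finally show ?thesis by (simp add: F_lborel \<phi>(4))
qed

lemma nn_integral_preserved_form:
  fixes f J :: "'a::euclidean_space \<Rightarrow> 'a"
  assumes "linear f" "linear J" "inj J" "\<And>x y. f x \<bullet> J (f y) = x \<bullet> J y"
    and "\<phi> \<in> borel_measurable borel"
  shows "(\<integral>\<^sup>+x. \<phi> (f x) \<partial>lborel) = (\<integral>\<^sup>+x. \<phi> x \<partial>lborel)"
proof -
  have "(\<integral>\<^sup>+x. \<phi> x \<partial>lborel) = (\<integral>\<^sup>+x. \<phi> x \<partial>distr lborel borel f)"
    by (simp add: lborel_distr_preserved_form[OF assms(1-4)])
  also have "\<dots> = (\<integral>\<^sup>+x. \<phi> (f x) \<partial>lborel)"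
    using borel_measurable_linear[OF assms(1)] assms(5) by (simp add: nn_integral_distr)
  finally show ?thesis by simp
qed

section \<open>The Hermitian form of signature \<open>(n, 1)\<close>\<close>

definition hform :: "complex ^ ('n::finite option) \<Rightarrow> complex ^ ('n option) \<Rightarrow> complex" where
  "hform v w = (\<Sum>j\<in>UNIV. v $ Some j * cnj (w $ Some j)) - v $ None * cnj (w $ None)"

definition qform :: "complex ^ ('n::finite option) \<Rightarrow> real" where
  "qform v = (cmod (v $ None))\<^sup>2 - (\<Sum>j\<in>UNIV. (cmod (v $ Some j))\<^sup>2)"

lemma sum_option: "(\<Sum>i\<in>UNIV. f i) = f None + (\<Sum>j\<in>UNIV. f (Some j))"
  for f :: "'n::finite option \<Rightarrow> 'a::comm_monoid_add"
proof -
  have "(\<Sum>i\<in>range Some. f i) = (\<Sum>j\<in>UNIV. f (Some j))"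
    by (subst sum.reindex) (auto simp: inj_on_def)
  then show ?thesis by (simp add: UNIV_option_conv)
qed

lemma hform_smult_left: "hform (c *s v) w = c * hform v w"
  by (simp add: hform_def algebra_simps sum_distrib_left)

lemma cnj_hform: "cnj (hform v w) = hform w v"
  by (simp add: hform_def mult.commute)

lemma cmod_hform_commute: "cmod (hform v w) = cmod (hform w v)"
  by (metis cnj_hform complex_mod_cnj)

lemma hform_smult_right: "hform w (c *s v) = cnj c * hform w v"
  by (simp add: hform_def algebra_simps sum_distrib_left)

lemma hform_add_left: "hform (u + v) w = hform u w + hform v w"
  by (simp add: hform_def algebra_simps sum.distrib)

lemma hform_diff_left: "hform (u - v) w = hform u w - hform v w"
  by (simp add: hform_def algebra_simps sum_subtractf)

lemma hform_diff_right: "hform w (u - v) = hform w u - hform w v"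
  by (simp add: hform_def algebra_simps sum_subtractf)

lemma hform_self: "hform v v = - complex_of_real (qform v)"
  by (simp add: hform_def qform_def complex_norm_square[symmetric] flip: of_real_power)

lemma qform_smult: "qform (c *s v) = (cmod c)\<^sup>2 * qform v"
  by (simp add: qform_def norm_mult power_mult_distrib right_diff_distrib sum_distrib_left)

lemma continuous_on_hform [continuous_intros]:
  "continuous_on S f \<Longrightarrow> continuous_on S g \<Longrightarrow> continuous_on S (\<lambda>x. hform (f x) (g x))"
  unfolding hform_def by (intro continuous_intros)

lemma continuous_on_qform [continuous_intros]:
  "continuous_on S f \<Longrightarrow> continuous_on S (\<lambda>x. qform (f x))"
  unfolding qform_def by (intro continuous_intros)

lemma measurable_hform [measurable]: "hform p \<in> borel_measurable borel"
  by (intro borel_measurable_continuous_onI continuous_intros)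

lemma measurable_qform [measurable]: "qform \<in> borel_measurable borel"
  by (intro borel_measurable_continuous_onI continuous_intros)

section \<open>The ball in homogeneous coordinates\<close>

definition vec_join :: "(complex ^ 'n::finite) \<times> complex \<Rightarrow> complex ^ ('n option)" where
  "vec_join y = (\<chi> i. case i of None \<Rightarrow> snd y | Some j \<Rightarrow> fst y $ j)"

lemma vec_join_nth [simp]: "vec_join y $ None = snd y" "vec_join y $ Some j = fst y $ j"
  by (simp_all add: vec_join_def)

definition lift :: "complex ^ 'n::finite \<Rightarrow> complex ^ ('n option)" where
  "lift z = vec_join (z, 1)"

definition dehom :: "complex ^ ('n::finite option) \<Rightarrow> complex ^ 'n" where
  "dehom v = (\<chi> j. v $ Some j / v $ None)"

lemma lift_nth [simp]: "lift z $ None = 1" "lift z $ Some j = z $ j"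
  by (simp_all add: lift_def)

lemma dehom_lift [simp]: "dehom (lift z) = z"
  by (simp add: dehom_def vec_eq_iff)

lemma dehom_smult: "c \<noteq> 0 \<Longrightarrow> dehom (c *s v) = dehom v"
  by (simp add: dehom_def vec_eq_iff)

lemma lift_dehom: "v $ None \<noteq> 0 \<Longrightarrow> v = v $ None *s lift (dehom v)"
  by (simp add: vec_eq_iff dehom_def split_option_all)

lemma continuous_on_lift [continuous_intros]:
  assumes "continuous_on S f"
  shows "continuous_on S (\<lambda>x. lift (f x))"
proof -
  have "continuous_on S (\<lambda>x. case i of None \<Rightarrow> 1 | Some j \<Rightarrow> f x $ j)" for i
    using assms by (cases i) (auto intro: continuous_intros)
  then show ?thesis unfolding lift_def vec_join_def by (simp add: continuous_on_vec_lambda)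
qed

lemma unit_ball_iff: "z \<in> unit_ball \<longleftrightarrow> norm z < 1"
  using abs_square_less_1[of "norm z"] by (simp add: unit_ball_def)

lemma qform_vec_join: "qform (vec_join (x, \<mu>)) = (cmod \<mu>)\<^sup>2 - (norm x)\<^sup>2"
  by (simp add: qform_def norm_vec_def L2_set_def sum_nonneg)

lemma qform_lift: "qform (lift z) = 1 - (norm z)\<^sup>2"
  by (simp add: lift_def qform_vec_join)

lemma qform_lift_pos_iff: "0 < qform (lift z) \<longleftrightarrow> z \<in> unit_ball"
  by (simp add: qform_lift unit_ball_def)

lemma hform_lift: "hform (lift z) (lift w) = herm_form z w"
  by (simp add: hform_def herm_form_def)

lemma
  assumes "qform v > 0"
  shows qform_pos_imp_nth_None: "v $ None \<noteq> 0"
    and dehom_in_unit_ball: "dehom v \<in> unit_ball"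
proof -
  have "\<not> 0 < qform v" if "v $ None = 0"
    using that sum_nonneg[of UNIV "\<lambda>j. (cmod (v $ Some j))\<^sup>2"] by (simp add: qform_def)
  then show v: "v $ None \<noteq> 0" using assms by blast
  have "qform v = (cmod (v $ None))\<^sup>2 * qform (lift (dehom v))"
    by (metis lift_dehom[OF v] qform_smult)
  then show "dehom v \<in> unit_ball"
    using assms by (simp add: zero_less_mult_iff flip: qform_lift_pos_iff)
qed

text \<open>The hyperbolic cosine of half the distance of two negative lines, and the square of the
  hyperbolic tangent of that number. Neither depends on the chosen vectors of the lines.\<close>

definition half_cosh :: "complex ^ ('n::finite option) \<Rightarrow> complex ^ ('n option) \<Rightarrow> real" where
  "half_cosh v w = cmod (hform v w) / sqrt (qform v * qform w)"

definition half_tanh_sq :: "complex ^ ('n::finite option) \<Rightarrow> complex ^ ('n option) \<Rightarrow> real" where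
  "half_tanh_sq v w = 1 - 1 / (half_cosh v w)\<^sup>2"

lemma half_cosh_commute: "half_cosh v w = half_cosh w v"
  by (simp add: half_cosh_def cmod_hform_commute[of v w] mult.commute)

lemma half_cosh_smult_left: "c \<noteq> 0 \<Longrightarrow> half_cosh (c *s v) w = half_cosh v w"
  by (simp add: half_cosh_def hform_smult_left qform_smult norm_mult real_sqrt_mult)

lemma half_cosh_smult_right: "c \<noteq> 0 \<Longrightarrow> half_cosh v (c *s w) = half_cosh v w"
  by (metis half_cosh_commute half_cosh_smult_left)

lemma half_cosh_lift_dehom:
  assumes "qform v > 0" "qform w > 0"
  shows "half_cosh v w = half_cosh (lift (dehom v)) (lift (dehom w))"
  using assms[THEN qform_pos_imp_nth_None] lift_dehom[of v] lift_dehom[of w]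
  by (metis half_cosh_smult_left half_cosh_smult_right)

lemma half_cosh_lift:
  assumes z: "z \<in> unit_ball" and w: "w \<in> unit_ball"
  shows "half_cosh (lift z) (lift w) = cosh (hyp_dist z w / 2)"
proof (rule power2_eq_imp_eq)
  have "0 < (1 - (norm z)\<^sup>2) * (1 - (norm w)\<^sup>2)"
    using z w by (simp add: unit_ball_def)
  then show "(half_cosh (lift z) (lift w))\<^sup>2 = (cosh (hyp_dist z w / 2))\<^sup>2"
    unfolding cosh_hyp_dist(1)[OF z w]
    by (simp add: half_cosh_def hform_lift qform_lift herm_form_self power_divide algebra_simps)
  show "0 \<le> half_cosh (lift z) (lift w)"
    using z w by (simp add: half_cosh_def qform_lift unit_ball_def)
qed simp

lemma hyp_dist_eq_arcosh_half_cosh: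
  assumes "z \<in> unit_ball" "w \<in> unit_ball"
  shows "hyp_dist z w = 2 * arcosh (half_cosh (lift z) (lift w))"
  using cosh_hyp_dist(2)[OF assms] by (simp add: half_cosh_lift[OF assms] arcosh_cosh_real)

lemma half_cosh_ge_1: "qform v > 0 \<Longrightarrow> qform w > 0 \<Longrightarrow> 1 \<le> half_cosh v w"
  by (simp add: half_cosh_lift_dehom half_cosh_lift dehom_in_unit_ball cosh_real_ge_1)

lemma half_cosh_lift_eq_ball_pairing:
  "half_cosh (lift z) (lift w)
    = cmod (ball_pairing z w) / (sqrt (1 - (norm z)\<^sup>2) * sqrt (1 - (norm w)\<^sup>2))"
  by (simp add: half_cosh_def hform_lift qform_lift herm_form_def ball_pairing_def
      real_sqrt_mult norm_minus_commute)

lemma half_cosh_lift_0: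
  assumes "qform v > 0"
  shows "half_cosh (lift 0) v = 1 / sqrt (1 - (norm (dehom v))\<^sup>2)"
  using assms half_cosh_lift_dehom[of "lift 0" v]
  by (simp add: qform_lift half_cosh_lift_eq_ball_pairing ball_pairing_def)

lemma half_tanh_sq_lift_0:
  assumes "qform v > 0"
  shows "half_tanh_sq (lift 0) v = (norm (dehom v))\<^sup>2"
  using dehom_in_unit_ball[OF assms]
  by (simp add: half_tanh_sq_def half_cosh_lift_0[OF assms] power_divide unit_ball_def)

lemma half_cosh_eq_ball_pairing:
  assumes v: "qform v > 0" and w: "qform w > 0"
  shows "half_cosh v w
    = cmod (ball_pairing (dehom v) (dehom w)) * (half_cosh (lift 0) v * half_cosh (lift 0) w)"
  using half_cosh_lift_dehom[OF v w]
  by (simp add: half_cosh_lift_eq_ball_pairing half_cosh_lift_0 v w)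

lemma half_tanh_sq_commute: "half_tanh_sq v w = half_tanh_sq w v"
  by (simp add: half_tanh_sq_def half_cosh_commute)

lemma measurable_half_cosh [measurable]: "half_cosh p \<in> borel_measurable borel"
  unfolding half_cosh_def by measurable

lemma measurable_half_tanh_sq [measurable]: "half_tanh_sq p \<in> borel_measurable borel"
  unfolding half_tanh_sq_def by measurable

section \<open>The unitary group of the form\<close>

definition U_n1 :: "('n::finite) cmat1 set" where
  "U_n1 = {g. conj_transpose g ** H_mat ** g = H_mat}"

definition H_adjoint :: "('n::finite) cmat1 \<Rightarrow> 'n cmat1" where
  "H_adjoint g = H_mat ** conj_transpose g ** H_mat"

lemma H_mat_vec: "(H_mat *v v) $ i = (if i = None then - v $ i else v $ i)"
  by (simp add: matrix_vector_mult_def H_mat_def if_distrib[of "\<lambda>x. x * _"] cong: if_cong)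

lemma hform_H_mat: "hform v w = (\<Sum>i\<in>UNIV. (H_mat *v v) $ i * cnj (w $ i))"
  by (simp add: H_mat_vec sum_option hform_def)

lemma inner_H_mat: "v \<bullet> (H_mat *v w) = Re (hform w v)"
  by (simp add: hform_H_mat inner_vec_def inner_complex_def) (simp add: mult.commute)

lemma hform_mult_both:
  "hform (g *v v) (g *v w)
    = (\<Sum>j\<in>UNIV. ((conj_transpose g ** H_mat ** g) *v v) $ j * cnj (w $ j))"
proof -
  define x where "x = H_mat *v (g *v v)"
  have "hform (g *v v) (g *v w) = (\<Sum>i\<in>UNIV. x $ i * (\<Sum>j\<in>UNIV. cnj (g $ i $ j) * cnj (w $ j)))"
    unfolding hform_H_mat x_def by (simp add: matrix_vector_mult_def)
  also have "\<dots> = (\<Sum>j\<in>UNIV. (\<Sum>i\<in>UNIV. cnj (g $ i $ j) * x $ i) * cnj (w $ j))"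
    unfolding sum_distrib_left sum_distrib_right by (subst sum.swap) (simp add: mult_ac)
  also have "\<dots> = (\<Sum>j\<in>UNIV. (conj_transpose g *v x) $ j * cnj (w $ j))"
    by (simp add: matrix_vector_mult_def conj_transpose_def)
  also have "conj_transpose g *v x = (conj_transpose g ** H_mat ** g) *v v"
    by (simp add: x_def matrix_vector_mul_assoc matrix_mul_assoc)
  finally show ?thesis .
qed

lemma hform_U_n1: "g \<in> U_n1 \<Longrightarrow> hform (g *v v) (g *v w) = hform v w"
  by (simp only: hform_mult_both) (simp add: U_n1_def hform_H_mat)

lemma qform_U_n1: "g \<in> U_n1 \<Longrightarrow> qform (g *v v) = qform v"
  using hform_U_n1[of g v v] by (simp add: hform_self)

lemma half_cosh_U_n1: "g \<in> U_n1 \<Longrightarrow> half_cosh (g *v v) (g *v w) = half_cosh v w"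
  by (simp add: half_cosh_def hform_U_n1 qform_U_n1)

lemma half_tanh_sq_U_n1: "g \<in> U_n1 \<Longrightarrow> half_tanh_sq (g *v v) (g *v w) = half_tanh_sq v w"
  by (simp add: half_tanh_sq_def half_cosh_U_n1)

lemma U_n1_I:
  fixes g :: "('n::finite) cmat1"
  assumes "\<And>v w. hform (g *v v) (g *v w) = hform v w"
  shows "g \<in> U_n1"
proof -
  have "(\<Sum>j\<in>UNIV. ((conj_transpose g ** H_mat ** g) *v v) $ j * cnj (w $ j))
      = (\<Sum>j\<in>UNIV. (H_mat *v v) $ j * cnj (w $ j))" for v w
    using assms[of v w, unfolded hform_mult_both] by (simp only: hform_H_mat)
  from this[of _ "axis i 1" for i]
  have "((conj_transpose g ** H_mat ** g) *v v) $ i = (H_mat *v v) $ i" for v i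
    by (simp add: axis_def if_distrib cong: if_cong)
  then have "(conj_transpose g ** H_mat ** g) *v v = H_mat *v v" for v
    by (simp add: vec_eq_iff)
  then show ?thesis by (simp add: U_n1_def matrix_eq)
qed

lemma U_n1_mult: "g \<in> U_n1 \<Longrightarrow> h \<in> U_n1 \<Longrightarrow> g ** h \<in> U_n1"
  by (rule U_n1_I) (simp add: hform_U_n1 flip: matrix_vector_mul_assoc)

lemma
  assumes g: "g \<in> U_n1"
  shows H_adjoint_mult: "H_adjoint g ** g = mat 1"
    and mult_H_adjoint: "g ** H_adjoint g = mat 1"
    and H_adjoint_U_n1: "H_adjoint g \<in> U_n1"
proof -
  have "H_adjoint g ** g = H_mat ** (conj_transpose g ** H_mat ** g)"
    by (simp add: H_adjoint_def matrix_mul_assoc)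
  then show "H_adjoint g ** g = mat 1" using g by (simp add: U_n1_def H_mat_H_mat)
  then show right: "g ** H_adjoint g = mat 1" by (simp add: matrix_left_right_inverse)
  show "H_adjoint g \<in> U_n1"
  proof (rule U_n1_I)
    fix v w
    have "hform (H_adjoint g *v v) (H_adjoint g *v w)
        = hform (g *v (H_adjoint g *v v)) (g *v (H_adjoint g *v w))"
      by (simp add: hform_U_n1[OF g])
    then show "hform (H_adjoint g *v v) (H_adjoint g *v w) = hform v w"
      by (simp add: matrix_vector_mul_assoc right)
  qed
qed

lemma linear_complex_matrix: "linear ((*v) A)" for A :: "complex ^ 'a ^ 'b"
  by (auto simp: linear_iff vec_eq_iff matrix_vector_mult_def scaleR_sum_right distrib_left
      sum.distrib)

lemma continuous_on_complex_matrix [continuous_intros]: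
  fixes A :: "complex ^ 'a ^ 'b"
  shows "continuous_on S f \<Longrightarrow> continuous_on S (\<lambda>x. A *v f x)"
  by (rule continuous_on_compose2[OF linear_continuous_on[of "(*v) A" UNIV]])
    (auto simp: linear_complex_matrix simp flip: linear_conv_bounded_linear)

lemma nn_integral_U_n1:
  assumes "g \<in> U_n1" and "\<phi> \<in> borel_measurable borel"
  shows "(\<integral>\<^sup>+v. \<phi> (g *v v) \<partial>lborel) = (\<integral>\<^sup>+v. \<phi> v \<partial>lborel)"
proof (rule nn_integral_preserved_form[OF _ linear_complex_matrix])
  show "inj ((*v) (H_mat :: 'a cmat1))"
    by (rule inj_on_inverseI[of _ "(*v) H_mat"])
      (simp add: matrix_vector_mul_assoc H_mat_H_mat)
  show "(g *v x) \<bullet> (H_mat *v (g *v y)) = x \<bullet> (H_mat *v y)" for x y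
    by (simp add: inner_H_mat hform_U_n1[OF assms(1)])
qed (simp_all add: linear_complex_matrix assms)

definition reflection ::
    "complex ^ ('n::finite option) \<Rightarrow> complex ^ ('n option) \<Rightarrow> complex ^ ('n option)" where
  "reflection v x = x - (2 * hform x v / hform v v) *s v"

lemma hform_reflection:
  assumes "hform v v \<noteq> 0"
  shows "hform (reflection v x) (reflection v y) = hform x y"
proof -
  define d where "d = hform v v"
  have "cnj d = d" by (simp add: d_def cnj_hform)
  then have "hform (reflection v x) (reflection v y)
      = hform x y - 2 * hform v y / d * hform x v - 2 * hform x v / d * hform v y
        + 2 * hform x v / d * (2 * hform v y / d) * d"
    by (simp add: reflection_def hform_diff_left hform_diff_right hform_smult_left
        hform_smult_right cnj_hform algebra_simps flip: d_def)
  then show ?thesis using assms by (simp add: d_def)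
qed

lemma reflection_diff:
  assumes same_norm: "hform x x = hform y y" and symmetric: "hform x y = hform y x"
    and nondegenerate: "hform (x - y) (x - y) \<noteq> 0"
  shows "reflection (x - y) x = y"
proof -
  have "hform (x - y) (x - y) = 2 * hform x (x - y)"
    using same_norm symmetric by (simp add: hform_diff_left hform_diff_right)
  then show ?thesis using nondegenerate by (simp add: reflection_def)
qed

lemma reflection_matrix_U_n1:
  assumes "hform v v \<noteq> 0"
  obtains R where "R \<in> U_n1" "\<And>x. R *v x = reflection v x"
proof -
  have "Vector_Spaces.linear (*s) (*s) (reflection v)"
    by unfold_locales
      (simp_all add: reflection_def hform_add_left hform_smult_left vec_eq_iff field_simps
        add_divide_distrib)
  then have matrix_vec: "matrix (reflection v) *v x = reflection v x" for x
    by (rule matrix_works)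
  then have "matrix (reflection v) \<in> U_n1"
    by (intro U_n1_I) (simp add: hform_reflection[OF assms])
  then show ?thesis using matrix_vec that by blast
qed

lemma U_n1_transitive:
  fixes p :: "complex ^ ('n::finite option)"
  assumes p: "qform p > 0"
  obtains g c where "g \<in> U_n1" "c \<noteq> 0" "g *v lift 0 = c *s p"
proof -
  note p_lift = lift_dehom[OF qform_pos_imp_nth_None[OF p]]
  define z where "z = dehom p"
  show ?thesis
  proof (cases "z = 0")
    case True
    have "mat 1 *v lift 0 = (1 / p $ None) *s p"
      by (subst p_lift) (simp add: True qform_pos_imp_nth_None[OF p] flip: z_def)
    moreover have "mat 1 \<in> (U_n1 :: 'n cmat1 set)" by (rule U_n1_I) simp
    ultimately show ?thesis
      using that[of "mat 1" "1 / p $ None"] qform_pos_imp_nth_None[OF p] by simp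
  next
    case False
    define b where "b = 1 / sqrt (1 - (norm z)\<^sup>2)"
    have "0 < 1 - (norm z)\<^sup>2" using dehom_in_unit_ball[OF p] by (simp add: z_def unit_ball_def)
    then have scaling: "b\<^sup>2 * (1 - (norm z)\<^sup>2) = 1" "b > 1"
      using False by (simp_all add: b_def power_divide)
    define y where "y = complex_of_real b *s lift z"
    define e :: "complex ^ 'n option" where "e = lift 0"
    have "hform y y = -1"
      using scaling(1) by (simp add: y_def hform_self qform_smult qform_lift)
    moreover have "hform e e = -1" "hform e y = - b" "hform y e = - b"
      by (simp_all add: e_def y_def hform_smult_left hform_smult_right hform_lift herm_form_def)
    ultimately have reflectable: "hform e e = hform y y" "hform e y = hform y e"
      "hform (e - y) (e - y) \<noteq> 0"
      using scaling(2) by (simp_all add: hform_diff_left hform_diff_right complex_eq_iff)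
    obtain R where "R \<in> U_n1" "R *v e = y"
      using reflection_matrix_U_n1[OF reflectable(3)] reflection_diff[OF reflectable] by metis
    moreover have "y = (b / p $ None) *s p"
      unfolding y_def z_def by (subst (2) p_lift) (simp add: qform_pos_imp_nth_None[OF p])
    ultimately show ?thesis
      using that[of R "b / p $ None"] scaling(2) qform_pos_imp_nth_None[OF p] by (simp add: e_def)
  qed
qed

definition phase_mat :: "complex \<Rightarrow> ('n::finite) cmat1" where
  "phase_mat \<omega> = (\<chi> i j. if i = j then (if i = None then \<omega> else 1) else 0)"

lemma phase_mat_vec: "(phase_mat \<omega> *v v) $ i = (if i = None then \<omega> * v $ i else v $ i)"
  by (simp add: matrix_vector_mult_def phase_mat_def if_distrib[of "\<lambda>x. x * _"] cong: if_cong)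

lemma phase_mat_U_n1: "cmod \<omega> = 1 \<Longrightarrow> phase_mat \<omega> \<in> U_n1"
  using complex_norm_square[of \<omega>] by (intro U_n1_I) (simp add: hform_def phase_mat_vec)

section \<open>The mean value inequality\<close>

lemma prod_roots_unity:
  fixes c :: complex
  assumes "N > 0"
  shows "(\<Prod>\<omega> | \<omega> ^ N = 1. 1 - \<omega> * c) = 1 - c ^ N"
proof -
  define Z where "Z = {\<omega> :: complex. \<omega> ^ N = 1}"
  have roots: "finite Z" "card Z = N" "0 \<notin> Z"
    using assms by (simp_all add: Z_def finite_roots_unity card_roots_unity_eq zero_power)
  define p where "p = (\<Prod>\<omega>\<in>Z. [:1, - \<omega>:])"
  have poly_p: "poly p x = (\<Prod>\<omega>\<in>Z. 1 - \<omega> * x)" for x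
    by (simp add: p_def poly_prod mult.commute)
  have "p = 1 - monom 1 N"
  proof (rule poly_eqI_degree)
    fix x assume "x \<in> insert 0 Z"
    then consider "x = 0" | "x \<in> Z" "inverse x \<in> Z"
      by (auto simp: Z_def power_inverse)
    then show "poly p x = poly (1 - monom 1 N) x"
    proof cases
      case 1
      then show ?thesis using assms by (simp add: poly_p poly_monom)
    next
      case 2
      then have "1 - inverse x * x = 0" using roots(3) by (metis diff_self left_inverse)
      then have "poly p x = 0" using 2 roots(1) unfolding poly_p by (metis prod_zero)
      then show ?thesis using 2 by (simp add: Z_def poly_monom)
    qed
  next
    have "degree p \<le> (\<Sum>\<omega>\<in>Z. degree [:1, - \<omega>:])"
      using degree_prod_sum_le[OF roots(1), of "\<lambda>\<omega>. [:1, - \<omega>:]"] by (simp add: p_def o_def)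
    also have "\<dots> \<le> (\<Sum>\<omega>\<in>Z. 1)" by (intro sum_mono) simp
    finally show "degree p < card (insert 0 Z)" using roots by simp
    show "degree (1 - monom 1 N :: complex poly) < card (insert 0 Z)"
      using roots by (auto intro!: degree_diff_less degree_monom_le[THEN le_less_trans])
  qed
  then show ?thesis using poly_p[of c] by (simp add: Z_def poly_monom)
qed

text \<open>This is the inequality of arithmetic and geometric means: the product of the terms is
  \<open>1 / |1 - c\<^sup>N|\<^sup>k \<ge> 2\<^sup>-\<^sup>k\<close>.\<close>

lemma sum_roots_unity_inverse_power_ge:
  fixes c :: complex
  assumes N_pos: "N > 0" and c_less_1: "cmod c < 1"
  shows "real N * 2 powr (- real k / N) \<le> (\<Sum>\<omega> | \<omega> ^ N = 1. 1 / cmod (1 - \<omega> * c) ^ k)"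
proof -
  define Z where "Z = {\<omega> :: complex. \<omega> ^ N = 1}"
  have roots: "finite Z" "card Z = N" "Z \<noteq> {}"
    using N_pos by (auto simp: Z_def finite_roots_unity card_roots_unity_eq intro: exI[of _ 1])
  have "0 < cmod (1 - c ^ N)"
    using N_pos c_less_1 power_less_one_iff[of "cmod c" N] by (auto simp flip: norm_power)
  moreover have "cmod (1 - c ^ N) \<le> 2"
    using norm_triangle_ineq4[of 1 "c ^ N"] power_le_one[of "cmod c" N] c_less_1
    by (simp add: norm_power)
  ultimately have "2 powr (- real k / N) \<le> cmod (1 - c ^ N) powr (- real k / N)"
    by (intro powr_mono2') auto
  also have "\<dots> = (1 / cmod (1 - c ^ N) ^ k) powr (1 / N)"
    using \<open>0 < cmod (1 - c ^ N)\<close>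
    by (simp add: powr_divide powr_minus_divide powr_powr flip: powr_realpow)
  also have "1 / cmod (1 - c ^ N) ^ k = (\<Prod>\<omega>\<in>Z. 1 / cmod (1 - \<omega> * c) ^ k)"
    by (simp add: Z_def prod_dividef prod_norm prod_roots_unity[OF N_pos] flip: prod_power_distrib)
  also have "(\<Prod>\<omega>\<in>Z. 1 / cmod (1 - \<omega> * c) ^ k) powr (1 / N)
      \<le> (\<Sum>\<omega>\<in>Z. 1 / cmod (1 - \<omega> * c) ^ k) / N"
    using arith_geom_mean[OF roots(1,3), of "\<lambda>\<omega>. 1 / cmod (1 - \<omega> * c) ^ k"]
    by (simp add: roots(2) sum_divide_distrib)
  finally show ?thesis using N_pos by (simp add: Z_def pos_le_divide_eq mult.commute)
qed

definition neg_shell :: "(complex ^ ('n::finite option)) set" where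
  "neg_shell = {v. 1 < qform v \<and> qform v < 2}"

lemma qform_pos_of_neg_shell: "v \<in> neg_shell \<Longrightarrow> qform v > 0"
  by (simp add: neg_shell_def)

lemma measurable_neg_shell [measurable]: "neg_shell \<in> sets borel"
  unfolding neg_shell_def by measurable

lemma neg_shell_U_n1: "g \<in> U_n1 \<Longrightarrow> g *v v \<in> neg_shell \<longleftrightarrow> v \<in> neg_shell"
  by (simp add: neg_shell_def qform_U_n1)

lemma nn_integral_neg_shell_U_n1:
  assumes g: "g \<in> U_n1" and [measurable]: "f \<in> borel_measurable borel"
  shows "(\<integral>\<^sup>+v\<in>neg_shell. f (g *v v) \<partial>lborel) = (\<integral>\<^sup>+v\<in>neg_shell. f v \<partial>lborel)"
  using nn_integral_U_n1[OF g, of "\<lambda>v. f v * indicator neg_shell v"]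
  by (simp add: indicator_def neg_shell_U_n1[OF g])

lemma measurable_vec_nth_complex [measurable]:
  "(\<lambda>v :: complex ^ 'a. v $ i) \<in> borel_measurable borel"
  by (intro borel_measurable_continuous_onI continuous_intros)

lemma measurable_ball_pairing_dehom [measurable]:
  "(\<lambda>v. ball_pairing (dehom v) z) \<in> borel_measurable borel"
  unfolding ball_pairing_def dehom_def by simp

lemma dehom_phase_mat: "dehom (phase_mat \<omega> *v v) = (1 / \<omega>) *s dehom v"
  by (simp add: dehom_def vec_eq_iff phase_mat_vec)

lemma ball_pairing_smult_left:
  "ball_pairing (c *s z) w = 1 - c * (1 - ball_pairing z w)"
  by (simp add: ball_pairing_def sum_distrib_left mult.assoc)

lemma cmod_one_minus_ball_pairing_less_1:
  assumes "z \<in> unit_ball" "w \<in> unit_ball"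
  shows "cmod (1 - ball_pairing z w) < 1"
proof -
  have "cmod (1 - ball_pairing z w) \<le> norm z * norm w"
    using cmod_sum_le_norm[of z w] by (simp add: ball_pairing_def)
  also have "\<dots> < 1"
    using assms mult_strict_mono'[of "norm z" 1 "norm w" 1] by (simp add: unit_ball_iff)
  finally show ?thesis .
qed

context
  fixes w :: "complex ^ 'n::finite" and F :: "complex ^ ('n option) \<Rightarrow> ennreal" and k :: nat
  assumes w: "w \<in> unit_ball" and F [measurable]: "F \<in> borel_measurable borel"
    and phase: "\<And>\<omega> v. cmod \<omega> = 1 \<Longrightarrow> F (phase_mat \<omega> *v v) = F v"
begin

lemma nn_integral_neg_shell_rotate:
  assumes \<omega>: "cmod \<omega> = 1"
  shows "(\<integral>\<^sup>+v\<in>neg_shell. F v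
      * ennreal (1 / cmod (1 - \<omega> * (1 - ball_pairing (dehom v) w)) ^ k) \<partial>lborel)
    = (\<integral>\<^sup>+v\<in>neg_shell. F v * ennreal (1 / cmod (ball_pairing (dehom v) w) ^ k) \<partial>lborel)"
proof -
  define f where "f v = F v * ennreal (1 / cmod (1 - \<omega> * (1 - ball_pairing (dehom v) w)) ^ k)" for v
  have [measurable]: "f \<in> borel_measurable borel" unfolding f_def by measurable
  have "\<omega> \<noteq> 0" using \<omega> by auto
  then have "f (phase_mat \<omega> *v v) = F v * ennreal (1 / cmod (ball_pairing (dehom v) w) ^ k)" for v
    by (simp add: f_def phase[OF \<omega>] dehom_phase_mat ball_pairing_smult_left)
  then show ?thesis
    using nn_integral_neg_shell_U_n1[OF phase_mat_U_n1[OF \<omega>], of f] by (simp add: f_def)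
qed

lemma neg_shell_phase_average_le:
  "ennreal (2 powr (- real k / Suc N)) * (\<integral>\<^sup>+v\<in>neg_shell. F v \<partial>lborel)
    \<le> (\<integral>\<^sup>+v\<in>neg_shell. F v * ennreal (1 / cmod (ball_pairing (dehom v) w) ^ k) \<partial>lborel)"
    (is "_ * ?I \<le> ?J")
proof -
  define c where "c v = 1 - ball_pairing (dehom v) w" for v
  have [measurable]: "c \<in> borel_measurable borel" unfolding c_def by simp
  define Z where "Z = {\<omega> :: complex. \<omega> ^ Suc N = 1}"
  have roots: "finite Z" "card Z = Suc N"
    unfolding Z_def by (rule finite_roots_unity, simp) (rule card_roots_unity_eq, simp)
  have Z_unit: "cmod \<omega> = 1" if "\<omega> \<in> Z" for \<omega>
    using that power_eq_1_iff[of \<omega> "Suc N"] by (simp add: Z_def del: power_Suc)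
  have "ennreal (Suc N) * (ennreal (2 powr (- real k / Suc N)) * ?I)
      = ennreal (Suc N * 2 powr (- real k / Suc N)) * ?I"
    by (simp add: ennreal_mult mult.assoc del: of_nat_Suc)
  also have "\<dots> = (\<integral>\<^sup>+v\<in>neg_shell. F v * ennreal (Suc N * 2 powr (- real k / Suc N)) \<partial>lborel)"
    by (subst nn_integral_cmult[symmetric]) (auto simp: mult_ac)
  also have "\<dots> \<le> (\<integral>\<^sup>+v\<in>neg_shell. F v * ennreal (\<Sum>\<omega>\<in>Z. 1 / cmod (1 - \<omega> * c v) ^ k) \<partial>lborel)"
  proof (intro nn_integral_mono)
    fix v :: "complex ^ 'n option"
    have "Suc N * 2 powr (- real k / Suc N) \<le> (\<Sum>\<omega>\<in>Z. 1 / cmod (1 - \<omega> * c v) ^ k)"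
      if "v \<in> neg_shell"
      unfolding Z_def c_def
      by (intro sum_roots_unity_inverse_power_ge cmod_one_minus_ball_pairing_less_1 w
          dehom_in_unit_ball qform_pos_of_neg_shell that) simp
    then show "F v * ennreal (Suc N * 2 powr (- real k / Suc N)) * indicator neg_shell v
        \<le> F v * ennreal (\<Sum>\<omega>\<in>Z. 1 / cmod (1 - \<omega> * c v) ^ k) * indicator neg_shell v"
      by (auto simp: indicator_def intro!: mult_left_mono ennreal_leI)
  qed
  also have "\<dots> = (\<Sum>\<omega>\<in>Z. \<integral>\<^sup>+v\<in>neg_shell. F v * ennreal (1 / cmod (1 - \<omega> * c v) ^ k) \<partial>lborel)"
    by (subst nn_integral_sum[symmetric])
      (auto simp: sum_distrib_left sum_distrib_right simp flip: sum_ennreal)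
  also have "\<dots> = (\<Sum>\<omega>\<in>Z. ?J)"
    unfolding c_def by (intro sum.cong refl nn_integral_neg_shell_rotate Z_unit)
  also have "\<dots> = ennreal (Suc N) * ?J"
    by (simp add: roots ennreal_of_nat_eq_real_of_nat del: of_nat_Suc)
  finally show ?thesis by (simp add: ennreal_mult_le_mult_iff)
qed

lemma neg_shell_phase_average:
  "(\<integral>\<^sup>+v\<in>neg_shell. F v \<partial>lborel)
    \<le> (\<integral>\<^sup>+v\<in>neg_shell. F v * ennreal (1 / cmod (ball_pairing (dehom v) w) ^ k) \<partial>lborel)"
    (is "?I \<le> ?J")
proof -
  have "(\<lambda>N. 2 powr (- real k / Suc N)) \<longlonglongrightarrow> 2 powr 0"
    by (intro tendsto_powr tendsto_const lim_const_over_n[THEN LIMSEQ_Suc]) simp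
  then have "(\<lambda>N. ennreal (2 powr (- real k / Suc N)) * ?I) \<longlonglongrightarrow> ennreal (2 powr 0) * ?I"
    by (intro tendsto_mult_ennreal tendsto_ennrealI tendsto_const) auto
  then show ?thesis
    using neg_shell_phase_average_le by (intro LIMSEQ_le_const2[of _ ?I ?J]) auto
qed

end

definition shell_integral ::
    "complex ^ ('n::finite option) \<Rightarrow> complex ^ ('n option) \<Rightarrow> nat \<Rightarrow> (real \<Rightarrow> real) \<Rightarrow> ennreal" where
  "shell_integral p q k H
    = (\<integral>\<^sup>+v\<in>neg_shell. ennreal (H (half_tanh_sq q v) / half_cosh p v ^ k) \<partial>lborel)"

lemma shell_integral_U_n1:
  assumes g: "g \<in> U_n1" and [measurable]: "H \<in> borel_measurable borel"
  shows "shell_integral (g *v p) (g *v q) k H = shell_integral p q k H"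
  unfolding shell_integral_def
  by (subst nn_integral_neg_shell_U_n1[OF g, symmetric])
    (simp_all add: half_cosh_U_n1[OF g] half_tanh_sq_U_n1[OF g])

lemma shell_integral_smult_right:
  "c \<noteq> 0 \<Longrightarrow> shell_integral p (c *s q) k H = shell_integral p q k H"
  by (simp add: shell_integral_def half_tanh_sq_def half_cosh_smult_left)

lemma shell_integral_smult_left:
  "c \<noteq> 0 \<Longrightarrow> shell_integral (c *s p) q k H = shell_integral p q k H"
  by (simp add: shell_integral_def half_cosh_smult_left)

lemma shell_integral_self_eq:
  fixes p q :: "complex ^ ('n::finite option)"
  assumes p: "qform p > 0" and q: "qform q > 0" and H: "H \<in> borel_measurable borel"
  shows "shell_integral p p k H = shell_integral q q k H"
proof -
  have "shell_integral x x k H = shell_integral (lift 0) (lift (0 :: complex ^ 'n)) k H"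
    if x: "qform x > 0" for x :: "complex ^ 'n option"
  proof -
    obtain g c where g: "g \<in> U_n1" "c \<noteq> 0" "g *v lift 0 = c *s x"
      using U_n1_transitive[OF x] .
    then show ?thesis
      using shell_integral_U_n1[OF g(1) H, of "lift 0" "lift 0" k]
      by (simp add: shell_integral_smult_left shell_integral_smult_right)
  qed
  then show ?thesis using p q by metis
qed

lemma half_cosh_lift_0_phase_mat:
  "cmod \<omega> = 1 \<Longrightarrow> half_cosh (lift 0) (phase_mat \<omega> *v v) = half_cosh (lift 0) v"
  by (simp add: half_cosh_def qform_U_n1[OF phase_mat_U_n1] hform_def phase_mat_vec norm_mult)

lemma half_cosh_power_eq_ball_pairing:
  assumes "qform v > 0" "qform w > 0"
  shows "1 / half_cosh w (lift 0) ^ k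
      * (h / half_cosh (lift 0) v ^ k * (1 / cmod (ball_pairing (dehom v) (dehom w)) ^ k))
    = h / half_cosh w v ^ k"
  using half_cosh_eq_ball_pairing[OF assms]
  by (simp add: half_cosh_commute[of w] power_mult_distrib)

lemma shell_integral_mean_value_lift_0:
  fixes w :: "complex ^ ('n::finite option)"
  assumes w: "qform w > 0" and H: "\<And>x. H x \<ge> 0" and [measurable]: "H \<in> borel_measurable borel"
  shows "ennreal (1 / half_cosh w (lift 0) ^ k)
      * shell_integral (lift 0) (lift (0 :: complex ^ 'n)) k H
    \<le> shell_integral w (lift 0) k H"
proof -
  define e :: "complex ^ 'n option" where "e = lift 0"
  define a where "a = 1 / half_cosh w e ^ k"
  define F where "F v = ennreal (H (half_tanh_sq e v) / half_cosh e v ^ k)" for v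
  define P where "P v = 1 / cmod (ball_pairing (dehom v) (dehom w)) ^ k"
    for v :: "complex ^ 'n option"
  have [measurable]: "F \<in> borel_measurable borel" "P \<in> borel_measurable borel"
    unfolding F_def P_def by measurable
  have "F (phase_mat \<omega> *v v) = F v" if "cmod \<omega> = 1" for \<omega> v
    by (simp add: F_def half_tanh_sq_def e_def half_cosh_lift_0_phase_mat[OF that])
  then have "shell_integral e e k H \<le> (\<integral>\<^sup>+v\<in>neg_shell. F v * ennreal (P v) \<partial>lborel)"
    unfolding P_def shell_integral_def F_def[symmetric]
    by (intro neg_shell_phase_average dehom_in_unit_ball w) auto
  then have "ennreal a * shell_integral e e k H
      \<le> ennreal a * (\<integral>\<^sup>+v\<in>neg_shell. F v * ennreal (P v) \<partial>lborel)"
    by (rule mult_left_mono) simp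
  also have "\<dots> = (\<integral>\<^sup>+v\<in>neg_shell. ennreal a * (F v * ennreal (P v)) \<partial>lborel)"
    by (subst nn_integral_cmult[symmetric]) (auto simp: mult.assoc)
  also have "\<dots> = shell_integral w e k H"
    unfolding shell_integral_def
  proof (intro set_nn_integral_cong refl)
    fix v :: "complex ^ 'n option" assume "v \<in> space lborel \<inter> neg_shell"
    then have v: "qform v > 0" by (simp add: qform_pos_of_neg_shell)
    have qform_e: "qform e > 0" by (simp add: e_def qform_lift)
    have "a * (H (half_tanh_sq e v) / half_cosh e v ^ k * P v)
        = H (half_tanh_sq e v) / half_cosh w v ^ k"
      unfolding a_def P_def e_def by (rule half_cosh_power_eq_ball_pairing[OF v w])
    moreover have "a \<ge> 0" "P v \<ge> 0" "H (half_tanh_sq e v) / half_cosh e v ^ k \<ge> 0"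
      using half_cosh_ge_1[OF w qform_e] half_cosh_ge_1[OF qform_e v] H by (auto simp: a_def P_def)
    ultimately show "ennreal a * (F v * ennreal (P v))
        = ennreal (H (half_tanh_sq e v) / half_cosh w v ^ k)"
      unfolding F_def by (simp only: ennreal_mult[symmetric] mult_nonneg_nonneg)
  qed
  finally show ?thesis by (simp add: a_def e_def)
qed

lemma shell_integral_mean_value:
  fixes p q :: "complex ^ ('n::finite option)"
  assumes p: "qform p > 0" and q: "qform q > 0"
    and H: "\<And>x. H x \<ge> 0" "H \<in> borel_measurable borel"
  shows "ennreal (1 / half_cosh p q ^ k) * shell_integral q q k H \<le> shell_integral p q k H"
proof -
  obtain g c where g: "g \<in> U_n1" "c \<noteq> 0" "g *v lift 0 = c *s q" using U_n1_transitive[OF q] .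
  define w where "w = H_adjoint g *v p"
  have p_eq: "g *v w = p" by (simp add: w_def matrix_vector_mul_assoc mult_H_adjoint[OF g(1)])
  have "half_cosh w (lift 0) = half_cosh (g *v w) (g *v lift 0)"
    by (rule half_cosh_U_n1[OF g(1), symmetric])
  also have "\<dots> = half_cosh p q" by (simp add: p_eq g half_cosh_smult_right)
  finally have half_cosh_eq: "half_cosh w (lift 0) = half_cosh p q" .
  have "shell_integral w (lift 0) k H = shell_integral (g *v w) (g *v lift 0) k H"
    by (rule shell_integral_U_n1[OF g(1) H(2), symmetric])
  also have "\<dots> = shell_integral p q k H" by (simp add: p_eq g shell_integral_smult_right)
  finally have "shell_integral w (lift 0) k H = shell_integral p q k H" .
  moreover have "qform w > 0" using p qform_U_n1[OF g(1), of w] by (simp add: p_eq)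
  moreover have "shell_integral q q k H
      = shell_integral (lift 0) (lift 0 :: complex ^ 'n option) k H"
    using q H(2) by (intro shell_integral_self_eq) (auto simp: qform_lift)
  ultimately show ?thesis
    using shell_integral_mean_value_lift_0[of w H k] H by (simp add: half_cosh_eq)
qed

lemma packing_inequality:
  fixes p :: "complex ^ ('n::finite option)" and q :: "'i \<Rightarrow> complex ^ ('n option)"
  assumes p: "qform p > 0" and I: "finite I" and q: "\<And>i. i \<in> I \<Longrightarrow> qform (q i) > 0"
    and H: "\<And>x. H x \<ge> 0" and [measurable]: "H \<in> borel_measurable borel"
    and overlap: "\<And>v. qform v > 0 \<Longrightarrow> (\<Sum>i\<in>I. H (half_tanh_sq (q i) v)) \<le> 1"
  shows "(\<Sum>i\<in>I. ennreal (1 / half_cosh p (q i) ^ k)) * shell_integral p p k H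
    \<le> shell_integral p p k (\<lambda>_. 1)"
proof -
  have "(\<Sum>i\<in>I. ennreal (1 / half_cosh p (q i) ^ k)) * shell_integral p p k H
      \<le> (\<Sum>i\<in>I. shell_integral p (q i) k H)"
    unfolding sum_distrib_right
  proof (rule sum_mono)
    fix i assume i: "i \<in> I"
    have "shell_integral p p k H = shell_integral (q i) (q i) k H"
      using p q[OF i] by (intro shell_integral_self_eq) auto
    then show "ennreal (1 / half_cosh p (q i) ^ k) * shell_integral p p k H
        \<le> shell_integral p (q i) k H"
      using shell_integral_mean_value[OF p q[OF i] H] by simp
  qed
  also have "\<dots> = (\<integral>\<^sup>+v\<in>neg_shell.
      (\<Sum>i\<in>I. ennreal (H (half_tanh_sq (q i) v) / half_cosh p v ^ k)) \<partial>lborel)"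
    unfolding shell_integral_def
    by (subst nn_integral_sum[symmetric]) (auto simp: sum_distrib_right)
  also have "\<dots> \<le> shell_integral p p k (\<lambda>_. 1)"
    unfolding shell_integral_def
  proof (intro nn_integral_mono)
    fix v :: "complex ^ 'n option"
    have "(\<Sum>i\<in>I. ennreal (H (half_tanh_sq (q i) v) / half_cosh p v ^ k))
        \<le> ennreal (1 / half_cosh p v ^ k)"
      if "v \<in> neg_shell"
    proof -
      have v: "qform v > 0" using that by (rule qform_pos_of_neg_shell)
      then have "half_cosh p v ^ k > 0" using half_cosh_ge_1[OF p v] by simp
      then show ?thesis
        using overlap[OF v] H
        by (simp add: divide_right_mono flip: sum_divide_distrib)
    qed
    then show "(\<Sum>i\<in>I. ennreal (H (half_tanh_sq (q i) v) / half_cosh p v ^ k))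
        * indicator neg_shell v
        \<le> ennreal (1 / half_cosh p v ^ k) * indicator neg_shell v"
      by (auto simp: indicator_def)
  qed
  finally show ?thesis .
qed

section \<open>Reduction to radial integrals\<close>

lemma nn_integral_scaleR:
  fixes f :: "'a::euclidean_space \<Rightarrow> ennreal"
  assumes c: "c \<noteq> 0" and [measurable]: "f \<in> borel_measurable borel"
  shows "(\<integral>\<^sup>+x. f x \<partial>lborel) = ennreal (\<bar>c\<bar> ^ DIM('a)) * (\<integral>\<^sup>+x. f (c *\<^sub>R x) \<partial>lborel)"
proof -
  have "(\<integral>\<^sup>+x. f x \<partial>lborel)
      = (\<integral>\<^sup>+x. f x \<partial>density (distr lborel borel (\<lambda>x. c *\<^sub>R x)) (\<lambda>_. \<bar>c\<bar> ^ DIM('a)))"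
    using lborel_affine[OF c, of "0 :: 'a"] by simp
  also have "\<dots> = ennreal (\<bar>c\<bar> ^ DIM('a)) * (\<integral>\<^sup>+x. f (c *\<^sub>R x) \<partial>lborel)"
    by (simp add: nn_integral_density nn_integral_distr nn_integral_cmult)
  finally show ?thesis .
qed

lemma linear_vec_join: "linear vec_join"
  by (auto simp: linear_iff vec_eq_iff split_option_all)

lemma lborel_distr_vec_join:
  "distr lborel borel (vec_join :: (complex ^ 'n::finite) \<times> complex \<Rightarrow> _) = lborel"
proof (rule lborel_distr_basis_bij[OF linear_vec_join])
  have axis: "vec_join (axis j u, 0) = axis (Some j) u"
    "vec_join (0 :: complex ^ 'n, u) = axis None u"
    for j :: 'n and u
    by (auto simp: vec_eq_iff axis_def split_option_all)
  have "inj (vec_join :: (complex ^ 'n) \<times> complex \<Rightarrow> _)"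
    by (auto simp: inj_def vec_eq_iff prod_eq_iff split_option_all)
  moreover have "vec_join ` Basis = (Basis :: (complex ^ ('n option)) set)"
  proof -
    have "vec_join ` Basis = (\<Union>j. (\<lambda>u. vec_join (axis (j::'n) u, 0)) ` Basis)
        \<union> (\<lambda>u. vec_join (0 :: complex ^ 'n, u)) ` Basis"
      by (auto simp: Basis_prod_def Basis_vec_def image_iff)
    also have "\<dots> = (\<Union>i. axis i ` Basis)"
      unfolding axis by (auto simp: image_iff) (metis not_Some_eq)
    also have "\<dots> = Basis" by (auto simp: Basis_vec_def)
    finally show ?thesis .
  qed
  ultimately show "bij_betw vec_join Basis (Basis :: (complex ^ ('n option)) set)"
    by (auto simp: bij_betw_def intro: inj_on_subset)
qed

lemma measurable_vec_join_slice [measurable]: "(\<lambda>x. vec_join (x, \<mu>)) \<in> borel_measurable borel"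
  by (rule borel_measurable_continuous_onI)
    (auto intro!: continuous_intros
      continuous_on_compose2[OF linear_continuous_on[of vec_join UNIV]] simp: linear_vec_join simp flip: linear_conv_bounded_linear)

lemma nn_integral_vec_join:
  fixes f :: "complex ^ ('n::finite option) \<Rightarrow> ennreal"
  assumes [measurable]: "f \<in> borel_measurable borel"
  shows "(\<integral>\<^sup>+v. f v \<partial>lborel) = (\<integral>\<^sup>+\<mu>. \<integral>\<^sup>+x. f (vec_join (x, \<mu>)) \<partial>lborel \<partial>lborel)"
proof -
  have [measurable]: "vec_join \<in> borel_measurable (borel :: ((complex ^ 'n) \<times> complex) measure)"
    by (rule borel_measurable_linear[OF linear_vec_join])
  have "(\<integral>\<^sup>+v. f v \<partial>lborel) = (\<integral>\<^sup>+y. f (vec_join y) \<partial>lborel)"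
    by (subst lborel_distr_vec_join[symmetric]) (simp add: nn_integral_distr)
  also have "\<dots> = (\<integral>\<^sup>+\<mu>. \<integral>\<^sup>+x. f (vec_join (x, \<mu>)) \<partial>lborel \<partial>lborel)"
    unfolding lborel_prod[symmetric] by (subst lborel_pair.nn_integral_snd) (auto simp: lborel_prod)
  finally show ?thesis .
qed

definition annulus_moment :: "nat \<Rightarrow> ennreal" where
  "annulus_moment n = (\<integral>\<^sup>+\<mu>. ennreal (cmod \<mu> ^ (2 * n)) * indicator {1<..<2} ((cmod \<mu>)\<^sup>2) \<partial>lborel)"

lemma annulus_moment_scaled:
  assumes "\<xi> > 0"
  shows "(\<integral>\<^sup>+\<mu>. ennreal (cmod \<mu> ^ (2 * n)) * indicator {1<..<2} ((cmod \<mu>)\<^sup>2 * \<xi>\<^sup>2) \<partial>lborel)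
    = annulus_moment n * ennreal (1 / \<xi> ^ (2 * n + 2))"
proof -
  have "(\<integral>\<^sup>+\<mu>. ennreal (cmod \<mu> ^ (2 * n)) * indicator {1<..<2} ((cmod \<mu>)\<^sup>2 * \<xi>\<^sup>2) \<partial>lborel)
      = ennreal (1 / \<xi> ^ 2) * (\<integral>\<^sup>+\<mu>. ennreal (cmod ((1 / \<xi>) *\<^sub>R \<mu>) ^ (2 * n))
          * indicator {1<..<2} ((cmod ((1 / \<xi>) *\<^sub>R \<mu>))\<^sup>2 * \<xi>\<^sup>2) \<partial>lborel)"
    using assms by (subst nn_integral_scaleR[of "1 / \<xi>"]) (auto simp: power_divide)
  also have "\<dots> = ennreal (1 / \<xi> ^ 2)
      * (\<integral>\<^sup>+\<mu>. ennreal (1 / \<xi> ^ (2 * n)) * (ennreal (cmod \<mu> ^ (2 * n))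
          * indicator {1<..<2} ((cmod \<mu>)\<^sup>2)) \<partial>lborel)"
    using assms
    by (intro arg_cong[of _ _ "\<lambda>x. ennreal (1 / \<xi> ^ 2) * x"] nn_integral_cong)
      (simp add: power_divide power_mult_distrib ennreal_mult[symmetric] mult.assoc[symmetric])
  also have "\<dots> = ennreal (1 / \<xi> ^ 2) * (ennreal (1 / \<xi> ^ (2 * n)) * annulus_moment n)"
    unfolding annulus_moment_def by (subst nn_integral_cmult) auto
  also have "\<dots> = ennreal (1 / \<xi> ^ (2 * n + 2)) * annulus_moment n"
  proof -
    have "ennreal (1 / \<xi> ^ 2) * ennreal (1 / \<xi> ^ (2 * n)) = ennreal (1 / \<xi> ^ 2 * (1 / \<xi> ^ (2 * n)))"
      using assms by (intro ennreal_mult[symmetric]) auto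
    also have "1 / \<xi> ^ 2 * (1 / \<xi> ^ (2 * n)) = 1 / \<xi> ^ (2 * n + 2)"
      by (simp add: power2_eq_square)
    finally show ?thesis by (simp only: mult.assoc[symmetric])
  qed
  finally show ?thesis by (simp add: mult.commute)
qed

lemma nn_integral_annulus_sqrt:
  "(\<integral>\<^sup>+\<mu>. ennreal (cmod \<mu> ^ (2 * n)) * indicator {1<..<2} ((cmod \<mu>)\<^sup>2 * s) \<partial>lborel)
    = annulus_moment n * ennreal (1 / sqrt s ^ (2 * n + 2)) * indicator {0<..} s"
proof (cases "s > 0")
  case True
  then show ?thesis using annulus_moment_scaled[of "sqrt s" n] by simp
next
  case False
  then have "(cmod \<mu>)\<^sup>2 * s \<le> 0" for \<mu> by (simp add: mult_nonneg_nonpos)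
  then have "indicator {1<..<2} ((cmod \<mu>)\<^sup>2 * s) = (0 :: ennreal)" for \<mu>
    by (simp add: indicator_def not_less order_trans[of _ 0])
  then show ?thesis using False by simp
qed

lemma
  shows annulus_moment_pos: "0 < annulus_moment n"
    and annulus_moment_finite: "annulus_moment n < \<infinity>"
proof -
  define A where "A = {\<mu> :: complex. (cmod \<mu>)\<^sup>2 \<in> {1<..<2}}"
  have A_eq: "A = ball 0 (sqrt 2) - cball 0 1"
  proof -
    have "(cmod \<mu>)\<^sup>2 < 2 \<longleftrightarrow> cmod \<mu> < sqrt 2" "1 < (cmod \<mu>)\<^sup>2 \<longleftrightarrow> 1 < cmod \<mu>" for \<mu>
      using real_sqrt_less_iff[of "(cmod \<mu>)\<^sup>2" 2] real_sqrt_less_iff[of 1 "(cmod \<mu>)\<^sup>2"]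
      by simp_all
    then show ?thesis by (auto simp: A_def)
  qed
  have moment: "annulus_moment n = (\<integral>\<^sup>+\<mu>\<in>A. ennreal (((cmod \<mu>)\<^sup>2) ^ n) \<partial>lborel)"
    by (simp add: annulus_moment_def A_def indicator_def power_mult)
  have sqrt2: "1 < sqrt 2" by simp
  have "emeasure lborel A = emeasure lborel (ball (0::complex) (sqrt 2))
      - emeasure lborel (cball (0::complex) 1)"
    unfolding A_eq
    by (rule emeasure_Diff) (auto simp: emeasure_cball intro!: le_less_trans[OF _ sqrt2])
  also have "\<dots> = ennreal (2 * pi) - ennreal pi"
    by (simp add: emeasure_ball emeasure_cball unit_ball_vol_2 mult.commute)
  finally have emeasure_A: "emeasure lborel A = ennreal pi"
    by (simp add: ennreal_minus)
  have [measurable]: "A \<in> sets borel" unfolding A_eq by simp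
  have "0 < emeasure lborel A" by (simp add: emeasure_A)
  also have "\<dots> = (\<integral>\<^sup>+\<mu>. indicator A \<mu> \<partial>lborel)" by simp
  also have "\<dots> \<le> annulus_moment n"
    unfolding moment by (intro nn_integral_mono) (auto simp: A_def indicator_def)
  finally show "0 < annulus_moment n" .
  have "annulus_moment n \<le> (\<integral>\<^sup>+\<mu>. ennreal (2 ^ n) * indicator A \<mu> \<partial>lborel)"
    unfolding moment
    by (intro nn_integral_mono) (auto simp: A_def indicator_def intro!: ennreal_leI power_mono)
  also have "\<dots> < \<infinity>"
    by (simp add: nn_integral_cmult emeasure_A ennreal_mult_less_top)
  finally show "annulus_moment n < \<infinity>" .
qed

lemma norm_dehom_sq:
  assumes "v $ None \<noteq> 0"
  shows "(norm (dehom v))\<^sup>2 = 1 - qform v / (cmod (v $ None))\<^sup>2"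
proof -
  have "qform v = (cmod (v $ None))\<^sup>2 * (1 - (norm (dehom v))\<^sup>2)"
    by (metis lift_dehom[OF assms] qform_smult qform_lift)
  then show ?thesis using assms by simp
qed

lemma measurable_norm_dehom [measurable]: "(\<lambda>v. norm (dehom v)) \<in> borel_measurable borel"
  unfolding dehom_def norm_vec_def L2_set_def by simp

lemma nn_integral_neg_shell_slice:
  fixes \<phi> :: "real \<Rightarrow> ennreal" and \<mu> :: complex
  assumes [measurable]: "\<phi> \<in> borel_measurable borel"
  shows "(\<integral>\<^sup>+x. \<phi> (norm (dehom (vec_join (x, \<mu>)))) * indicator neg_shell (vec_join (x, \<mu>))
        \<partial>(lborel :: (complex ^ 'n::finite) measure))
    = (\<integral>\<^sup>+y. \<phi> (norm y) * (ennreal (cmod \<mu> ^ (2 * CARD('n)))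
        * indicator {1<..<2} ((cmod \<mu>)\<^sup>2 * (1 - (norm y)\<^sup>2))) \<partial>(lborel :: (complex ^ 'n) measure))"
proof (cases "\<mu> = 0")
  case True
  have "vec_join (x, 0) \<notin> neg_shell" for x :: "complex ^ 'n"
    by (simp add: neg_shell_def qform_vec_join not_less order_trans[of _ 0])
  then show ?thesis by (simp add: True zero_power)
next
  case False
  define f where "f x = \<phi> (norm (dehom (vec_join (x, \<mu>)))) * indicator neg_shell (vec_join (x, \<mu>))"
    for x :: "complex ^ 'n"
  have [measurable]: "f \<in> borel_measurable borel" unfolding f_def by measurable
  have f_scaled: "f (cmod \<mu> *\<^sub>R y)
      = \<phi> (norm y) * indicator {1<..<2} ((cmod \<mu>)\<^sup>2 * (1 - (norm y)\<^sup>2))" for y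
  proof -
    define v where "v = vec_join (cmod \<mu> *\<^sub>R y, \<mu>)"
    have qform_v: "qform v = (cmod \<mu>)\<^sup>2 * (1 - (norm y)\<^sup>2)"
      by (simp add: v_def qform_vec_join power_mult_distrib algebra_simps)
    then have "(norm (dehom v))\<^sup>2 = (norm y)\<^sup>2"
      using False by (simp add: norm_dehom_sq v_def)
    then have "norm (dehom v) = norm y" by (simp add: power2_eq_iff_nonneg)
    then show ?thesis by (simp add: f_def neg_shell_def indicator_def qform_v flip: v_def)
  qed
  have "(\<integral>\<^sup>+x. f x \<partial>lborel) = ennreal (cmod \<mu> ^ (2 * CARD('n))) * (\<integral>\<^sup>+y. f (cmod \<mu> *\<^sub>R y) \<partial>lborel)"
    using False nn_integral_scaleR[of "cmod \<mu>" f] by (simp add: mult.commute)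
  also have "\<dots> = (\<integral>\<^sup>+y. ennreal (cmod \<mu> ^ (2 * CARD('n))) * f (cmod \<mu> *\<^sub>R y) \<partial>lborel)"
    by (rule nn_integral_cmult[symmetric]) measurable
  finally show ?thesis unfolding f_scaled by (simp add: f_def mult_ac)
qed

text \<open>The density \<open>(1 - |y|\<^sup>2)\<^sup>-\<^sup>(\<^sup>n\<^sup>+\<^sup>1\<^sup>)\<close> is that of the hyperbolic volume, up to a constant.\<close>

lemma nn_integral_neg_shell_dehom:
  fixes \<phi> :: "real \<Rightarrow> ennreal"
  assumes [measurable]: "\<phi> \<in> borel_measurable borel"
  shows "(\<integral>\<^sup>+v\<in>neg_shell. \<phi> (norm (dehom v)) \<partial>(lborel :: (complex ^ ('n option)) measure))
    = annulus_moment CARD('n) * (\<integral>\<^sup>+y\<in>unit_ball. \<phi> (norm y)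
        * ennreal (1 / sqrt (1 - (norm y)\<^sup>2) ^ (2 * CARD('n) + 2))
          \<partial>(lborel :: (complex ^ 'n::finite) measure))"
proof -
  let ?n = "CARD('n)"
  define A where "A y \<mu> = ennreal (cmod \<mu> ^ (2 * ?n))
      * indicator {1<..<2} ((cmod \<mu>)\<^sup>2 * (1 - (norm y)\<^sup>2))"
    for y :: "complex ^ 'n" and \<mu>
  have [measurable]: "(\<lambda>(y, \<mu>). A y \<mu>) \<in> borel_measurable (borel \<Otimes>\<^sub>M borel)"
    unfolding A_def by measurable
  have "(\<integral>\<^sup>+v\<in>neg_shell. \<phi> (norm (dehom v)) \<partial>(lborel :: (complex ^ ('n option)) measure))
      = (\<integral>\<^sup>+\<mu>. \<integral>\<^sup>+y. \<phi> (norm y) * A y \<mu> \<partial>(lborel :: (complex ^ 'n) measure) \<partial>lborel)"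
    by (subst nn_integral_vec_join) (simp, simp only: nn_integral_neg_shell_slice[OF assms] A_def)
  also have "\<dots> = (\<integral>\<^sup>+y. \<integral>\<^sup>+\<mu>. \<phi> (norm y) * A y \<mu> \<partial>lborel \<partial>(lborel :: (complex ^ 'n) measure))"
    by (rule lborel_pair.Fubini') measurable
  also have "\<dots> = (\<integral>\<^sup>+y. annulus_moment ?n * (\<phi> (norm y)
      * ennreal (1 / sqrt (1 - (norm y)\<^sup>2) ^ (2 * ?n + 2)) * indicator unit_ball y)
        \<partial>(lborel :: (complex ^ 'n) measure))"
  proof (intro nn_integral_cong)
    fix y :: "complex ^ 'n"
    have indicator_unit_ball: "indicator unit_ball y
        = (indicator {0<..} (1 - (norm y)\<^sup>2) :: ennreal)"
      by (simp add: indicator_def unit_ball_def)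
    show "(\<integral>\<^sup>+\<mu>. \<phi> (norm y) * A y \<mu> \<partial>lborel) = annulus_moment ?n * (\<phi> (norm y)
        * ennreal (1 / sqrt (1 - (norm y)\<^sup>2) ^ (2 * ?n + 2)) * indicator unit_ball y)"
      unfolding A_def indicator_unit_ball
      by (subst nn_integral_cmult) (simp_all add: nn_integral_annulus_sqrt, simp add: mult_ac)
  qed
  also have "\<dots> = annulus_moment ?n * (\<integral>\<^sup>+y\<in>unit_ball. \<phi> (norm y)
      * ennreal (1 / sqrt (1 - (norm y)\<^sup>2) ^ (2 * ?n + 2)) \<partial>(lborel :: (complex ^ 'n) measure))"
    using open_unit_ball by (intro nn_integral_cmult) measurable
  finally show ?thesis .
qed

lemma ball_Int_sqrt_superlevel:
  fixes t :: real
  shows "{y \<in> ball (0 :: 'a::real_normed_vector) 1. t < sqrt (1 - (norm y)\<^sup>2)}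
    = ball 0 (sqrt (1 - (min 1 (max 0 t))\<^sup>2))"
proof -
  have "norm y < 1 \<and> t < sqrt (1 - (norm y)\<^sup>2) \<longleftrightarrow> norm y < sqrt (1 - (min 1 (max 0 t))\<^sup>2)"
    for y :: 'a
  proof -
    consider "t < 0" | "0 \<le> t" "t < 1" | "1 \<le> t" by linarith
    then show ?thesis
    proof cases
      case 1
      have "0 \<le> sqrt (1 - (norm y)\<^sup>2)" if "norm y < 1" using that by (simp add: power_le_one)
      then show ?thesis using 1 by (auto intro: less_le_trans)
    next
      case 2
      have "t < sqrt (1 - (norm y)\<^sup>2) \<longleftrightarrow> (norm y)\<^sup>2 < 1 - t\<^sup>2"
        using 2 real_sqrt_less_iff[of "t\<^sup>2" "1 - (norm y)\<^sup>2"] by (simp add: algebra_simps)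
      also have "\<dots> \<longleftrightarrow> norm y < sqrt (1 - t\<^sup>2)"
        using real_sqrt_less_iff[of "(norm y)\<^sup>2" "1 - t\<^sup>2"] by simp
      finally have "t < sqrt (1 - (norm y)\<^sup>2) \<longleftrightarrow> norm y < sqrt (1 - t\<^sup>2)" .
      moreover have "sqrt (1 - t\<^sup>2) \<le> 1" by simp
      moreover have "min 1 (max 0 t) = t" using 2 by simp
      ultimately show ?thesis by (metis less_le_trans)
    next
      case 3
      have "sqrt (1 - (norm y)\<^sup>2) \<le> 1" by simp
      then have "sqrt (1 - (norm y)\<^sup>2) \<le> t" using 3 by (rule order_trans)
      then show ?thesis using 3 by (simp add: not_less)
    qed
  qed
  then show ?thesis unfolding set_eq_iff mem_Collect_eq mem_ball_0 by blast
qed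

lemma emeasure_ball_sqrt_superlevel:
  assumes "DIM('a::euclidean_space) = 2 * d"
  shows "emeasure lborel {y \<in> ball (0 :: 'a) 1. t < sqrt (1 - (norm y)\<^sup>2)}
    = ennreal (unit_ball_vol (2 * d) * (1 - (min 1 (max 0 t))\<^sup>2) ^ d)"
proof -
  have "(min 1 (max 0 t))\<^sup>2 \<le> 1" by (auto simp: power_le_one)
  then show ?thesis
    unfolding ball_Int_sqrt_superlevel by (simp add: emeasure_ball assms power_mult)
qed

lemma nn_integral_power_one_minus_square:
  fixes c m :: real
  assumes c: "c \<ge> 0" and d: "d > 0" and m: "0 \<le> m" "m \<le> 1"
  shows "(\<integral>\<^sup>+x\<in>{m..1}. ennreal (c * (2 * real d * x * (1 - x\<^sup>2) ^ (d - 1))) \<partial>lborel)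
    = ennreal (c * (1 - m\<^sup>2) ^ d)"
proof -
  have "(\<integral>\<^sup>+x\<in>{m..1}. ennreal (c * (2 * real d * x * (1 - x\<^sup>2) ^ (d - 1))) \<partial>lborel)
      = ennreal (- c * (1 - 1\<^sup>2) ^ d - (- c * (1 - m\<^sup>2) ^ d))"
  proof (rule nn_integral_FTC_Icc)
    fix x assume x: "x \<in> {m..1}"
    show "((\<lambda>x. - c * (1 - x\<^sup>2) ^ d)
        has_real_derivative c * (2 * real d * x * (1 - x\<^sup>2) ^ (d - 1))) (at x)"
      by (auto intro!: derivative_eq_intros)
    show "0 \<le> c * (2 * real d * x * (1 - x\<^sup>2) ^ (d - 1))" using x m c by (simp add: power_le_one)
  qed (use m in auto)
  then show ?thesis using d by (simp add: zero_power)
qed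

lemma distr_ball_sqrt:
  assumes dim: "DIM('a::euclidean_space) = 2 * d"
  shows "distr (density lborel (indicator (ball (0::'a) 1))) borel (\<lambda>y. sqrt (1 - (norm y)\<^sup>2))
    = density lborel (\<lambda>x. ennreal (unit_ball_vol (2 * d) * (2 * real d * x * (1 - x\<^sup>2) ^ (d - 1)))
        * indicator {0..1} x)" (is "?M = ?N")
proof (rule measure_eqI_lessThan)
  define c where "c = unit_ball_vol (2 * d)"
  have c_nonneg: "c \<ge> 0" by (simp add: c_def)
  have d_pos: "d > 0" using dim DIM_positive[where 'a='a] by linarith
  have [measurable]: "(indicator (ball (0::'a) 1) :: 'a \<Rightarrow> ennreal) \<in> borel_measurable borel"
    by (simp add: borel_measurable_indicator)
  fix t :: real
  have "emeasure ?M {t<..} = (\<integral>\<^sup>+y. indicator (ball (0 :: 'a) 1) y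
      * indicator {y. t < sqrt (1 - (norm y)\<^sup>2)} y \<partial>lborel)"
    by (subst emeasure_distr, simp, simp, subst emeasure_density) (auto simp: vimage_def)
  also have "\<dots> = (\<integral>\<^sup>+y. indicator {y \<in> ball (0 :: 'a) 1. t < sqrt (1 - (norm y)\<^sup>2)} y \<partial>lborel)"
    by (intro nn_integral_cong) (auto simp: indicator_def)
  also have "\<dots> = ennreal (c * (1 - (min 1 (max 0 t))\<^sup>2) ^ d)"
    using emeasure_ball_sqrt_superlevel[OF dim, of t] by (simp add: c_def)
  finally have emeasure_M: "emeasure ?M {t<..} = ennreal (c * (1 - (min 1 (max 0 t))\<^sup>2) ^ d)" .
  have "emeasure ?N {t<..} = (\<integral>\<^sup>+x\<in>{min 1 (max 0 t)..1}.
      ennreal (c * (2 * real d * x * (1 - x\<^sup>2) ^ (d - 1))) \<partial>lborel)"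
    unfolding c_def
    by (subst emeasure_density, simp, simp, intro nn_integral_cong_AE)
      (use AE_lborel_singleton[of t] AE_lborel_singleton[of 1] in eventually_elim,
        auto simp: indicator_def)
  also have "\<dots> = ennreal (c * (1 - (min 1 (max 0 t))\<^sup>2) ^ d)"
    by (rule nn_integral_power_one_minus_square[OF c_nonneg d_pos]) auto
  finally show "emeasure ?M {t<..} < \<infinity>" "emeasure ?M {t<..} = emeasure ?N {t<..}"
    by (simp_all add: emeasure_M)
qed simp_all

lemma nn_integral_ball_sqrt:
  fixes \<psi> :: "real \<Rightarrow> ennreal"
  assumes dim: "DIM('a::euclidean_space) = 2 * d" and [measurable]: "\<psi> \<in> borel_measurable borel"
  shows "(\<integral>\<^sup>+y\<in>ball 0 1. \<psi> (sqrt (1 - (norm y)\<^sup>2)) \<partial>(lborel :: 'a measure))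
    = ennreal (unit_ball_vol (2 * d))
      * (\<integral>\<^sup>+x\<in>{0..1}. \<psi> x * ennreal (2 * real d * x * (1 - x\<^sup>2) ^ (d - 1)) \<partial>lborel)"
proof -
  define c where "c = unit_ball_vol (2 * d)"
  have c_nonneg: "c \<ge> 0" by (simp add: c_def)
  have [measurable]: "(indicator (ball (0::'a) 1) :: 'a \<Rightarrow> ennreal) \<in> borel_measurable borel"
    by (simp add: borel_measurable_indicator)
  have "(\<integral>\<^sup>+y\<in>ball 0 1. \<psi> (sqrt (1 - (norm y)\<^sup>2)) \<partial>(lborel :: 'a measure))
      = (\<integral>\<^sup>+x. \<psi> x \<partial>distr (density lborel (indicator (ball (0::'a) 1))) borel
          (\<lambda>y. sqrt (1 - (norm y)\<^sup>2)))"
    by (simp add: nn_integral_distr nn_integral_density mult.commute)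
  also have "\<dots> = (\<integral>\<^sup>+x. ennreal c
      * (\<psi> x * ennreal (2 * real d * x * (1 - x\<^sup>2) ^ (d - 1)) * indicator {0..1} x) \<partial>lborel)"
    unfolding distr_ball_sqrt[OF dim] c_def[symmetric]
    by (subst nn_integral_density)
      (auto intro!: nn_integral_cong simp: indicator_def ennreal_mult' c_nonneg mult_ac)
  also have "\<dots> = ennreal c
      * (\<integral>\<^sup>+x\<in>{0..1}. \<psi> x * ennreal (2 * real d * x * (1 - x\<^sup>2) ^ (d - 1)) \<partial>lborel)"
    by (rule nn_integral_cmult) measurable
  finally show ?thesis by (simp add: c_def)
qed

definition radial_integral :: "nat \<Rightarrow> nat \<Rightarrow> (real \<Rightarrow> real) \<Rightarrow> ennreal" where
  "radial_integral n l H
    = (\<integral>\<^sup>+x\<in>{0..1}. ennreal (2 * real n * (1 - x\<^sup>2) ^ (n - 1) * x ^ (l + 1) * H (1 - x\<^sup>2)) \<partial>lborel)"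

lemma shell_integral_lift_0:
  assumes [measurable]: "H \<in> borel_measurable borel"
  shows "shell_integral (lift 0) (lift (0 :: complex ^ 'n::finite)) (2 * CARD('n) + 2 + l) H
    = annulus_moment CARD('n)
      * (\<integral>\<^sup>+y\<in>ball 0 1. ennreal (H ((norm y)\<^sup>2) * sqrt (1 - (norm y)\<^sup>2) ^ l)
          \<partial>(lborel :: (complex ^ 'n) measure))"
proof -
  let ?n = "CARD('n)"
  define \<phi> where "\<phi> r = ennreal (H (r\<^sup>2) * sqrt (1 - r\<^sup>2) ^ (2 * ?n + 2 + l))" for r
  have [measurable]: "\<phi> \<in> borel_measurable borel" unfolding \<phi>_def by measurable
  have "shell_integral (lift 0) (lift (0 :: complex ^ 'n)) (2 * ?n + 2 + l) H
      = (\<integral>\<^sup>+v\<in>neg_shell. \<phi> (norm (dehom v)) \<partial>(lborel :: (complex ^ 'n option) measure))"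
    unfolding shell_integral_def
    by (intro set_nn_integral_cong refl)
      (auto dest!: qform_pos_of_neg_shell
        simp: \<phi>_def half_tanh_sq_lift_0 half_cosh_lift_0 power_divide)
  also have "\<dots> = annulus_moment ?n * (\<integral>\<^sup>+y\<in>unit_ball. \<phi> (norm y)
      * ennreal (1 / sqrt (1 - (norm y)\<^sup>2) ^ (2 * ?n + 2)) \<partial>(lborel :: (complex ^ 'n) measure))"
    by (rule nn_integral_neg_shell_dehom) measurable
  also have "(\<integral>\<^sup>+y\<in>unit_ball. \<phi> (norm y)
        * ennreal (1 / sqrt (1 - (norm y)\<^sup>2) ^ (2 * ?n + 2)) \<partial>(lborel :: (complex ^ 'n) measure))
      = (\<integral>\<^sup>+y\<in>ball 0 1. ennreal (H ((norm y)\<^sup>2) * sqrt (1 - (norm y)\<^sup>2) ^ l)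
          \<partial>(lborel :: (complex ^ 'n) measure))"
  proof (intro set_nn_integral_cong refl)
    fix y :: "complex ^ 'n" assume "y \<in> space lborel \<inter> unit_ball"
    then have "0 < sqrt (1 - (norm y)\<^sup>2)" by (simp add: unit_ball_def)
    then show "\<phi> (norm y) * ennreal (1 / sqrt (1 - (norm y)\<^sup>2) ^ (2 * ?n + 2))
        = ennreal (H ((norm y)\<^sup>2) * sqrt (1 - (norm y)\<^sup>2) ^ l)"
      unfolding \<phi>_def by (subst ennreal_mult''[symmetric]) (simp_all add: power_add)
  qed (auto simp: unit_ball_iff)
  finally show ?thesis .
qed

lemma shell_integral_eq_radial_integral:
  obtains \<kappa> :: ennreal where "\<kappa> \<noteq> 0" "\<kappa> \<noteq> \<infinity>"
    "\<And>(p :: complex ^ ('n::finite option)) H l.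
      qform p > 0 \<Longrightarrow> H \<in> borel_measurable borel \<Longrightarrow>
      shell_integral p p (2 * CARD('n) + 2 + l) H = \<kappa> * radial_integral CARD('n) l H"
proof -
  let ?n = "CARD('n)"
  define c where "c = unit_ball_vol (real (2 * ?n))"
  show ?thesis
  proof (rule that[of "annulus_moment ?n * ennreal c"])
    have "c > 0" by (simp add: c_def)
    then show "annulus_moment ?n * ennreal c \<noteq> 0" "annulus_moment ?n * ennreal c \<noteq> \<infinity>"
      using annulus_moment_pos[of ?n] annulus_moment_finite[of ?n]
      by (auto simp: ennreal_mult_eq_top_iff)
    fix p :: "complex ^ ('n option)" and H :: "real \<Rightarrow> real" and l
    assume p: "qform p > 0" and [measurable]: "H \<in> borel_measurable borel"
    define \<psi> where "\<psi> x = ennreal (H (1 - x\<^sup>2) * x ^ l)" for x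
    have [measurable]: "\<psi> \<in> borel_measurable borel" unfolding \<psi>_def by measurable
    have "shell_integral p p (2 * ?n + 2 + l) H
        = shell_integral (lift 0) (lift (0 :: complex ^ 'n)) (2 * ?n + 2 + l) H"
      using p by (intro shell_integral_self_eq) (auto simp: qform_lift)
    also have "\<dots> = annulus_moment ?n
        * (\<integral>\<^sup>+y\<in>ball 0 1. \<psi> (sqrt (1 - (norm y)\<^sup>2)) \<partial>(lborel :: (complex ^ 'n) measure))"
      unfolding shell_integral_lift_0[OF \<open>H \<in> borel_measurable borel\<close>] \<psi>_def
      by (intro arg_cong[of _ _ "(*) _"] set_nn_integral_cong refl) (auto simp: power_le_one)
    also have "(\<integral>\<^sup>+y\<in>ball 0 1. \<psi> (sqrt (1 - (norm y)\<^sup>2)) \<partial>(lborel :: (complex ^ 'n) measure))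
        = ennreal c * (\<integral>\<^sup>+x\<in>{0..1}. \<psi> x * ennreal (2 * real ?n * x * (1 - x\<^sup>2) ^ (?n - 1)) \<partial>lborel)"
      unfolding c_def by (rule nn_integral_ball_sqrt) auto
    also have "(\<integral>\<^sup>+x\<in>{0..1}. \<psi> x * ennreal (2 * real ?n * x * (1 - x\<^sup>2) ^ (?n - 1)) \<partial>lborel)
        = radial_integral ?n l H"
      unfolding radial_integral_def \<psi>_def
      by (intro set_nn_integral_cong refl)
        (auto simp: mult_ac power_le_one simp flip: ennreal_mult'')
    finally show "shell_integral p p (2 * ?n + 2 + l) H
        = annulus_moment ?n * ennreal c * radial_integral ?n l H" by (simp add: mult.assoc)
  qed
qed

section \<open>Incomplete beta integrals\<close>

definition inc_beta :: "nat \<Rightarrow> nat \<Rightarrow> real \<Rightarrow> real" where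
  "inc_beta n l x = 2 * real n
    * (\<Sum>j\<le>n-1. of_nat ((n - 1) choose j) * (-1) ^ j * x ^ (l + 2 + 2 * j) / real (l + 2 + 2 * j))"

lemma DERIV_inc_beta [derivative_intros]:
  assumes "(g has_real_derivative g') (at x)"
  shows "((\<lambda>x. inc_beta n l (g x)) has_real_derivative
    2 * real n * (1 - (g x)\<^sup>2) ^ (n - 1) * (g x) ^ (l + 1) * g') (at x)"
proof -
  have monomial: "((\<lambda>x. of_nat ((n - 1) choose j) * (-1) ^ j
      * x ^ (l + 2 + 2 * j) / real (l + 2 + 2 * j))
      has_real_derivative of_nat ((n - 1) choose j) * (-1) ^ j * x ^ (l + 1 + 2 * j)) (at x)"
    for j and x :: real
  proof -
    have "((\<lambda>x. x ^ (l + 2 + 2 * j) / real (l + 2 + 2 * j))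
        has_real_derivative x ^ (l + 1 + 2 * j)) (at x)"
      using DERIV_cdivide[OF DERIV_pow[of "l + 2 + 2 * j" x], of "real (l + 2 + 2 * j)"]
      by (simp del: of_nat_add of_nat_mult of_nat_Suc)
    from DERIV_cmult[OF this, of "of_nat ((n - 1) choose j) * (-1) ^ j"]
    show ?thesis by (simp add: mult.assoc)
  qed
  have "(1 - y\<^sup>2) ^ (n - 1) * y ^ (l + 1)
      = (\<Sum>j\<le>n-1. of_nat ((n - 1) choose j) * (-1) ^ j * y ^ (l + 1 + 2 * j))" for y :: real
  proof -
    have "(1 - y\<^sup>2) ^ (n - 1) = (- y\<^sup>2 + 1) ^ (n - 1)" by simp
    also have "\<dots> = (\<Sum>j\<le>n-1. of_nat ((n - 1) choose j) * (- y\<^sup>2) ^ j * 1 ^ (n - 1 - j))"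
      by (rule binomial_ring)
    also have "\<dots> = (\<Sum>j\<le>n-1. of_nat ((n - 1) choose j) * (-1) ^ j * y ^ (2 * j))"
      by (intro sum.cong refl) (simp add: power_mult power_minus[of "y\<^sup>2"])
    finally show ?thesis by (simp add: sum_distrib_left power_add mult_ac)
  qed
  then have "(inc_beta n l
      has_real_derivative 2 * real n * ((1 - y\<^sup>2) ^ (n - 1) * y ^ (l + 1))) (at y)"
    for y :: real
    unfolding inc_beta_def by (simp only:) (intro DERIV_cmult DERIV_sum monomial)
  from DERIV_chain2[OF this assms] show ?thesis by (simp add: mult.assoc)
qed

lemma inc_beta_0 [simp]: "inc_beta n l 0 = 0"
  by (simp add: inc_beta_def)

lemma inc_beta_less:
  assumes n: "n \<ge> 1" and "0 \<le> x" "x < y" "y \<le> 1"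
  shows "inc_beta n l x < inc_beta n l y"
proof (rule DERIV_pos_imp_increasing_open[OF \<open>x < y\<close>])
  fix z assume z: "x < z" "z < y"
  then have "0 < z" "z\<^sup>2 < 1" using assms by (simp_all add: abs_square_less_1)
  then have "0 < 2 * real n * (1 - z\<^sup>2) ^ (n - 1) * z ^ (l + 1)" using n by simp
  then show "\<exists>D. (inc_beta n l has_real_derivative D) (at z) \<and> 0 < D"
    using DERIV_inc_beta[OF DERIV_ident, of n l z] by auto
qed (intro continuous_at_imp_continuous_on ballI DERIV_isCont[OF DERIV_inc_beta[OF DERIV_ident]])

lemma nn_integral_inc_beta:
  assumes \<rho>: "0 \<le> \<rho>" "\<rho> \<le> 1"
  shows "(\<integral>\<^sup>+x\<in>{\<rho>..1}. ennreal (2 * real n * (1 - x\<^sup>2) ^ (n - 1) * x ^ (l + 1)) \<partial>lborel)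
    = ennreal (inc_beta n l 1 - inc_beta n l \<rho>)"
proof (rule nn_integral_FTC_Icc)
  fix x assume x: "x \<in> {\<rho>..1}"
  show "(inc_beta n l has_real_derivative 2 * real n * (1 - x\<^sup>2) ^ (n - 1) * x ^ (l + 1)) (at x)"
    using DERIV_inc_beta[OF DERIV_ident] by simp
  show "0 \<le> 2 * real n * (1 - x\<^sup>2) ^ (n - 1) * x ^ (l + 1)"
    using x \<rho> by (simp add: power_le_one)
qed (use \<rho> in auto)

lemma radial_integral_one: "radial_integral n l (\<lambda>_. 1) = ennreal (inc_beta n l 1)"
  using nn_integral_inc_beta[of 0 n l] by (simp add: radial_integral_def)

lemma radial_integral_indicator:
  assumes \<rho>: "0 \<le> \<rho>" "\<rho> \<le> 1"
  shows "radial_integral n l (indicator {..<1 - \<rho>\<^sup>2}) = ennreal (inc_beta n l 1 - inc_beta n l \<rho>)"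
proof -
  have "radial_integral n l (indicator {..<1 - \<rho>\<^sup>2})
      = (\<integral>\<^sup>+x\<in>{\<rho>..1}. ennreal (2 * real n * (1 - x\<^sup>2) ^ (n - 1) * x ^ (l + 1)) \<partial>lborel)"
    unfolding radial_integral_def
  proof (intro nn_integral_cong_AE, use AE_lborel_singleton[of \<rho>] in eventually_elim)
    fix x :: real assume "x \<noteq> \<rho>"
    moreover have "\<rho>\<^sup>2 < x\<^sup>2 \<longleftrightarrow> \<rho> < x" if "0 \<le> x"
      using that \<rho> by (auto intro: power_strict_mono power2_less_imp_less)
    ultimately show "ennreal (2 * real n * (1 - x\<^sup>2) ^ (n - 1) * x ^ (l + 1)
          * indicator {..<1 - \<rho>\<^sup>2} (1 - x\<^sup>2)) * indicator {0..1} x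
        = ennreal (2 * real n * (1 - x\<^sup>2) ^ (n - 1) * x ^ (l + 1)) * indicator {\<rho>..1} x"
      using \<rho> by (auto simp: indicator_def)
  qed
  then show ?thesis by (simp only: nn_integral_inc_beta[OF \<rho>])
qed

lemma nn_integral_cutoff:
  fixes X :: real
  assumes X: "0 < X" "X < 1"
  shows "(\<integral>\<^sup>+x\<in>{sqrt (1 - X)..1}. ennreal (4 * (1 - x\<^sup>2) * x ^ 3 * (1 - (1 - x\<^sup>2) / X)) \<partial>lborel)
    = ennreal (X\<^sup>2 / 3 * (1 - X / 2))"
proof -
  define \<rho> where "\<rho> = sqrt (1 - X)"
  have \<rho>: "0 \<le> \<rho>" "\<rho> \<le> 1" "\<rho>\<^sup>2 = 1 - X" using X by (simp_all add: \<rho>_def)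
  define P where "P t = t\<^sup>2 - 2 * t ^ 3 / 3 - (2 * t ^ 3 / 3 - t ^ 4 / 2) / X" for t
  define f where "f x = 4 * (1 - x\<^sup>2) * x ^ 3 * (1 - (1 - x\<^sup>2) / X)" for x
  have "(\<integral>\<^sup>+x\<in>{\<rho>..1}. ennreal (f x) \<partial>lborel) = ennreal (- P (1 - 1\<^sup>2) - (- P (1 - \<rho>\<^sup>2)))"
  proof (rule nn_integral_FTC_Icc)
    fix x assume x: "x \<in> {\<rho>..1}"
    have DERIV_P: "(P has_real_derivative 2 * t * (1 - t) * (1 - t / X)) (at t)" for t
      unfolding P_def using X
      by (auto intro!: derivative_eq_intros simp: field_simps power2_eq_square power3_eq_cube)
    have "((\<lambda>x. 1 - x\<^sup>2) has_real_derivative - 2 * x) (at x)"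
      by (auto intro!: derivative_eq_intros)
    from DERIV_minus[OF DERIV_chain2[OF DERIV_P this]]
    show "((\<lambda>x. - P (1 - x\<^sup>2)) has_real_derivative f x) (at x)"
      by (rule DERIV_cong)
        (simp add: f_def power2_eq_square power3_eq_cube algebra_simps diff_divide_distrib)
    have "\<rho>\<^sup>2 \<le> x\<^sup>2" "x\<^sup>2 \<le> 1" using x \<rho>(1,2) by (auto intro: power_mono power_le_one)
    then show "0 \<le> f x" using x X \<rho> by (simp add: f_def divide_le_eq)
  qed (use \<rho> in \<open>auto simp: f_def\<close>)
  also have "1 - \<rho>\<^sup>2 = X" by (simp add: \<rho>(3))
  also have "- P (1 - 1\<^sup>2) - (- P X) = X\<^sup>2 / 3 * (1 - X / 2)"
    using X by (simp add: P_def field_simps power2_eq_square power3_eq_cube numeral_eq_Suc)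
  finally show ?thesis by (simp add: f_def \<rho>_def)
qed

lemma radial_integral_2_cutoff_ge:
  assumes X: "0 < X" "X < 1" and l: "l \<le> 2"
  shows "ennreal (X\<^sup>2 / 3 * (1 - X / 2)) \<le> radial_integral 2 l (\<lambda>t. max 0 (1 - t / X))"
  unfolding nn_integral_cutoff[OF X, symmetric] radial_integral_def
proof (intro nn_integral_mono)
  fix x :: real
  define u where "u = 4 * (1 - x\<^sup>2) * (1 - (1 - x\<^sup>2) / X)"
  have "u * x ^ 3 \<le> u * x ^ (l + 1)" "0 \<le> 1 - (1 - x\<^sup>2) / X" "0 \<le> x" if x: "x \<in> {sqrt (1 - X)..1}"
  proof -
    show "0 \<le> x" using x X by (auto intro: order_trans[of _ "sqrt (1 - X)"])
    have "(sqrt (1 - X))\<^sup>2 \<le> x\<^sup>2" using x X by (intro power_mono) auto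
    then show nonneg: "0 \<le> 1 - (1 - x\<^sup>2) / X" using X by (simp add: divide_le_eq)
    have "x\<^sup>2 \<le> 1" using x \<open>0 \<le> x\<close> by (simp add: power_le_one)
    then have "u \<ge> 0" using nonneg by (simp add: u_def)
    then show "u * x ^ 3 \<le> u * x ^ (l + 1)"
      using x \<open>0 \<le> x\<close> l by (intro mult_left_mono power_decreasing) auto
  qed
  then show "ennreal (4 * (1 - x\<^sup>2) * x ^ 3 * (1 - (1 - x\<^sup>2) / X)) * indicator {sqrt (1 - X)..1} x
      \<le> ennreal (2 * real 2 * (1 - x\<^sup>2) ^ (2 - 1) * x ^ (l + 1) * max 0 (1 - (1 - x\<^sup>2) / X))
        * indicator {0..1} x"
    by (auto simp: indicator_def u_def mult_ac intro!: ennreal_leI)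
qed

section \<open>Overlap of separated points\<close>

lemma chart_centred_at:
  fixes v :: "complex ^ ('n::finite option)"
  assumes v: "qform v > 0"
  obtains \<zeta> :: "complex ^ ('n option) \<Rightarrow> complex ^ 'n"
  where "\<And>p. qform p > 0 \<Longrightarrow> \<zeta> p \<in> unit_ball"
    and "\<And>p q. qform p > 0 \<Longrightarrow> qform q > 0 \<Longrightarrow>
      half_cosh (lift (\<zeta> p)) (lift (\<zeta> q)) = half_cosh p q"
    and "\<And>p. qform p > 0 \<Longrightarrow> half_tanh_sq p v = (norm (\<zeta> p))\<^sup>2"
proof -
  obtain g c where g: "g \<in> U_n1" "c \<noteq> 0" "g *v lift 0 = c *s v" using U_n1_transitive[OF v] .
  define h where "h = H_adjoint g"
  have h_U_n1: "h \<in> U_n1" using H_adjoint_U_n1[OF g(1)] by (simp add: h_def)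
  have "lift 0 = h *v (c *s v)"
    by (simp add: h_def matrix_vector_mul_assoc H_adjoint_mult[OF g(1)] flip: g(3))
  then have "half_tanh_sq p v = half_tanh_sq (lift 0) (h *v p)" for p
    by (simp add: half_tanh_sq_U_n1[OF h_U_n1] half_tanh_sq_commute[of p v])
      (simp add: half_tanh_sq_def half_cosh_smult_left g(2))
  then show ?thesis
    using that[of "\<lambda>p. dehom (h *v p)"]
    by (simp add: dehom_in_unit_ball half_tanh_sq_lift_0 qform_U_n1[OF h_U_n1]
        half_cosh_U_n1[OF h_U_n1] flip: half_cosh_lift_dehom)
qed

lemma sum_half_tanh_sq_le_1:
  fixes z :: "'i \<Rightarrow> complex ^ 'n::finite"
  assumes z: "\<And>i. i \<in> I \<Longrightarrow> z i \<in> unit_ball" and v: "qform v > 0"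
    and overlap: "\<And>w. \<lbrakk>\<And>i. i \<in> I \<Longrightarrow> w i \<in> unit_ball;
        \<And>i j. i \<in> I \<Longrightarrow> j \<in> I \<Longrightarrow> hyp_dist (w i) (w j) = hyp_dist (z i) (z j)\<rbrakk>
      \<Longrightarrow> (\<Sum>i\<in>I. H ((norm (w i :: complex ^ 'n))\<^sup>2)) \<le> (1 :: real)"
  shows "(\<Sum>i\<in>I. H (half_tanh_sq (lift (z i)) v)) \<le> 1"
proof -
  obtain \<zeta> :: "complex ^ ('n option) \<Rightarrow> complex ^ 'n"
    where \<zeta>: "\<And>p. qform p > 0 \<Longrightarrow> \<zeta> p \<in> unit_ball"
      "\<And>p q. qform p > 0 \<Longrightarrow> qform q > 0 \<Longrightarrow>
        half_cosh (lift (\<zeta> p)) (lift (\<zeta> q)) = half_cosh p q"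
      "\<And>p. qform p > 0 \<Longrightarrow> half_tanh_sq p v = (norm (\<zeta> p))\<^sup>2"
    using chart_centred_at[OF v] by blast
  have "(\<Sum>i\<in>I. H ((norm (\<zeta> (lift (z i))))\<^sup>2)) \<le> 1"
    using \<zeta> z by (intro overlap) (auto simp: hyp_dist_eq_arcosh_half_cosh qform_lift_pos_iff)
  then show ?thesis using \<zeta>(3) z by (simp add: qform_lift_pos_iff)
qed

lemma ball_packing_inequality:
  fixes p :: "complex ^ 'n::finite" and z :: "'i \<Rightarrow> complex ^ 'n"
  assumes p: "p \<in> unit_ball" and I: "finite I" and z: "\<And>i. i \<in> I \<Longrightarrow> z i \<in> unit_ball"
    and H: "\<And>x. H x \<ge> 0" "H \<in> borel_measurable borel"
    and overlap: "\<And>w. \<lbrakk>\<And>i. i \<in> I \<Longrightarrow> w i \<in> unit_ball;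
        \<And>i j. i \<in> I \<Longrightarrow> j \<in> I \<Longrightarrow> hyp_dist (w i) (w j) = hyp_dist (z i) (z j)\<rbrakk>
      \<Longrightarrow> (\<Sum>i\<in>I. H ((norm (w i :: complex ^ 'n))\<^sup>2)) \<le> 1"
    and J: "ennreal J \<le> radial_integral CARD('n) l H" "J \<ge> 0"
  shows "(\<Sum>i\<in>I. 1 / cosh (hyp_dist p (z i) / 2) ^ (2 * CARD('n) + 2 + l)) * J
    \<le> inc_beta CARD('n) l 1"
proof -
  let ?n = "CARD('n)"
  define k where "k = 2 * ?n + 2 + l"
  define S where "S = (\<Sum>i\<in>I. 1 / cosh (hyp_dist p (z i) / 2) ^ k)"
  have qform: "qform (lift p) > 0" "\<And>i. i \<in> I \<Longrightarrow> qform (lift (z i)) > 0"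
    using p z by (simp_all add: qform_lift_pos_iff)
  obtain \<kappa> where \<kappa>: "\<kappa> \<noteq> 0" "\<kappa> \<noteq> \<infinity>" "\<And>H. H \<in> borel_measurable borel \<Longrightarrow>
      shell_integral (lift p) (lift p) k H = \<kappa> * radial_integral ?n l H"
    using shell_integral_eq_radial_integral[where 'n='n] qform(1) unfolding k_def by metis
  have "(\<Sum>i\<in>I. H (half_tanh_sq (lift (z i)) v)) \<le> 1" if "qform v > 0" for v
    using z that overlap by (rule sum_half_tanh_sq_le_1)
  then have "(\<Sum>i\<in>I. ennreal (1 / half_cosh (lift p) (lift (z i)) ^ k))
      * shell_integral (lift p) (lift p) k H
      \<le> shell_integral (lift p) (lift p) k (\<lambda>_. 1)"
    by (intro packing_inequality qform I H) auto
  then have "\<kappa> * (ennreal S * radial_integral ?n l H) \<le> \<kappa> * ennreal (inc_beta ?n l 1)"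
    using p z H(2) by (simp add: S_def \<kappa>(3) radial_integral_one half_cosh_lift mult_ac)
  then have "ennreal S * radial_integral ?n l H \<le> ennreal (inc_beta ?n l 1)"
    using \<kappa>(1,2) by (simp add: ennreal_mult_le_mult_iff)
  then have "ennreal S * ennreal J \<le> ennreal (inc_beta ?n l 1)"
    using J(1) by (meson mult_left_mono order_trans zero_le)
  moreover have "S \<ge> 0" by (simp add: S_def sum_nonneg)
  moreover have "inc_beta ?n l 1 > 0" using inc_beta_less[of ?n 0 1 l] by (simp add: Suc_leI)
  ultimately show ?thesis using J(2) by (simp add: S_def k_def flip: ennreal_mult)
qed

lemma cosh_half_hyp_dist_eq_ball_pairing:
  assumes "z \<in> unit_ball" "w \<in> unit_ball"
  shows "cosh (hyp_dist z w / 2)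
    = cmod (ball_pairing z w) / (sqrt (1 - (norm z)\<^sup>2) * sqrt (1 - (norm w)\<^sup>2))"
  using assms by (simp add: half_cosh_lift_eq_ball_pairing flip: half_cosh_lift)

lemma cosh_half_hyp_dist_less:
  assumes s: "s < 1" and z: "(norm z)\<^sup>2 < s" and w: "(norm w)\<^sup>2 < s"
  shows "cosh (hyp_dist z w / 2) < (1 + s) / (1 - s)"
proof -
  have ball: "z \<in> unit_ball" "w \<in> unit_ball" using assms by (simp_all add: unit_ball_def)
  have "2 * (norm z * norm w) \<le> (norm z)\<^sup>2 + (norm w)\<^sup>2"
    using sum_squares_bound[of "norm z" "norm w"] by simp
  then have "norm z * norm w \<le> s" using z w by simp
  then have "cmod (ball_pairing z w) \<le> 1 + s"
    using norm_triangle_ineq4[of 1 "\<Sum>j\<in>UNIV. z $ j * cnj (w $ j)"] cmod_sum_le_norm[of z w]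
    by (simp add: ball_pairing_def)
  moreover have "1 - s < sqrt (1 - (norm z)\<^sup>2) * sqrt (1 - (norm w)\<^sup>2)"
  proof -
    have "sqrt (1 - s) * sqrt (1 - s) < sqrt (1 - (norm z)\<^sup>2) * sqrt (1 - (norm w)\<^sup>2)"
      using s z w by (intro mult_strict_mono) auto
    then show ?thesis using s by simp
  qed
  moreover have "s > 0" using z zero_le_power2[of "norm z"] by linarith
  ultimately have "cmod (ball_pairing z w) / (sqrt (1 - (norm z)\<^sup>2) * sqrt (1 - (norm w)\<^sup>2))
      \<le> (1 + s) / (sqrt (1 - (norm z)\<^sup>2) * sqrt (1 - (norm w)\<^sup>2))"
    "(1 + s) / (sqrt (1 - (norm z)\<^sup>2) * sqrt (1 - (norm w)\<^sup>2)) < (1 + s) / (1 - s)"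
    using s by (auto intro: divide_right_mono divide_strict_left_mono)
  then show ?thesis unfolding cosh_half_hyp_dist_eq_ball_pairing[OF ball] by linarith
qed

lemma separated_indicator_sum_le_1:
  fixes w :: "'i \<Rightarrow> complex ^ 'n::finite"
  assumes I: "finite I" and s: "s < 1"
    and separated: "\<And>i j. i \<in> I \<Longrightarrow> j \<in> I \<Longrightarrow> i \<noteq> j \<Longrightarrow>
      (1 + s) / (1 - s) \<le> cosh (hyp_dist (w i) (w j) / 2)"
  shows "(\<Sum>i\<in>I. indicator {..<s} ((norm (w i))\<^sup>2)) \<le> (1::real)"
proof -
  define B where "B = {i \<in> I. (norm (w i))\<^sup>2 < s}"
  have "i = j" if "i \<in> B" "j \<in> B" for i j
    using that separated[of i j] cosh_half_hyp_dist_less[OF s, of "w i" "w j"]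
    by (force simp: B_def)
  then have "card B \<le> 1"
    using I by (simp add: B_def card_le_Suc0_iff_eq)
  moreover have "(\<Sum>i\<in>I. indicator {..<s} ((norm (w i))\<^sup>2)) = real (card B)"
    using I by (simp add: B_def indicator_def sum.If_cases Int_def)
  ultimately show ?thesis by simp
qed

text \<open>Blichfeldt's argument: expand \<open>0 \<le> |\<Sum> z i|\<^sup>2\<close> and estimate the mixed inner products.\<close>

lemma sum_norm_sq_ge_of_separated:
  fixes z :: "'i \<Rightarrow> 'a::real_inner"
  assumes B: "finite B"
    and separated: "\<And>i j. i \<in> B \<Longrightarrow> j \<in> B \<Longrightarrow> i \<noteq> j \<Longrightarrow>
      2 * (z i \<bullet> z j) \<le> K * ((norm (z i))\<^sup>2 + (norm (z j))\<^sup>2) - (K - 1)"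
  shows "card B * (real (card B) - 1) * (K - 1)
    \<le> 2 * (\<Sum>i\<in>B. (norm (z i))\<^sup>2) * (1 + K * (real (card B) - 1))"
proof -
  define N where "N = real (card B)"
  define x where "x i = (norm (z i))\<^sup>2" for i
  define S where "S = (\<Sum>i\<in>B. x i)"
  have "0 \<le> 2 * ((\<Sum>i\<in>B. z i) \<bullet> (\<Sum>j\<in>B. z j))" by simp
  also have "\<dots> = (\<Sum>i\<in>B. \<Sum>j\<in>B. 2 * (z i \<bullet> z j))"
    by (simp add: inner_sum_left inner_sum_right sum_distrib_left) (rule sum.swap)
  also have "\<dots> = (\<Sum>i\<in>B. 2 * x i + (\<Sum>j\<in>B - {i}. 2 * (z i \<bullet> z j)))"
    using B by (intro sum.cong refl) (simp add: sum.remove x_def power2_norm_eq_inner)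
  also have "\<dots> \<le> (\<Sum>i\<in>B. 2 * x i + (\<Sum>j\<in>B - {i}. K * (x i + x j) - (K - 1)))"
    using separated by (intro sum_mono add_left_mono) (auto simp: x_def)
  also have "\<dots> = (\<Sum>i\<in>B. 2 * x i + ((N - 1) * (K * x i - (K - 1)) + K * (S - x i)))"
  proof (intro sum.cong refl arg_cong2[of _ _ _ _ "(+)"])
    fix i assume i: "i \<in> B"
    then have "N - 1 = real (card (B - {i}))" "S - x i = (\<Sum>j\<in>B - {i}. x j)"
      using B card_gt_0_iff[of B] by (auto simp: N_def S_def sum.remove of_nat_diff Suc_leI)
    then show "(\<Sum>j\<in>B - {i}. K * (x i + x j) - (K - 1))
        = (N - 1) * (K * x i - (K - 1)) + K * (S - x i)"
      by (simp add: sum.distrib sum_subtractf distrib_left sum_distrib_left algebra_simps)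
  qed
  also have "\<dots> = 2 * S * (1 + K * (N - 1)) - N * (N - 1) * (K - 1)"
    by (simp add: sum.distrib sum_subtractf S_def N_def algebra_simps
        flip: sum_distrib_left sum_distrib_right)
  finally show ?thesis by (simp add: N_def S_def x_def)
qed

lemma blichfeldt_sum_le_1:
  fixes z :: "'i \<Rightarrow> 'a::real_inner"
  assumes I: "finite I" and K: "K > 1"
    and separated: "\<And>i j. i \<in> I \<Longrightarrow> j \<in> I \<Longrightarrow> i \<noteq> j \<Longrightarrow>
      2 * (z i \<bullet> z j) \<le> K * ((norm (z i))\<^sup>2 + (norm (z j))\<^sup>2) - (K - 1)"
  defines "X \<equiv> (K - 1) / (2 * K)"
  shows "(\<Sum>i\<in>I. max 0 (1 - (norm (z i))\<^sup>2 / X)) \<le> 1"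
proof -
  have X_pos: "X > 0" using K by (simp add: X_def)
  define B where "B = {i \<in> I. (norm (z i))\<^sup>2 < X}"
  define N where "N = real (card B)"
  define S where "S = (\<Sum>i\<in>B. (norm (z i))\<^sup>2)"
  have finite_B: "finite B" using I by (simp add: B_def)
  have S_nonneg: "S \<ge> 0" by (simp add: S_def sum_nonneg)
  have bound: "N * (N - 1) * (K - 1) \<le> 2 * S * (1 + K * (N - 1))"
    unfolding N_def S_def using separated
    by (intro sum_norm_sq_ge_of_separated finite_B) (auto simp: B_def)
  have "N - S / X \<le> 1"
  proof (cases "card B = 0")
    case True
    then show ?thesis using divide_nonneg_pos[OF S_nonneg X_pos] by (simp add: N_def)
  next
    case False
    then have N_ge_1: "N \<ge> 1" by (simp add: N_def)
    have "1 + K * (N - 1) \<le> K * N" using K by (simp add: algebra_simps)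
    then have "2 * S * (1 + K * (N - 1)) \<le> 2 * S * (K * N)"
      using S_nonneg by (intro mult_left_mono) auto
    then have "N * ((N - 1) * (K - 1)) \<le> N * (2 * K * S)" using bound by (simp add: algebra_simps)
    then have "(N - 1) * (K - 1) \<le> 2 * K * S" using N_ge_1 by simp
    then show ?thesis using K by (simp add: X_def field_simps)
  qed
  moreover have "(\<Sum>i\<in>I. max 0 (1 - (norm (z i))\<^sup>2 / X)) = (\<Sum>i\<in>B. 1 - (norm (z i))\<^sup>2 / X)"
    using I X_pos by (intro sum.mono_neutral_cong_right) (auto simp: B_def not_less max_def)
  ultimately show ?thesis by (simp add: sum_subtractf N_def S_def sum_divide_distrib)
qed

lemma inner_le_of_cosh_half_hyp_dist_ge:
  assumes z: "z \<in> unit_ball" and w: "w \<in> unit_ball" and K: "K \<ge> 1"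
    and cosh_ge: "K \<le> (cosh (hyp_dist z w / 2))\<^sup>2"
  shows "2 * (z \<bullet> w) \<le> K * ((norm z)\<^sup>2 + (norm w)\<^sup>2) - (K - 1)"
proof -
  define x y where "x = (norm z)\<^sup>2" and "y = (norm w)\<^sup>2"
  define c where "c = (\<Sum>j\<in>UNIV. z $ j * cnj (w $ j))"
  have x_y_less_1: "0 < 1 - x" "0 < 1 - y" using z w by (simp_all add: x_def y_def unit_ball_def)
  have Re_c: "Re c = z \<bullet> w" by (simp add: c_def inner_vec_def inner_complex_def)
  have "(cosh (hyp_dist z w / 2))\<^sup>2 = (cmod (1 - c))\<^sup>2 / ((1 - x) * (1 - y))"
    using x_y_less_1 unfolding cosh_half_hyp_dist_eq_ball_pairing[OF z w] ball_pairing_def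
    by (simp add: power_divide power_mult_distrib c_def x_def y_def)
  then have "K * ((1 - x) * (1 - y)) \<le> (cmod (1 - c))\<^sup>2"
    using cosh_ge x_y_less_1 by (simp add: pos_le_divide_eq)
  also have "(cmod (1 - c))\<^sup>2 = 1 - 2 * Re c + (cmod c)\<^sup>2"
    unfolding cmod_power2 by (simp add: power2_eq_square algebra_simps)
  also have "(cmod c)\<^sup>2 \<le> x * y"
    using power_mono[OF cmod_sum_le_norm[of z w], of 2]
    by (simp add: c_def x_def y_def power_mult_distrib)
  also have "x * y \<le> K * (x * y)" using K mult_right_mono[of 1 K "x * y"] by (simp add: x_def y_def)
  finally show ?thesis by (simp add: Re_c algebra_simps flip: x_def y_def)
qed

section \<open>Inequalities for incomplete beta integrals\<close>

text \<open>The difference of both sides, multiplied by \<open>(l + 1) (1 - \<rho>\<^sup>2)\<^sup>n\<close>, vanishes for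
  \<open>\<rho> = 1\<close> and is decreasing in \<open>\<rho>\<close>.\<close>

lemma inc_beta_ratio_le:
  assumes n: "n \<ge> 2" and \<rho>: "0 < \<rho>" "\<rho> < 1"
    and bound: "\<And>x. 0 < x \<Longrightarrow> x < 1 \<Longrightarrow>
      real (l + 1) * inc_beta n l x \<le> x ^ l * (1 + real (l + 1) * (1 - x\<^sup>2) ^ n)"
  shows "inc_beta n l 1
    \<le> (inc_beta n l 1 - inc_beta n l \<rho>) * (1 + 1 / (real (l + 1) * (1 - \<rho>\<^sup>2) ^ n))"
proof -
  define c where "c = real (l + 1)"
  define Q where "Q x = inc_beta n l x * (1 + c * (1 - x\<^sup>2) ^ n)" for x
  define D where "D x = 2 * real n * x * (1 - x\<^sup>2) ^ (n - 1)
    * (x ^ l * (1 + c * (1 - x\<^sup>2) ^ n) - c * inc_beta n l x)" for x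
  have DERIV_Q: "(Q has_real_derivative D x) (at x)" for x
    unfolding Q_def D_def by (auto intro!: derivative_eq_intros) (simp add: algebra_simps)
  have "Q \<rho> \<le> Q 1"
  proof (rule DERIV_nonneg_imp_nondecreasing[of \<rho> 1 Q])
    fix x assume x: "\<rho> \<le> x" "x \<le> 1"
    have "0 \<le> D x"
    proof (cases "x = 1")
      case True
      then show ?thesis using n by (simp add: D_def zero_power)
    next
      case False
      then have "x\<^sup>2 \<le> 1" using x \<rho> by (simp add: power_le_one)
      then show ?thesis
        using bound[of x] x \<rho> False unfolding D_def by (intro mult_nonneg_nonneg) (auto simp: c_def)
    qed
    then show "\<exists>y. (Q has_real_derivative y) (at x) \<and> 0 \<le> y" using DERIV_Q by blast
  qed (use \<rho> in simp)
  moreover define y where "y = c * (1 - \<rho>\<^sup>2) ^ n"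
  ultimately have "inc_beta n l \<rho> * (1 + y) \<le> inc_beta n l 1"
    using n by (simp add: Q_def zero_power)
  moreover have "y > 0" using \<rho> by (simp add: y_def c_def abs_square_less_1)
  ultimately have "inc_beta n l 1 \<le> (inc_beta n l 1 - inc_beta n l \<rho>) * (1 + 1 / y)"
    by (simp add: field_simps)
  then show ?thesis by (simp add: y_def c_def)
qed

lemma power_mean_le:
  assumes m_le_n: "1 \<le> m" "m \<le> n" and s: "0 < s" and v: "0 \<le> v" "v \<le> 1"
  shows "(1 - v + v * s) ^ n \<le> (1 - v + v * s powr (real n / real m)) ^ m"
proof -
  define p where "p = real n / real m"
  have p: "p \<ge> 1" "real m * p = real n" using m_le_n by (simp_all add: p_def)
  define A where "A = 1 - v + v * s"
  have A_pos: "A > 0"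
  proof (cases "v = 0")
    case False
    then have "v * s > 0" using v s by simp
    then show ?thesis using v by (simp add: A_def)
  qed (simp add: A_def)
  have "A powr p \<le> (1 - v) * 1 powr p + v * s powr p"
    using convex_onD[OF powr_convex[OF p(1)], of v 1 s] v s by (simp add: A_def)
  then have "(A powr p) ^ m \<le> (1 - v + v * s powr p) ^ m" by (intro power_mono) simp_all
  moreover have "(A powr p) ^ m = A ^ n"
    using A_pos by (simp add: powr_power mult.commute[of p] p(2) powr_realpow)
  ultimately show ?thesis by (simp add: A_def p_def)
qed

text \<open>Integration by parts: \<open>inc_beta n l y + (1 - y\<^sup>2)\<^sup>n y\<^sup>l\<close> is the integral of
  \<open>l (1 - y\<^sup>2)\<^sup>n y\<^sup>l\<^sup>-\<^sup>1\<close>. In this form the integrands for different \<open>n\<close> can be compared.\<close>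

lemma inc_beta_ratio_mono:
  assumes m_le_n: "1 \<le> m" "m \<le> n" and \<rho>: "0 < \<rho>" "\<rho> < 1" and \<sigma>: "0 < \<sigma>" "\<sigma> < 1"
    and one_minus_sq: "1 - \<sigma>\<^sup>2 = (1 - \<rho>\<^sup>2) powr (real n / real m)"
  shows "inc_beta n l \<rho> / \<rho> ^ l \<le> inc_beta m l \<sigma> / \<sigma> ^ l"
proof -
  define U where "U N r x = (inc_beta N l (r * x) + (1 - (r * x)\<^sup>2) ^ N * (r * x) ^ l) / r ^ l"
    for N :: nat and r x :: real
  have DERIV_U: "(U N r has_real_derivative real l * x ^ (l - 1) * (1 - (r * x)\<^sup>2) ^ N) (at x)"
    if "r > 0" for N r x
    unfolding U_def using that
    by (auto intro!: derivative_eq_intros) (cases l; simp add: field_simps power_mult_distrib)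
  have s: "0 < 1 - \<rho>\<^sup>2" using \<rho> by (simp add: abs_square_less_1)
  have "U n \<rho> 1 - U m \<sigma> 1 \<le> U n \<rho> 0 - U m \<sigma> 0"
  proof (rule DERIV_nonpos_imp_nonincreasing[of 0 1 "\<lambda>x. U n \<rho> x - U m \<sigma> x"])
    fix x :: real assume x: "0 \<le> x" "x \<le> 1"
    then have "(1 - x\<^sup>2 + x\<^sup>2 * (1 - \<rho>\<^sup>2)) ^ n \<le> (1 - x\<^sup>2 + x\<^sup>2 * (1 - \<sigma>\<^sup>2)) ^ m"
      unfolding one_minus_sq by (intro power_mean_le m_le_n s) (auto simp: power_le_one)
    then have "(1 - (\<rho> * x)\<^sup>2) ^ n \<le> (1 - (\<sigma> * x)\<^sup>2) ^ m"
      by (simp add: algebra_simps power_mult_distrib)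
    then have "real l * x ^ (l - 1) * (1 - (\<rho> * x)\<^sup>2) ^ n
        \<le> real l * x ^ (l - 1) * (1 - (\<sigma> * x)\<^sup>2) ^ m"
      using x by (intro mult_left_mono) auto
    then show "\<exists>y. ((\<lambda>x. U n \<rho> x - U m \<sigma> x) has_real_derivative y) (at x) \<and> y \<le> 0"
      using DERIV_diff[OF DERIV_U[OF \<rho>(1)] DERIV_U[OF \<sigma>(1)]] by force
  qed simp
  moreover have "U N r 0 = (if l = 0 then 1 else 0)" for N r by (simp add: U_def)
  moreover have "(1 - \<rho>\<^sup>2) ^ n = (1 - \<sigma>\<^sup>2) ^ m"
    using s m_le_n by (simp add: one_minus_sq powr_power powr_realpow)
  ultimately show ?thesis using \<rho> \<sigma> by (simp add: U_def add_divide_distrib)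
qed

lemma cubic_nonneg:
  fixes t :: real
  assumes "t \<le> 1" "0 \<le> t" "k \<ge> 1" "a3 \<ge> 0" "a2 = a3 * (k + 2 * b)" "a3 * (k * b\<^sup>2) \<le> a0"
    and "a3 * (k * b\<^sup>2) - a3 * (2 * k * b + b\<^sup>2) + a1 \<le> a0"
  shows "0 \<le> a0 - a1 * t + a2 * t\<^sup>2 - a3 * t ^ 3"
proof -
  have "0 \<le> a3 * ((k - t) * (t - b)\<^sup>2) + ((1 - t) * (a0 - a3 * (k * b\<^sup>2))
      + t * (a0 - (a3 * (k * b\<^sup>2) - a3 * (2 * k * b + b\<^sup>2) + a1)))"
    using assms by (intro add_nonneg_nonneg mult_nonneg_nonneg) auto
  also have "\<dots> = a0 - a1 * t + a2 * t\<^sup>2 - a3 * t ^ 3"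
    by (simp add: assms(5) power2_eq_square power3_eq_cube algebra_simps)
  finally show ?thesis .
qed

text \<open>After clearing denominators the inequality is a polynomial in \<open>l - 1\<close> whose coefficients
  are nonnegative cubics in \<open>t\<close>.\<close>

lemma inc_beta_3_rational_bound:
  fixes t l :: real
  assumes t: "0 \<le> t" "t \<le> 1" and l: "l \<ge> 1"
  shows "6 * (l + 1) * (t / (l + 2) - 2 * t\<^sup>2 / (l + 4) + t ^ 3 / (l + 6))
      \<le> 1 + (l + 1) * (1 - t) ^ 3"
proof -
  define P where "P = (l + 2) * (l + 4) * (l + 6)"
  define R where "R = 1 + (l + 1) * (1 - t) ^ 3
    - 6 * (l + 1) * (t / (l + 2) - 2 * t\<^sup>2 / (l + 4) + t ^ 3 / (l + 6))"
  define v where "v = l - 1"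
  have v: "v \<ge> 0" "l = v + 1" using l by (simp_all add: v_def)
  \<comment> \<open>In each case \<open>b\<close> is close to the minimizer, and \<open>k\<close> makes the coefficients of \<open>t\<^sup>2\<close> agree.\<close>
  have cubics: "0 \<le> 315 - 1050 * t + 1134 * t\<^sup>2 - 390 * t ^ 3"
    "0 \<le> 318 - 1095 * t + 1233 * t\<^sup>2 - 433 * t ^ 3"
    "0 \<le> 116 - 387 * t + 447 * t\<^sup>2 - 161 * t ^ 3" "0 \<le> 18 - 57 * t + 63 * t\<^sup>2 - 23 * t ^ 3"
    by (rule cubic_nonneg[OF t(2,1), where k = "451/325" and b = "19/25"]
        cubic_nonneg[OF t(2,1), where k = "30907/21650" and b = "71/100"]
        cubic_nonneg[OF t(2,1), where k = "11241/8050" and b = "69/100"]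
        cubic_nonneg[OF t(2,1), where k = "1241/1150" and b = "83/100"];
      simp add: power2_eq_square; fail)+
  have "0 \<le> (315 - 1050 * t + 1134 * t\<^sup>2 - 390 * t ^ 3)
      + v * (318 - 1095 * t + 1233 * t\<^sup>2 - 433 * t ^ 3)
      + v\<^sup>2 * (116 - 387 * t + 447 * t\<^sup>2 - 161 * t ^ 3)
      + v ^ 3 * (18 - 57 * t + 63 * t\<^sup>2 - 23 * t ^ 3) + v ^ 4 * (1 - t) ^ 3"
    using cubics v t by (intro add_nonneg_nonneg mult_nonneg_nonneg) auto
  also have "\<dots> = P * (1 + (l + 1) * (1 - t) ^ 3)
      - 6 * (l + 1) * (t * ((l + 4) * (l + 6)) - 2 * t\<^sup>2 * ((l + 2) * (l + 6))
        + t ^ 3 * ((l + 2) * (l + 4)))"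
    unfolding P_def v(2) by (simp add: numeral_eq_Suc algebra_simps)
  also have "\<dots> = R * P"
  proof -
    have "l + 2 \<noteq> 0" "l + 4 \<noteq> 0" "l + 6 \<noteq> 0" using l by auto
    then show ?thesis unfolding R_def P_def by (simp add: divide_simps) (simp add: algebra_simps)
  qed
  finally have "0 \<le> R * P" .
  moreover have "P > 0" using l by (simp add: P_def)
  ultimately have "0 \<le> R" by (simp add: zero_le_mult_iff)
  then show ?thesis by (simp add: R_def)
qed

lemma inc_beta_2: "inc_beta 2 l x = 4 * (x ^ (l + 2) / real (l + 2) - x ^ (l + 4) / real (l + 4))"
  by (simp add: inc_beta_def numeral_eq_Suc algebra_simps)

lemma inc_beta_3:
  "inc_beta 3 l x = 6 * (x ^ (l + 2) / real (l + 2)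
      - 2 * x ^ (l + 4) / real (l + 4) + x ^ (l + 6) / real (l + 6))"
  by (simp add: inc_beta_def numeral_eq_Suc algebra_simps)

lemma inc_beta_3_le:
  assumes \<rho>: "0 < \<rho>" "\<rho> < 1"
  shows "real (l + 1) * inc_beta 3 l \<rho> \<le> \<rho> ^ l * (1 + real (l + 1) * (1 - \<rho>\<^sup>2) ^ 3)"
proof -
  define t where "t = \<rho>\<^sup>2"
  have t: "0 \<le> t" "t \<le> 1" using \<rho> by (simp_all add: t_def power_le_one)
  define w where "w = t / (real l + 2) - 2 * t\<^sup>2 / (real l + 4) + t ^ 3 / (real l + 6)"
  have "6 * (real l + 1) * w \<le> 1 + (real l + 1) * (1 - t) ^ 3"
  proof (cases "l = 0")
    case True
    have "0 \<le> 2 * (1 - t) ^ 3" using t by simp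
    then show ?thesis using True by (simp add: w_def power2_eq_square power3_eq_cube algebra_simps)
  next
    case False
    then show ?thesis using t unfolding w_def by (intro inc_beta_3_rational_bound) auto
  qed
  then have "\<rho> ^ l * (6 * (real l + 1) * w) \<le> \<rho> ^ l * (1 + (real l + 1) * (1 - t) ^ 3)"
    using \<rho> by (intro mult_left_mono) auto
  moreover have "inc_beta 3 l \<rho> = \<rho> ^ l * (6 * w)"
  proof -
    have "\<rho> ^ 4 = t\<^sup>2" "\<rho> ^ 6 = t ^ 3" by (simp_all add: t_def flip: power_mult)
    then have powers: "\<rho> ^ (l + 2) = \<rho> ^ l * t" "\<rho> ^ (l + 4) = \<rho> ^ l * t\<^sup>2"
      "\<rho> ^ (l + 6) = \<rho> ^ l * t ^ 3"
      by (simp_all only: power_add t_def)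
    show ?thesis unfolding inc_beta_3 powers by (simp add: w_def algebra_simps)
  qed
  ultimately show ?thesis by (simp add: t_def mult_ac add.commute)
qed

lemma inc_beta_le_of_ge_3:
  assumes n: "n \<ge> 3" and \<rho>: "0 < \<rho>" "\<rho> < 1"
  shows "real (l + 1) * inc_beta n l \<rho> \<le> \<rho> ^ l * (1 + real (l + 1) * (1 - \<rho>\<^sup>2) ^ n)"
proof -
  have s: "0 < 1 - \<rho>\<^sup>2" "1 - \<rho>\<^sup>2 < 1" using \<rho> by (simp_all add: abs_square_less_1)
  define t where "t = (1 - \<rho>\<^sup>2) powr (real n / 3)"
  have t: "0 < t" "t < 1" "t ^ 3 = (1 - \<rho>\<^sup>2) ^ n"
    using s n by (auto simp: t_def powr01_less_one powr_power powr_realpow)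
  define \<sigma> where "\<sigma> = sqrt (1 - t)"
  have \<sigma>: "0 < \<sigma>" "\<sigma> < 1" "1 - \<sigma>\<^sup>2 = t" using t by (simp_all add: \<sigma>_def)
  have "real (l + 1) * (inc_beta n l \<rho> / \<rho> ^ l) \<le> real (l + 1) * (inc_beta 3 l \<sigma> / \<sigma> ^ l)"
    using inc_beta_ratio_mono[of 3 n \<rho> \<sigma> l] n \<rho> \<sigma> by (intro mult_left_mono) (auto simp: t_def)
  also have "\<dots> \<le> 1 + real (l + 1) * (1 - \<sigma>\<^sup>2) ^ 3"
    using inc_beta_3_le[OF \<sigma>(1,2), of l] \<sigma>(1) by (simp add: divide_le_eq mult.commute)
  finally show ?thesis using \<rho>(1) by (simp add: \<sigma>(3) t(3) divide_le_eq mult.commute)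
qed

lemma inc_beta_2_le:
  assumes l: "l = 0 \<or> l \<ge> 3" and \<rho>: "0 < \<rho>" "\<rho> < 1"
  shows "real (l + 1) * inc_beta 2 l \<rho> \<le> \<rho> ^ l * (1 + real (l + 1) * (1 - \<rho>\<^sup>2) ^ 2)"
proof -
  define s where "s = 1 - \<rho>\<^sup>2"
  define L where "L = real l"
  have L_cases: "L = 0 \<or> L \<ge> 3" and L_nonneg: "L \<ge> 0" using l by (auto simp: L_def)
  have "0 \<le> L * (L - 2) - 4 * L * (L + 1) * s + (L + 1) * (L + 2) * (L + 8) * s\<^sup>2"
  proof (cases "L = 0")
    case False
    then have L_ge_3: "L \<ge> 3" using L_cases by simp
    define A where "A = (L + 1) * (L + 2) * (L + 8)"
    have A_pos: "A > 0" using L_ge_3 by (simp add: A_def)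
    have "0 \<le> (L + 4) * (L\<^sup>2 - 8) * (L * (L + 1))"
      using L_ge_3 power_mono[of 3 L 2] by (intro mult_nonneg_nonneg) auto
    also have "\<dots> = A * (L * (L - 2)) - (2 * L * (L + 1))\<^sup>2"
      by (simp add: A_def power2_eq_square algebra_simps)
    finally have "0 \<le> (A * s - 2 * L * (L + 1))\<^sup>2 + (A * (L * (L - 2)) - (2 * L * (L + 1))\<^sup>2)"
      by simp
    also have "\<dots> = A * (L * (L - 2) - 4 * L * (L + 1) * s + A * s\<^sup>2)"
      by (simp add: power2_eq_square algebra_simps)
    finally show ?thesis using A_pos by (simp add: zero_le_mult_iff A_def)
  qed simp
  also have "\<dots> = (L + 2) * (L + 4) * (1 + (L + 1) * s\<^sup>2)
      - 4 * (L + 1) * ((1 - s) * ((L + 4) - (L + 2) * (1 - s)))"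
    by (simp add: power2_eq_square algebra_simps)
  finally have polynomial_le: "4 * (L + 1) * ((1 - s) * ((L + 4) - (L + 2) * (1 - s)))
      \<le> (L + 2) * (L + 4) * (1 + (L + 1) * s\<^sup>2)" by simp
  have "(L + 1) * inc_beta 2 l \<rho>
      = \<rho> ^ l * (4 * (L + 1) * (\<rho>\<^sup>2 * ((L + 4) - (L + 2) * \<rho>\<^sup>2)) / ((L + 2) * (L + 4)))"
  proof -
    have "L + 2 \<noteq> 0" "L + 4 \<noteq> 0" using L_nonneg by auto
    then show ?thesis unfolding inc_beta_2
      by (simp add: L_def[symmetric] divide_simps power_add)
        (simp add: algebra_simps numeral_eq_Suc)
  qed
  also have "\<dots> \<le> \<rho> ^ l * (1 + (L + 1) * s\<^sup>2)"
    using polynomial_le \<rho> L_nonneg by (intro mult_left_mono) (auto simp: s_def divide_le_eq mult_ac)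
  finally show ?thesis by (simp add: L_def s_def add.commute)
qed

lemma inc_beta_le:
  assumes n: "n \<ge> 2" and exceptional: "\<not> (n = 2 \<and> l \<in> {1, 2})" and \<rho>: "0 < \<rho>" "\<rho> < 1"
  shows "real (l + 1) * inc_beta n l \<rho> \<le> \<rho> ^ l * (1 + real (l + 1) * (1 - \<rho>\<^sup>2) ^ n)"
proof (cases "n \<ge> 3")
  case False
  then have "n = 2" "l = 0 \<or> l \<ge> 3" using n exceptional by auto
  then show ?thesis using inc_beta_2_le[OF _ \<rho>, of l] by simp
qed (rule inc_beta_le_of_ge_3[OF _ \<rho>])

section \<open>The exceptional weights in dimension two\<close>

text \<open>In dimension two the hypothesis of the ratio bound fails for \<open>l \<in> {1, 2}\<close>, and a summand
  \<open>\<delta>\<close> from the third term of the theorem has to help. With \<open>s = (tanh a)\<^sup>2\<close> that term is at least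
  \<open>1 / (22 s\<^sup>2)\<close> for \<open>9/200 \<le> s \<le> 2/5\<close>, and it is not needed for \<open>s \<ge> 2/5\<close>.\<close>

lemma inc_beta_2_1_diff_ge:
  fixes \<rho> :: real
  assumes \<rho>: "0 < \<rho>" "\<rho> < 1"
  defines "s \<equiv> 1 - \<rho>\<^sup>2"
  shows "(1 - s / 3 - s\<^sup>2 / 4) * s\<^sup>2 \<le> inc_beta 2 1 1 - inc_beta 2 1 \<rho>"
proof -
  have "0 \<le> (1 - \<rho>) ^ 4 * (7 + 28 * \<rho> + 70 * \<rho>\<^sup>2 + 60 * \<rho> ^ 3 + 15 * \<rho> ^ 4)"
    using \<rho> by simp
  also have "\<dots> = (32 - 80 * \<rho> ^ 3 + 48 * \<rho> ^ 5) - 5 * (s\<^sup>2 * (12 - 4 * s - 3 * s\<^sup>2))"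
    unfolding s_def by algebra
  also have "s\<^sup>2 * (12 - 4 * s - 3 * s\<^sup>2) = 12 * ((1 - s / 3 - s\<^sup>2 / 4) * s\<^sup>2)"
    by (simp add: algebra_simps)
  finally have "(1 - s / 3 - s\<^sup>2 / 4) * s\<^sup>2 \<le> 8/15 - 4 * (\<rho> ^ 3 / 3 - \<rho> ^ 5 / 5)"
    by (simp add: field_simps)
  then show ?thesis by (simp add: inc_beta_2 power3_eq_cube)
qed

lemma inc_beta_2_1_polynomial_bound:
  fixes s \<delta> :: real
  assumes s: "0 < s" "s < 1" and \<delta>: "\<delta> \<ge> 0" and \<delta>_small: "s \<le> 2/5 \<Longrightarrow> 1/22 \<le> \<delta> * s\<^sup>2"
  shows "8/15 - (1 - s / 3 - s\<^sup>2 / 4) / 2 \<le> (1 - s / 3 - s\<^sup>2 / 4) * (s\<^sup>2 + \<delta> * s\<^sup>2)"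
proof -
  define B where "B = 1 - s / 3 - s\<^sup>2 / 4"
  have powers: "s ^ 3 \<le> s\<^sup>2" "s\<^sup>2 \<le> s"
    using s power_decreasing[of 2 3 s] power_decreasing[of 1 2 s] by simp_all
  then have B_nonneg: "B \<ge> 0" using s by (simp add: B_def)
  have "8/15 - B / 2 \<le> B * (s\<^sup>2 + \<delta> * s\<^sup>2)"
  proof (cases "s \<le> 2/5")
    case True
    have square: "0 \<le> s\<^sup>2 - 79/300 * s + 6241/360000"
      using zero_le_power2[of "s - 79/600"] by (simp add: power2_eq_square algebra_simps)
    have cube: "s ^ 3 \<le> 2/5 * s\<^sup>2"
      using True s by (simp add: power2_eq_square power3_eq_cube)
    have "s * s ^ 3 \<le> 2/5 * s ^ 3" using True s by (intro mult_right_mono) auto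
    then have fourth: "s ^ 4 \<le> 4/25 * s\<^sup>2" using cube by (simp add: eval_nat_numeral)
    have "8/15 - B / 2 = 1/30 + s / 6 + s\<^sup>2 / 8" by (simp add: B_def field_simps)
    also have "\<dots> \<le> s\<^sup>2 - s\<^sup>2 / 88 - s ^ 3 / 3 - s ^ 4 / 4 + 1/22 - s / 66"
      using square cube fourth s True by linarith
    also have "\<dots> = B * (s\<^sup>2 + 1/22)"
      by (simp add: B_def field_simps) (simp add: eval_nat_numeral)
    also have "\<dots> \<le> B * (s\<^sup>2 + \<delta> * s\<^sup>2)"
      using \<delta>_small[OF True] B_nonneg by (intro mult_left_mono) auto
    finally show ?thesis .
  next
    case False
    have "0 \<le> (s - 2/5) * (57/500 + 421/600 * s - 13/30 * s\<^sup>2 - s ^ 3 / 4)"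
      using False s powers by (intro mult_nonneg_nonneg) linarith+
    also have "\<dots> = B * s\<^sup>2 + B / 2 - 8/15 - 23/1875"
      by (simp add: B_def power2_eq_square power3_eq_cube field_simps)
    finally have "8/15 - B / 2 \<le> B * s\<^sup>2" by simp
    also have "\<dots> \<le> B * (s\<^sup>2 + \<delta> * s\<^sup>2)" using B_nonneg \<delta> by (intro mult_left_mono) auto
    finally show ?thesis .
  qed
  then show ?thesis by (simp add: B_def)
qed

lemma inc_beta_2_1_ratio_le:
  fixes \<rho> \<delta> :: real
  assumes \<rho>: "0 < \<rho>" "\<rho> < 1" and \<delta>: "\<delta> \<ge> 0"
  defines "s \<equiv> 1 - \<rho>\<^sup>2"
  assumes \<delta>_small: "s \<le> 2/5 \<Longrightarrow> 1/22 \<le> \<delta> * s\<^sup>2"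
  shows "inc_beta 2 1 1 \<le> (inc_beta 2 1 1 - inc_beta 2 1 \<rho>) * (1 + 1 / (2 * s\<^sup>2) + \<delta>)"
proof -
  define B where "B = 1 - s / 3 - s\<^sup>2 / 4"
  have s: "0 < s" "s < 1" using \<rho> by (simp_all add: s_def abs_square_less_1)
  have "inc_beta 2 1 1 = 8/15" by (simp add: inc_beta_2)
  also have "\<dots> \<le> B * (s\<^sup>2 + \<delta> * s\<^sup>2) + B / 2"
    using inc_beta_2_1_polynomial_bound[OF s \<delta> \<delta>_small] unfolding B_def by linarith
  also have "\<dots> = B * s\<^sup>2 * (1 + 1 / (2 * s\<^sup>2) + \<delta>)"
    using s by (simp add: field_simps)
  also have "\<dots> \<le> (inc_beta 2 1 1 - inc_beta 2 1 \<rho>) * (1 + 1 / (2 * s\<^sup>2) + \<delta>)"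
    using inc_beta_2_1_diff_ge[OF \<rho>] \<delta> unfolding B_def s_def by (intro mult_right_mono) auto
  finally show ?thesis .
qed

lemma inc_beta_2_2_polynomial_bound:
  fixes s \<delta> :: real
  assumes s: "0 < s" "s < 1" and \<delta>: "\<delta> \<ge> 0" and \<delta>_small: "s \<le> 2/5 \<Longrightarrow> 1/22 \<le> \<delta> * s\<^sup>2"
  shows "2 * s / 9 \<le> (1 - 2 * s / 3) * (s\<^sup>2 + \<delta> * s\<^sup>2)"
proof (cases "s \<le> 2/5")
  case True
  have "0 \<le> s\<^sup>2 - s / 3 + 1/36"
    using zero_le_power2[of "s - 1/6"] by (simp add: power2_eq_square algebra_simps)
  moreover have "s ^ 3 \<le> 2/5 * s\<^sup>2"
    using True s by (simp add: power3_eq_cube power2_eq_square)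
  moreover have "(1 - 2 * s / 3) * (s\<^sup>2 + 1/22) = s\<^sup>2 - 2/3 * s ^ 3 + 1/22 - s / 33"
    by (simp add: power2_eq_square power3_eq_cube field_simps)
  ultimately have "2 * s / 9 \<le> (1 - 2 * s / 3) * (s\<^sup>2 + 1/22)" using s True by linarith
  also have "\<dots> \<le> (1 - 2 * s / 3) * (s\<^sup>2 + \<delta> * s\<^sup>2)"
    using \<delta>_small[OF True] s by (intro mult_left_mono) auto
  finally show ?thesis .
next
  case False
  have "0 \<le> (s - 2/5) * (1 - s)" using False s by simp
  also have "\<dots> = 7/5 * s - s\<^sup>2 - 2/5" by (simp add: power2_eq_square field_simps)
  finally have "2/9 \<le> s - 2/3 * s\<^sup>2" using False by linarith
  also have "\<dots> = s * (1 - 2 * s / 3)" by (simp add: power2_eq_square field_simps)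
  finally have "s * (2/9) \<le> s * (s * (1 - 2 * s / 3))" using s by (intro mult_left_mono) auto
  then have "2 * s / 9 \<le> (1 - 2 * s / 3) * s\<^sup>2" by (simp add: power2_eq_square algebra_simps)
  also have "\<dots> \<le> (1 - 2 * s / 3) * (s\<^sup>2 + \<delta> * s\<^sup>2)" using s \<delta> by (intro mult_left_mono) auto
  finally show ?thesis .
qed

lemma inc_beta_2_2_ratio_le:
  fixes \<rho> \<delta> :: real
  assumes \<rho>: "0 < \<rho>" "\<rho> < 1" and \<delta>: "\<delta> \<ge> 0"
  defines "s \<equiv> 1 - \<rho>\<^sup>2"
  assumes \<delta>_small: "s \<le> 2/5 \<Longrightarrow> 1/22 \<le> \<delta> * s\<^sup>2"
  shows "inc_beta 2 2 1 \<le> (inc_beta 2 2 1 - inc_beta 2 2 \<rho>) * (1 + 1 / (3 * s\<^sup>2) + \<delta>)"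
proof -
  have s: "0 < s" "s < 1" using \<rho> by (simp_all add: s_def abs_square_less_1)
  have diff: "inc_beta 2 2 1 - inc_beta 2 2 \<rho> = s\<^sup>2 * (1 - 2 * s / 3)"
  proof -
    have "\<rho> ^ 4 = (1 - s)\<^sup>2" "\<rho> ^ 6 = (1 - s) ^ 3" by (simp_all add: s_def flip: power_mult)
    then show ?thesis
      by (simp add: inc_beta_2) (simp add: power2_eq_square power3_eq_cube field_simps)
  qed
  have "inc_beta 2 2 1 = 1/3" by (simp add: inc_beta_2)
  also have "\<dots> \<le> (1 - 2 * s / 3) * (s\<^sup>2 + \<delta> * s\<^sup>2) + (1/3 - 2 * s / 9)"
    using inc_beta_2_2_polynomial_bound[OF s \<delta> \<delta>_small] by linarith
  also have "\<dots> = s\<^sup>2 * (1 - 2 * s / 3) * (1 + 1 / (3 * s\<^sup>2) + \<delta>)"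
    using s by (simp add: field_simps)
  finally show ?thesis unfolding diff .
qed

lemma cutoff_ratio_le:
  fixes s c \<beta> :: real
  assumes s: "0 < s" "s \<le> 9/200" and c_pos: "c > 0" and product_le: "c * \<beta> \<le> 16/15"
  defines "X \<equiv> 2 * s / (1 + s)\<^sup>2"
  shows "\<beta> \<le> X\<^sup>2 / 3 * (1 - X / 2) * (1 + 1 / (c * s\<^sup>2))"
proof -
  define w where "w = 1 + s"
  have w_pos: "w > 0" using s by (simp add: w_def)
  have "s\<^sup>2 \<le> (9/200)\<^sup>2" "s ^ 3 \<le> (9/200) ^ 3" "s ^ 4 \<le> (9/200) ^ 4"
    "s ^ 5 \<le> (9/200) ^ 5" "s ^ 6 \<le> (9/200) ^ 6"
    using s by (intro power_mono; simp)+
  then have "0 \<le> 1 - 19 * s - 55 * s\<^sup>2 - 80 * s ^ 3 - 60 * s ^ 4 - 24 * s ^ 5 - 4 * s ^ 6"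
    using s by (simp add: power_divide)
  also have "\<dots> = 5 * (1 + s + s\<^sup>2) - 4 * w ^ 6" unfolding w_def by algebra
  finally have numerator_le: "16/15 * (3 * w ^ 6) \<le> 4 * (1 + s + s\<^sup>2)" by simp
  have X_eq: "X\<^sup>2 / 3 * (1 - X / 2) = 4 * s\<^sup>2 * (1 + s + s\<^sup>2) / (3 * w ^ 6)"
  proof -
    have "X\<^sup>2 = 4 * s\<^sup>2 / w ^ 4"
      unfolding X_def w_def[symmetric]
      by (simp add: power_divide power_mult_distrib flip: power_mult)
    moreover have "1 - X / 2 = (1 + s + s\<^sup>2) / w\<^sup>2"
      unfolding X_def w_def[symmetric] using w_pos
      by (simp add: field_simps) (simp add: w_def power2_eq_square algebra_simps)
    ultimately show ?thesis by (simp add: power_add[symmetric])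
  qed
  have "c * \<beta> * (3 * w ^ 6) \<le> 16/15 * (3 * w ^ 6)"
    using product_le w_pos by (intro mult_right_mono) auto
  also note numerator_le
  also have "4 * (1 + s + s\<^sup>2) \<le> 4 * (1 + s + s\<^sup>2) * (1 + c * s\<^sup>2)"
    using mult_left_mono[of 1 "1 + c * s\<^sup>2" "4 * (1 + s + s\<^sup>2)"] c_pos s by simp
  finally have "\<beta> \<le> 4 * (1 + s + s\<^sup>2) * (1 + c * s\<^sup>2) / (c * (3 * w ^ 6))"
    using c_pos w_pos by (simp add: pos_le_divide_eq mult_ac)
  also have "\<dots> = X\<^sup>2 / 3 * (1 - X / 2) * (1 + 1 / (c * s\<^sup>2))"
    unfolding X_eq using c_pos s w_pos by (simp add: field_simps)
  finally show ?thesis .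
qed

section \<open>Hyperbolic functions\<close>

lemma sinh_mult_ge:
  fixes c x :: real
  assumes c: "c \<ge> 1" and x: "x \<ge> 0"
  shows "c * sinh x \<le> sinh (c * x)"
proof -
  have "sinh (c * 0) - c * sinh 0 \<le> sinh (c * x) - c * sinh x"
  proof (rule DERIV_nonneg_imp_nondecreasing[of 0 x "\<lambda>y. sinh (c * y) - c * sinh y"])
    fix y :: real assume "0 \<le> y" "y \<le> x"
    then have "cosh y \<le> cosh (c * y)"
      using c mult_right_mono[of 1 c y] by (subst cosh_real_nonneg_le_iff) auto
    then have "0 \<le> c * (cosh (c * y) - cosh y)" using c by simp
    moreover have "((\<lambda>y. sinh (c * y) - c * sinh y)
        has_real_derivative c * (cosh (c * y) - cosh y)) (at y)"
      by (auto intro!: derivative_eq_intros simp: algebra_simps)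
    ultimately show "\<exists>D. ((\<lambda>y. sinh (c * y) - c * sinh y) has_real_derivative D) (at y) \<and> 0 \<le> D"
      by blast
  qed (rule x)
  then show ?thesis by simp
qed

lemma cosh_real_gt_1: "x \<noteq> 0 \<Longrightarrow> 1 < cosh x" for x :: real
  using cosh_real_ge_1[of x] by (simp add: less_le)

lemma cosh_midpoint_sq_le: "(cosh ((x + y) / 2))\<^sup>2 \<le> cosh x * cosh y" for x y :: real
proof -
  define u where "u = (x + y) / 2"
  have "x + y = 2 * u" by (simp add: u_def)
  then have "cosh (x + y) = 2 * (cosh u)\<^sup>2 - 1" by (simp only: cosh_double_cosh)
  moreover have "cosh (x + y) + cosh (x - y) = 2 * (cosh x * cosh y)"
    by (simp add: cosh_add cosh_diff)
  ultimately show ?thesis using cosh_real_ge_1[of "x - y"] unfolding u_def by linarith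
qed

lemma cosh_sq_mult_one_minus_tanh_sq: "(cosh a)\<^sup>2 * (1 - (tanh a)\<^sup>2) = 1" for a :: real
  using cosh_real_pos[of a]
  by (simp add: tanh_def power_divide right_diff_distrib hyperbolic_pythagoras)

lemma one_minus_inverse_cosh_sq: "1 - (1 / cosh a)\<^sup>2 = (tanh a)\<^sup>2" for a :: real
  using cosh_sq_mult_one_minus_tanh_sq[of a] cosh_real_pos[of a]
  by (simp add: power_divide field_simps)

lemma tanh_sq_less_1: "(tanh a)\<^sup>2 < 1" for a :: real
  using tanh_real_bounds[of a] by (simp add: abs_square_less_1 abs_less_iff)

lemma cosh_double_tanh: "cosh (2 * a) = (1 + (tanh a)\<^sup>2) / (1 - (tanh a)\<^sup>2)" for a :: real
proof -
  have "cosh (2 * a) = (cosh a)\<^sup>2 * (1 + (tanh a)\<^sup>2)"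
    by (simp add: cosh_double tanh_def power_divide distrib_left)
  then have "cosh (2 * a) * (1 - (tanh a)\<^sup>2) = 1 + (tanh a)\<^sup>2"
    using cosh_sq_mult_one_minus_tanh_sq[of a] by (simp add: mult_ac)
  then show ?thesis using tanh_sq_less_1[of a] by (simp add: eq_divide_eq)
qed

lemma sinh_cosh_ratio_ge:
  fixes a :: real
  assumes a: "a > 0" and k: "k \<le> 8"
  defines "s \<equiv> (tanh a)\<^sup>2"
  shows "39 * (1 - s) ^ 6 / (1 + s) ^ 4
      \<le> sinh (5 * a / 2) ^ 4 / (sinh a ^ 4 * cosh (3 * a / 2) ^ k)"
proof -
  have s: "0 \<le> s" "s < 1" using tanh_sq_less_1[of a] by (simp_all add: s_def)
  have "(5 / 2) ^ 4 * sinh a ^ 4 \<le> sinh (5 * a / 2) ^ 4"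
    unfolding power_mult_distrib[symmetric] using a sinh_mult_ge[of "5 / 2" a]
    by (intro power_mono) auto
  moreover have "39 * sinh a ^ 4 \<le> (5 / 2) ^ 4 * sinh a ^ 4"
    by (intro mult_right_mono) (simp_all add: power_divide)
  ultimately have "39 * sinh a ^ 4 \<le> sinh (5 * a / 2) ^ 4"
    by linarith
  moreover have "cosh (3 * a / 2) ^ k * (1 - s) ^ 6 \<le> (1 + s) ^ 4"
  proof -
    have "cosh (3 * a / 2) ^ k \<le> cosh (3 * a / 2) ^ 8"
      using k by (intro power_increasing cosh_real_ge_1) auto
    also have "\<dots> = ((cosh (3 * a / 2))\<^sup>2) ^ 4" by (simp flip: power_mult)
    also have "\<dots> \<le> (cosh a * cosh (2 * a)) ^ 4"
      using cosh_midpoint_sq_le[of a "2 * a"] by (intro power_mono) (simp_all add: add.commute)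
    finally have "cosh (3 * a / 2) ^ k * (1 - s) ^ 6 \<le> (cosh a * cosh (2 * a)) ^ 4 * (1 - s) ^ 6"
      using s by (intro mult_right_mono) auto
    also have "\<dots> = ((cosh a)\<^sup>2 * (1 - s))\<^sup>2 * (cosh (2 * a) * (1 - s)) ^ 4"
      by algebra
    also have "\<dots> = (1 + s) ^ 4"
      using s cosh_sq_mult_one_minus_tanh_sq[of a] by (simp add: cosh_double_tanh flip: s_def)
    finally show ?thesis .
  qed
  ultimately have "39 * sinh a ^ 4 * (cosh (3 * a / 2) ^ k * (1 - s) ^ 6)
      \<le> sinh (5 * a / 2) ^ 4 * (1 + s) ^ 4"
    using s by (intro mult_mono) auto
  then have "39 * (1 - s) ^ 6 * (sinh a ^ 4 * cosh (3 * a / 2) ^ k)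
      \<le> sinh (5 * a / 2) ^ 4 * (1 + s) ^ 4"
    by (simp add: mult_ac)
  moreover have "0 < (1 + s) ^ 4" "0 < sinh a ^ 4 * cosh (3 * a / 2) ^ k" using s a by simp_all
  ultimately show ?thesis
    by (simp only: pos_divide_le_eq times_divide_eq_left pos_le_divide_eq)
qed

lemma sinh_cosh_ratio_mult_tanh_ge:
  fixes a :: real
  assumes a: "a > 0" and k: "k \<le> 8"
  defines "s \<equiv> (tanh a)\<^sup>2"
  assumes s: "9/200 \<le> s" "s \<le> 2/5"
  shows "1/22 \<le> sinh (5 * a / 2) ^ 4 / (sinh a ^ 4 * cosh (3 * a / 2) ^ k) * s\<^sup>2"
proof -
  have "0 \<le> (s - 9/200) * (2/5 - s) * (29 * s\<^sup>2 + (54 - 74 * s))"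
    using s by (intro mult_nonneg_nonneg add_nonneg_nonneg) auto
  also have "\<dots> = - 29 * s ^ 4 + 17381/200 * s ^ 3 - 21863/250 * s\<^sup>2 + 12681/500 * s - 243/250"
    by (simp add: eval_nat_numeral field_simps)
  also have "\<dots> \<le> - 29 * s ^ 4 + 87 * s ^ 3 - 88 * s\<^sup>2 + 27 * s - 1"
  proof -
    have "s\<^sup>2 \<le> 2/5 * s" "0 \<le> s ^ 3" using s by (simp_all add: power2_eq_square)
    then show ?thesis using s by linarith
  qed
  also have "\<dots> = 29 * s * (1 - s) ^ 3 - (1 + s)\<^sup>2"
    by (simp add: eval_nat_numeral algebra_simps)
  finally have "(1 + s)\<^sup>2 \<le> 29 * s * (1 - s) ^ 3" by simp
  then have "((1 + s)\<^sup>2)\<^sup>2 \<le> (29 * s * (1 - s) ^ 3)\<^sup>2" using s by (intro power_mono) auto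
  then have "(1 + s) ^ 4 \<le> 841 * s\<^sup>2 * (1 - s) ^ 6"
    by (simp add: power_mult_distrib flip: power_mult)
  also have "\<dots> \<le> 858 * s\<^sup>2 * (1 - s) ^ 6" using s by (intro mult_right_mono) auto
  finally have "1/22 \<le> 39 * (1 - s) ^ 6 / (1 + s) ^ 4 * s\<^sup>2" using s by (simp add: field_simps)
  also have "\<dots> \<le> sinh (5 * a / 2) ^ 4 / (sinh a ^ 4 * cosh (3 * a / 2) ^ k) * s\<^sup>2"
    using sinh_cosh_ratio_ge[OF a k] unfolding s_def by (rule mult_right_mono) simp
  finally show ?thesis .
qed

section \<open>Sums over separated points\<close>

definition orbit_sum_bound :: "nat \<Rightarrow> nat \<Rightarrow> real \<Rightarrow> real" where
  "orbit_sum_bound n k a = 1 + cosh a ^ (2 * n) / ((real k - 2 * real n - 1) * sinh a ^ (2 * n))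
    + sinh (5 * a / 2) ^ (2 * n) / (sinh a ^ (2 * n) * cosh (3 * a / 2) ^ k)"

lemma orbit_sum_bound_tanh:
  assumes "a > 0"
  shows "orbit_sum_bound n (2 * n + 2 + l) a = 1 + 1 / (real (l + 1) * ((tanh a)\<^sup>2) ^ n)
    + sinh (5 * a / 2) ^ (2 * n) / (sinh a ^ (2 * n) * cosh (3 * a / 2) ^ (2 * n + 2 + l))"
proof -
  have "cosh a ^ (2 * n) / (real (l + 1) * sinh a ^ (2 * n))
      = 1 / (real (l + 1) * ((tanh a)\<^sup>2) ^ n)"
    by (simp add: tanh_def power_divide flip: power_mult)
  moreover have "real (2 * n + 2 + l) - 2 * real n - 1 = real (l + 1)" by simp
  ultimately show ?thesis by (simp only: orbit_sum_bound_def)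
qed

lemma orbit_sum_bound_ge:
  assumes "a > 0"
  shows "1 + 1 / (real (l + 1) * ((tanh a)\<^sup>2) ^ n) \<le> orbit_sum_bound n (2 * n + 2 + l) a"
  unfolding orbit_sum_bound_tanh[OF assms] using assms by simp

lemma inc_beta_le_orbit_sum_bound:
  assumes n: "n \<ge> 2" and a: "a > 0"
    and not_small: "n = 2 \<Longrightarrow> l \<in> {1, 2} \<Longrightarrow> 9/200 \<le> (tanh a)\<^sup>2"
  shows "inc_beta n l 1
    \<le> (inc_beta n l 1 - inc_beta n l (1 / cosh a)) * orbit_sum_bound n (2 * n + 2 + l) a"
proof -
  define \<rho> where "\<rho> = 1 / cosh a"
  define s where "s = (tanh a)\<^sup>2"
  define \<delta> where "\<delta> = sinh (5 * a / 2) ^ (2 * n)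
    / (sinh a ^ (2 * n) * cosh (3 * a / 2) ^ (2 * n + 2 + l))"
  have "cosh a > 1" using a by (simp add: cosh_real_gt_1)
  then have \<rho>: "0 < \<rho>" "\<rho> < 1" by (simp_all add: \<rho>_def)
  have s: "1 - \<rho>\<^sup>2 = s"
    unfolding \<rho>_def s_def by (rule one_minus_inverse_cosh_sq)
  have bound: "orbit_sum_bound n (2 * n + 2 + l) a = 1 + 1 / (real (l + 1) * s ^ n) + \<delta>"
    unfolding s_def \<delta>_def using a by (rule orbit_sum_bound_tanh)
  have \<delta>: "\<delta> \<ge> 0" using a by (simp add: \<delta>_def)
  have "inc_beta n l 1 \<le> (inc_beta n l 1 - inc_beta n l \<rho>) * (1 + 1 / (real (l + 1) * s ^ n) + \<delta>)"
  proof (cases "n = 2 \<and> l \<in> {1, 2}")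
    case True
    have "1/22 \<le> \<delta> * s\<^sup>2" if "s \<le> 2/5"
      using sinh_cosh_ratio_mult_tanh_ge[OF a, of "2 * n + 2 + l"] True not_small that
      by (auto simp: \<delta>_def s_def)
    then show ?thesis
      using True inc_beta_2_1_ratio_le[OF \<rho> \<delta>] inc_beta_2_2_ratio_le[OF \<rho> \<delta>] by (auto simp: s)
  next
    case False
    have "inc_beta n l 1
        \<le> (inc_beta n l 1 - inc_beta n l \<rho>) * (1 + 1 / (real (l + 1) * s ^ n))"
      using inc_beta_ratio_le[OF n \<rho> inc_beta_le[OF n False]] by (simp add: s)
    also have "\<dots> \<le> (inc_beta n l 1 - inc_beta n l \<rho>) * (1 + 1 / (real (l + 1) * s ^ n) + \<delta>)"
      using inc_beta_less[of n \<rho> 1 l] \<rho> n \<delta> by (intro mult_left_mono) auto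
    finally show ?thesis .
  qed
  then show ?thesis unfolding bound by (simp add: \<rho>_def)
qed

lemma cutoff_radius_eq:
  fixes a :: real
  shows "2 * (tanh a)\<^sup>2 / (1 + (tanh a)\<^sup>2)\<^sup>2 = ((cosh (2 * a))\<^sup>2 - 1) / (2 * (cosh (2 * a))\<^sup>2)"
proof -
  define s where "s = (tanh a)\<^sup>2"
  have s: "0 \<le> s" "s < 1" by (simp_all add: s_def tanh_sq_less_1)
  have "1 / (cosh (2 * a))\<^sup>2 = (1 - s)\<^sup>2 / (1 + s)\<^sup>2"
    by (simp add: cosh_double_tanh s_def power_divide)
  then have "1 - 1 / (cosh (2 * a))\<^sup>2 = ((1 + s)\<^sup>2 - (1 - s)\<^sup>2) / (1 + s)\<^sup>2"
    using s by (simp add: diff_divide_distrib)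
  also have "(1 + s)\<^sup>2 - (1 - s)\<^sup>2 = 4 * s" by algebra
  finally have "2 * (2 * s / (1 + s)\<^sup>2) = 1 - 1 / (cosh (2 * a))\<^sup>2" by simp
  then show ?thesis by (simp add: field_simps flip: s_def)
qed

locale separated_points =
  fixes p :: "complex ^ 'n::finite" and I :: "'i set" and z :: "'i \<Rightarrow> complex ^ 'n" and a :: real
  assumes p: "p \<in> unit_ball" and I: "finite I" and z: "\<And>i. i \<in> I \<Longrightarrow> z i \<in> unit_ball"
    and a: "a > 0"
    and separated: "\<And>i j. i \<in> I \<Longrightarrow> j \<in> I \<Longrightarrow> i \<noteq> j \<Longrightarrow> 4 * a \<le> hyp_dist (z i) (z j)"
begin

lemma cosh_half_hyp_dist_ge:
  assumes "i \<in> I" "j \<in> I" "i \<noteq> j"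
  shows "cosh (2 * a) \<le> cosh (hyp_dist (z i) (z j) / 2)"
  using separated[OF assms] a by (subst cosh_real_nonneg_le_iff) auto

lemma ball_packing:
  "(\<Sum>i\<in>I. 1 / cosh (hyp_dist p (z i) / 2) ^ (2 * CARD('n) + 2 + l))
      * (inc_beta CARD('n) l 1 - inc_beta CARD('n) l (1 / cosh a)) \<le> inc_beta CARD('n) l 1"
proof (rule ball_packing_inequality[OF p I z])
  define \<rho> where "\<rho> = 1 / cosh a"
  have "cosh a > 1" using a by (simp add: cosh_real_gt_1)
  then have \<rho>: "0 < \<rho>" "\<rho> < 1" by (simp_all add: \<rho>_def)
  have tanh: "1 - \<rho>\<^sup>2 = (tanh a)\<^sup>2"
    unfolding \<rho>_def by (rule one_minus_inverse_cosh_sq)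
  let ?H = "indicator {..<1 - \<rho>\<^sup>2} :: real \<Rightarrow> real"
  show "ennreal (inc_beta CARD('n) l 1 - inc_beta CARD('n) l (1 / cosh a))
      \<le> radial_integral CARD('n) l ?H"
    using \<rho> by (simp add: radial_integral_indicator \<rho>_def)
  show "0 \<le> inc_beta CARD('n) l 1 - inc_beta CARD('n) l (1 / cosh a)"
    using inc_beta_less[of "CARD('n)" \<rho> 1 l] \<rho> by (simp add: \<rho>_def Suc_leI)
  show "(\<Sum>i\<in>I. ?H ((norm (w i))\<^sup>2)) \<le> 1"
    if "\<And>i. i \<in> I \<Longrightarrow> w i \<in> unit_ball"
      "\<And>i j. i \<in> I \<Longrightarrow> j \<in> I \<Longrightarrow> hyp_dist (w i) (w j) = hyp_dist (z i) (z j)"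
    for w :: "'i \<Rightarrow> complex ^ 'n"
    unfolding tanh using I tanh_sq_less_1
  proof (rule separated_indicator_sum_le_1)
    fix i j assume "i \<in> I" "j \<in> I" "i \<noteq> j"
    then show "(1 + (tanh a)\<^sup>2) / (1 - (tanh a)\<^sup>2) \<le> cosh (hyp_dist (w i) (w j) / 2)"
      using cosh_half_hyp_dist_ge that(2) by (simp add: cosh_double_tanh)
  qed
qed auto

lemma blichfeldt_packing:
  assumes n: "CARD('n) = 2" and l: "l \<le> 2"
  defines "X \<equiv> 2 * (tanh a)\<^sup>2 / (1 + (tanh a)\<^sup>2)\<^sup>2"
  shows "0 < X" "X < 1"
    and "(\<Sum>i\<in>I. 1 / cosh (hyp_dist p (z i) / 2) ^ (2 * CARD('n) + 2 + l)) * (X\<^sup>2 / 3 * (1 - X / 2))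
      \<le> inc_beta 2 l 1"
proof -
  define K where "K = (cosh (2 * a))\<^sup>2"
  have K_gt_1: "K > 1" using a by (simp add: K_def cosh_real_gt_1 one_less_power)
  have X_eq: "X = (K - 1) / (2 * K)" unfolding X_def K_def by (rule cutoff_radius_eq)
  show X_bounds: "0 < X" "X < 1" using K_gt_1 by (simp_all add: X_eq field_simps)
  have "(\<Sum>i\<in>I. 1 / cosh (hyp_dist p (z i) / 2) ^ (2 * CARD('n) + 2 + l)) * (X\<^sup>2 / 3 * (1 - X / 2))
      \<le> inc_beta CARD('n) l 1"
  proof (rule ball_packing_inequality[OF p I z])
    show "ennreal (X\<^sup>2 / 3 * (1 - X / 2)) \<le> radial_integral CARD('n) l (\<lambda>t. max 0 (1 - t / X))"
      using radial_integral_2_cutoff_ge[OF X_bounds l] by (simp add: n)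
    show "(\<Sum>i\<in>I. max 0 (1 - (norm (w i))\<^sup>2 / X)) \<le> 1"
      if w: "\<And>i. i \<in> I \<Longrightarrow> w i \<in> unit_ball"
        "\<And>i j. i \<in> I \<Longrightarrow> j \<in> I \<Longrightarrow> hyp_dist (w i) (w j) = hyp_dist (z i) (z j)"
      for w :: "'i \<Rightarrow> complex ^ 'n"
      unfolding X_eq using I K_gt_1
    proof (rule blichfeldt_sum_le_1)
      fix i j assume distinct: "i \<in> I" "j \<in> I" "i \<noteq> j"
      then have "K \<le> (cosh (hyp_dist (w i) (w j) / 2))\<^sup>2"
        using cosh_half_hyp_dist_ge w(2) by (auto simp: K_def intro!: power_mono)
      then show "2 * (w i \<bullet> w j) \<le> K * ((norm (w i))\<^sup>2 + (norm (w j))\<^sup>2) - (K - 1)"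
        using w(1) distinct K_gt_1 by (intro inner_le_of_cosh_half_hyp_dist_ge) auto
    qed
  qed (use X_bounds in auto)
  then show "(\<Sum>i\<in>I. 1 / cosh (hyp_dist p (z i) / 2) ^ (2 * CARD('n) + 2 + l))
      * (X\<^sup>2 / 3 * (1 - X / 2))
      \<le> inc_beta 2 l 1" by (simp add: n)
qed

text \<open>Disjoint balls are too wasteful when the dimension is two, the weight is 7 or 8 and the
  points are close together; Blichfeldt's overlapping weights are used there.\<close>

lemma sum_inverse_power_cosh_le:
  assumes n: "CARD('n) \<ge> 2" and k: "k \<ge> 2 * CARD('n) + 2"
  shows "(\<Sum>i\<in>I. 1 / cosh (hyp_dist p (z i) / 2) ^ k) \<le> orbit_sum_bound CARD('n) k a"
proof -
  obtain l where l: "k = 2 * CARD('n) + 2 + l" using k le_Suc_ex by blast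
  define S where "S = (\<Sum>i\<in>I. 1 / cosh (hyp_dist p (z i) / 2) ^ k)"
  define \<beta> where "\<beta> = inc_beta CARD('n) l 1"
  obtain J where J: "J > 0" "S * J \<le> \<beta>" "\<beta> \<le> J * orbit_sum_bound CARD('n) k a"
  proof (cases "CARD('n) = 2 \<and> l \<in> {1, 2} \<and> (tanh a)\<^sup>2 < 9/200")
    case True
    define X where "X = 2 * (tanh a)\<^sup>2 / (1 + (tanh a)\<^sup>2)\<^sup>2"
    define J where "J = X\<^sup>2 / 3 * (1 - X / 2)"
    have X_bounds: "0 < X" "X < 1" and packing: "S * J \<le> \<beta>"
      using True blichfeldt_packing[of l] by (auto simp: X_def J_def S_def \<beta>_def l)
    have "J > 0" using X_bounds by (simp add: J_def)
    have "\<beta> \<le> J * (1 + 1 / (real (l + 1) * ((tanh a)\<^sup>2)\<^sup>2))"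
      unfolding J_def X_def
    proof (rule cutoff_ratio_le)
      show "real (l + 1) * \<beta> \<le> 16/15" using True by (auto simp: \<beta>_def inc_beta_2)
    qed (use True a in auto)
    also have "\<dots> \<le> J * orbit_sum_bound CARD('n) k a"
      using orbit_sum_bound_ge[OF a, of l 2] \<open>J > 0\<close> True by (intro mult_left_mono) (auto simp: l)
    finally show thesis using that \<open>J > 0\<close> packing by blast
  next
    case False
    then have "\<beta> \<le> (\<beta> - inc_beta CARD('n) l (1 / cosh a)) * orbit_sum_bound CARD('n) k a"
      unfolding \<beta>_def l using n a by (intro inc_beta_le_orbit_sum_bound) auto
    moreover have "S * (\<beta> - inc_beta CARD('n) l (1 / cosh a)) \<le> \<beta>"
      unfolding S_def \<beta>_def l by (rule ball_packing)
    moreover have "inc_beta CARD('n) l (1 / cosh a) < \<beta>"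
      unfolding \<beta>_def using n a cosh_real_gt_1[of a] by (intro inc_beta_less) auto
    ultimately show thesis using that[of "\<beta> - inc_beta CARD('n) l (1 / cosh a)"] by simp
  qed
  have "J * S \<le> J * orbit_sum_bound CARD('n) k a" using J(2,3) by (simp add: mult.commute)
  then show ?thesis using J(1) by (simp add: S_def)
qed

end

section \<open>The action on the ball\<close>

lemma mult_lift_None: "(g *v lift z) $ None = aut_factor g z"
  by (simp add: matrix_vector_mult_def sum_option aut_factor_def add.commute)

lemma ball_act_eq_dehom: "ball_act g z = dehom (g *v lift z)"
  by (simp add: vec_eq_iff ball_act_def dehom_def mult_lift_None)
    (simp add: matrix_vector_mult_def sum_option add.commute)

lemma
  assumes g: "g \<in> U_n1" and z: "z \<in> unit_ball"
  shows aut_factor_nonzero: "aut_factor g z \<noteq> 0"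
    and mult_lift: "g *v lift z = aut_factor g z *s lift (ball_act g z)"
    and ball_act_unit_ball: "ball_act g z \<in> unit_ball"
proof -
  have qform_pos: "qform (g *v lift z) > 0"
    using z by (simp add: qform_U_n1[OF g] qform_lift_pos_iff)
  from qform_pos_imp_nth_None[OF qform_pos] show nonzero: "aut_factor g z \<noteq> 0"
    by (simp add: mult_lift_None)
  from lift_dehom[of "g *v lift z"] nonzero
  show "g *v lift z = aut_factor g z *s lift (ball_act g z)"
    by (simp add: mult_lift_None ball_act_eq_dehom)
  from dehom_in_unit_ball[OF qform_pos] show "ball_act g z \<in> unit_ball"
    by (simp add: ball_act_eq_dehom)
qed

lemma ball_act_mult:
  assumes "h \<in> U_n1" "z \<in> unit_ball"
  shows "ball_act (g ** h) z = ball_act g (ball_act h z)"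
proof -
  have "(g ** h) *v lift z = aut_factor h z *s (g *v lift (ball_act h z))"
    by (simp add: mult_lift[OF assms] vector_scalar_commute flip: matrix_vector_mul_assoc)
  then show ?thesis by (simp add: ball_act_eq_dehom dehom_smult aut_factor_nonzero[OF assms])
qed

lemma ball_act_mat_1: "ball_act (mat 1) z = z"
  by (simp add: ball_act_eq_dehom)

lemma
  assumes "g \<in> U_n1" "z \<in> unit_ball"
  shows ball_act_H_adjoint_left: "ball_act (H_adjoint g) (ball_act g z) = z"
    and ball_act_H_adjoint_right: "ball_act g (ball_act (H_adjoint g) z) = z"
  using assms
  by (simp_all add: H_adjoint_U_n1 H_adjoint_mult mult_H_adjoint ball_act_mat_1 flip: ball_act_mult)

lemma continuous_on_ball_act: "g \<in> U_n1 \<Longrightarrow> continuous_on unit_ball (ball_act g)"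
  unfolding ball_act_def
  using aut_factor_nonzero[of g] unfolding aut_factor_def by (intro continuous_intros) auto

lemma half_cosh_lift_mult_lift:
  assumes "g \<in> U_n1" "z \<in> unit_ball" "w \<in> unit_ball"
  shows "half_cosh (lift z) (g *v lift w) = cosh (hyp_dist z (ball_act g w) / 2)"
  using assms
  by (simp add: mult_lift half_cosh_smult_right aut_factor_nonzero half_cosh_lift
      ball_act_unit_ball)

lemma hyp_dist_ball_act:
  assumes "g \<in> U_n1" "z \<in> unit_ball" "w \<in> unit_ball"
  shows "hyp_dist (ball_act g z) (ball_act g w) = hyp_dist z w"
  using assms half_cosh_U_n1[of g "lift z" "lift w"]
  by (simp add: hyp_dist_eq_arcosh_half_cosh ball_act_unit_ball mult_lift half_cosh_smult_left
      half_cosh_smult_right aut_factor_nonzero)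

lemma cosh_half_hyp_dist_ball_act:
  assumes "g \<in> U_n1" "z \<in> unit_ball"
  shows "cosh (hyp_dist z (ball_act g z) / 2)
    = cmod (ball_pairing z (ball_act g z)) * cmod (aut_factor g z) / (1 - (norm z)\<^sup>2)"
proof -
  have "herm_form z w = - ball_pairing z w" for w by (simp add: herm_form_def ball_pairing_def)
  then have "cmod (hform (lift z) (g *v lift z))
      = cmod (ball_pairing z (ball_act g z)) * cmod (aut_factor g z)"
    by (simp add: mult_lift[OF assms] hform_smult_right hform_lift norm_mult)
  moreover have "qform (g *v lift z) = 1 - (norm z)\<^sup>2" by (simp add: qform_U_n1 assms(1) qform_lift)
  ultimately show ?thesis
    using assms(2) unfolding half_cosh_lift_mult_lift[OF assms assms(2), symmetric]
    by (simp add: half_cosh_def qform_lift unit_ball_def)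
qed

lemma continuous_on_displacement:
  assumes g: "g \<in> U_n1"
  shows "continuous_on unit_ball (\<lambda>z. hyp_dist z (ball_act g z))"
proof -
  have "continuous_on unit_ball (\<lambda>z. half_cosh (lift z) (g *v lift z))"
    unfolding half_cosh_def using g
    by (intro continuous_intros) (auto simp: qform_U_n1 qform_lift unit_ball_def)
  then have "continuous_on unit_ball (\<lambda>z. 2 * arcosh (half_cosh (lift z) (g *v lift z)))"
    using g
    by (intro continuous_intros continuous_on_compose2[OF continuous_on_arcosh[OF order_refl]])
      (auto simp: half_cosh_lift_mult_lift cosh_real_ge_1)
  then show ?thesis
    using g cosh_hyp_dist(2)[OF _ ball_act_unit_ball[OF g]]
    by (elim continuous_on_eq) (simp add: half_cosh_lift_mult_lift arcosh_cosh_real)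
qed

lemma hyp_dist_eq_0_iff:
  assumes z: "z \<in> unit_ball" and w: "w \<in> unit_ball"
  shows "hyp_dist z w = 0 \<longleftrightarrow> z = w"
proof
  assume dist_0: "hyp_dist z w = 0"
  obtain g c where g: "g \<in> U_n1" "c \<noteq> 0" "g *v lift 0 = c *s lift z"
    using U_n1_transitive[of "lift z"] z by (auto simp: qform_lift_pos_iff)
  have "0 \<in> (unit_ball :: (complex ^ 'a) set)" by (simp add: unit_ball_def)
  have "ball_act g 0 = z" using g by (simp add: ball_act_eq_dehom dehom_smult)
  define v where "v = ball_act (H_adjoint g) w"
  have v: "v \<in> unit_ball" "ball_act g v = w"
    using g w by (simp_all add: v_def ball_act_unit_ball H_adjoint_U_n1 ball_act_H_adjoint_right)
  have "hyp_dist 0 v = 0"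
    using hyp_dist_ball_act[OF g(1) \<open>0 \<in> unit_ball\<close> v(1)] dist_0 \<open>ball_act g 0 = z\<close> v(2) by simp
  then have "half_cosh (lift 0) (lift v) = 1" by (simp add: half_cosh_lift \<open>0 \<in> unit_ball\<close> v)
  then have "v = 0" using v(1) by (simp add: half_cosh_lift_0 qform_lift_pos_iff)
  then show "z = w" using v(2) \<open>ball_act g 0 = z\<close> by simp
next
  assume "z = w"
  moreover have "half_cosh (lift w) (lift w) = 1"
    using w by (simp add: half_cosh_def hform_self flip: qform_lift_pos_iff)
  ultimately show "hyp_dist z w = 0" using w by (simp add: hyp_dist_eq_arcosh_half_cosh)
qed

section \<open>Entries of isometries\<close>

lemma U_n1_column_None:
  assumes "g \<in> U_n1"
  shows "(\<Sum>i\<in>UNIV. (cmod (g $ i $ None))\<^sup>2) = 2 * (cmod (g $ None $ None))\<^sup>2 - 1"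
  using qform_U_n1[OF assms, of "axis None 1"]
  by (simp add: qform_def sum_option matrix_vector_mult_def axis_def if_distrib cong: if_cong)

lemma U_n1_column_Some:
  fixes j :: "'n::finite"
  assumes "g \<in> U_n1"
  shows "(\<Sum>i\<in>UNIV. (cmod (g $ i $ Some j))\<^sup>2) = 1 + 2 * (cmod (g $ None $ Some j))\<^sup>2"
proof -
  have "(\<Sum>i\<in>UNIV. (cmod (axis (Some j) 1 $ Some i))\<^sup>2) = (\<Sum>i\<in>UNIV. if i = j then 1 else 0::real)"
    by (intro sum.cong) (auto simp: axis_def)
  then have "qform (axis (Some j) 1) = -1" by (simp add: qform_def axis_def)
  then show ?thesis
    using qform_U_n1[OF assms, of "axis (Some j) 1"]
    by (simp add: qform_def sum_option matrix_vector_mult_def axis_def if_distrib cong: if_cong)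
qed

lemma H_adjoint_column_None:
  "H_adjoint g $ i $ None = (if i = None then 1 else - 1) * cnj (g $ None $ i)"
  by (simp add: H_adjoint_def matrix_matrix_mult_def H_mat_def conj_transpose_def
      if_distrib[of "\<lambda>x. x * _"] if_distrib[of "\<lambda>x. _ * x"] cong: if_cong)

lemma U_n1_row_None:
  assumes "g \<in> U_n1"
  shows "(\<Sum>j\<in>UNIV. (cmod (g $ None $ Some j))\<^sup>2) = (cmod (g $ None $ None))\<^sup>2 - 1"
  using U_n1_column_None[OF H_adjoint_U_n1[OF assms]]
  by (simp add: sum_option H_adjoint_column_None)

lemma norm_sq_U_n1:
  fixes g :: "('n::finite) cmat1"
  assumes g: "g \<in> U_n1"
  shows "(norm g)\<^sup>2 = 4 * (cmod (g $ None $ None))\<^sup>2 + real CARD('n) - 3"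
proof -
  have "(norm g)\<^sup>2 = (\<Sum>j\<in>UNIV. \<Sum>i\<in>UNIV. (cmod (g $ i $ j))\<^sup>2)"
    by (subst sum.swap) (simp add: norm_vec_def L2_set_def sum_nonneg)
  also have "\<dots> = 4 * (cmod (g $ None $ None))\<^sup>2 + real CARD('n) - 3"
    by (subst sum_option)
      (simp add: U_n1_column_None[OF g] U_n1_column_Some[OF g] sum.distrib U_n1_row_None[OF g]
        flip: sum_distrib_left)
  finally show ?thesis .
qed

lemma norm_H_adjoint:
  assumes "g \<in> U_n1"
  shows "norm (H_adjoint g) = norm g"
proof (rule power2_eq_imp_eq)
  show "(norm (H_adjoint g))\<^sup>2 = (norm g)\<^sup>2"
    using assms by (simp add: norm_sq_U_n1 H_adjoint_U_n1 H_adjoint_column_None)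
qed simp_all

lemma cmod_nth_None_le_aut_factor:
  assumes g: "g \<in> U_n1"
  shows "cmod (g $ None $ None) * (1 - norm z) \<le> cmod (aut_factor g z)"
proof -
  define y where "y = (\<chi> j. cnj (g $ None $ Some j))"
  have "(norm y)\<^sup>2 \<le> (cmod (g $ None $ None))\<^sup>2"
    by (simp add: y_def norm_vec_def L2_set_def sum_nonneg) (simp add: U_n1_row_None[OF g])
  then have "norm y \<le> cmod (g $ None $ None)" by (rule power2_le_imp_le) simp
  then have "norm z * norm y \<le> norm z * cmod (g $ None $ None)" by (rule mult_left_mono) simp
  moreover have "aut_factor g z = (\<Sum>j\<in>UNIV. z $ j * cnj (y $ j)) + g $ None $ None"
    by (simp add: aut_factor_def y_def mult.commute)
  then have "cmod (g $ None $ None) - norm z * norm y \<le> cmod (aut_factor g z)"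
    using norm_diff_ineq[of "g $ None $ None" "\<Sum>j\<in>UNIV. z $ j * cnj (y $ j)"]
      cmod_sum_le_norm[of z y] by (simp add: add.commute)
  ultimately show ?thesis by (simp add: algebra_simps)
qed

lemma aut_factor_le_displacement:
  assumes g: "g \<in> U_n1" and z: "z \<in> unit_ball"
  shows "cmod (aut_factor g z) \<le> 2 * cosh (hyp_dist z (ball_act g z) / 2)"
proof -
  define w where "w = ball_act g z"
  have norms: "norm z < 1" "norm w < 1"
    using z ball_act_unit_ball[OF g z] by (simp_all add: w_def unit_ball_iff)
  have "norm z * norm w \<le> norm z * 1" using norms by (intro mult_left_mono) auto
  then have "1 - norm z \<le> cmod (ball_pairing z w)"
    using norm_triangle_ineq2[of 1 "\<Sum>j\<in>UNIV. z $ j * cnj (w $ j)"] cmod_sum_le_norm[of z w]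
    by (simp add: ball_pairing_def)
  moreover have "1 - (norm z)\<^sup>2 \<le> 2 - 2 * norm z"
    using zero_le_power2[of "1 - norm z"] by (simp add: power2_eq_square algebra_simps)
  ultimately have "1 - (norm z)\<^sup>2 \<le> cmod (ball_pairing z w) * 2" by linarith
  then have "cmod (aut_factor g z) * (1 - (norm z)\<^sup>2)
      \<le> cmod (aut_factor g z) * (cmod (ball_pairing z w) * 2)"
    by (rule mult_left_mono) simp
  moreover have "1 - (norm z)\<^sup>2 > 0" using z by (simp add: unit_ball_def)
  ultimately show ?thesis
    by (simp add: cosh_half_hyp_dist_ball_act[OF g z] w_def pos_le_divide_eq mult_ac)
qed

lemma norm_bound_of_displacement:
  assumes "R < 1"
  obtains M where "\<And>g z. \<lbrakk>g \<in> U_n1; norm z \<le> R; hyp_dist z (ball_act g z) \<le> d\<rbrakk>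
    \<Longrightarrow> norm (g :: ('n::finite) cmat1) \<le> M"
proof
  fix g :: "'n cmat1" and z assume g: "g \<in> U_n1" and z: "norm z \<le> R"
    and displacement_le: "hyp_dist z (ball_act g z) \<le> d"
  define D where "D = 2 * cosh (d / 2) / (1 - R)"
  have ball: "z \<in> unit_ball" using z assms by (simp add: unit_ball_iff)
  have "cmod (g $ None $ None) * (1 - R) \<le> cmod (g $ None $ None) * (1 - norm z)"
    using z by (intro mult_left_mono) auto
  also note cmod_nth_None_le_aut_factor[OF g]
  also note aut_factor_le_displacement[OF g ball]
  also have "2 * cosh (hyp_dist z (ball_act g z) / 2) \<le> 2 * cosh (d / 2)"
    using displacement_le cosh_hyp_dist(2)[OF ball ball_act_unit_ball[OF g ball]]
    by (simp add: cosh_real_nonneg_le_iff)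
  finally have "cmod (g $ None $ None) \<le> D" using assms by (simp add: D_def pos_le_divide_eq)
  then have "(cmod (g $ None $ None))\<^sup>2 \<le> D\<^sup>2" by (intro power_mono) auto
  then have "(norm g)\<^sup>2 \<le> 4 * D\<^sup>2 + real CARD('n)" by (simp add: norm_sq_U_n1[OF g])
  then show "norm g \<le> sqrt (4 * (2 * cosh (d / 2) / (1 - R))\<^sup>2 + real CARD('n))"
    by (intro real_le_rsqrt) (simp add: D_def)
qed

section \<open>Cocompact discrete groups\<close>

lemma (in group) nat_pow_eq_one_of_finite_range:
  assumes x: "x \<in> carrier G" and finite_powers: "finite (range (\<lambda>m::nat. x [^] m))"
  obtains m :: nat where "m > 0" "x [^] m = \<one>"
proof -
  have "\<not> inj (\<lambda>m::nat. x [^] m)" using finite_powers finite_imageD infinite_UNIV_nat by blast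
  then obtain a b :: nat where power_eq: "a < b" "x [^] a = x [^] b"
    unfolding inj_def by (metis linorder_neqE_nat)
  then have "x [^] a \<otimes> x [^] (b - a) = x [^] a" using nat_pow_mult[OF x, of a "b - a"] by simp
  then have "x [^] (b - a) = \<one>" using x by (simp add: l_cancel_one')
  then show thesis using power_eq(1) that[of "b - a"] by simp
qed

locale SU_n1_subgroup =
  fixes \<Gamma> :: "('n::finite) cmat1 set"
  assumes subgroup: "subgroup \<Gamma> SU_n1"
begin

lemma subset_U_n1: "g \<in> \<Gamma> \<Longrightarrow> g \<in> U_n1"
  using subgroup.subset[OF subgroup] by (auto simp: SU_n1_def U_n1_def)

lemma mat_1_mem: "mat 1 \<in> \<Gamma>"
  using subgroup.one_closed[OF subgroup] by (simp add: SU_n1_def)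

lemma mult_mem: "g \<in> \<Gamma> \<Longrightarrow> h \<in> \<Gamma> \<Longrightarrow> g ** h \<in> \<Gamma>"
  using subgroup.m_closed[OF subgroup] by (simp add: SU_n1_def)

lemma H_adjoint_mem:
  assumes "g \<in> \<Gamma>"
  shows "H_adjoint g \<in> \<Gamma>"
proof -
  interpret group SU_n1 by (rule group_SU_n1)
  interpret subgroup \<Gamma> SU_n1 by (rule subgroup)
  have "inv\<^bsub>SU_n1\<^esub> g ** g = mat 1" using l_inv[OF mem_carrier[OF assms]] by (simp add: SU_n1_def)
  then have "inv\<^bsub>SU_n1\<^esub> g = H_adjoint g"
    by (metis mult_H_adjoint subset_U_n1[OF assms] matrix_mul_assoc matrix_mul_lid matrix_mul_rid)
  then show ?thesis using m_inv_closed[OF assms] by simp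
qed

lemma nat_pow_mem: "g \<in> \<Gamma> \<Longrightarrow> g [^]\<^bsub>SU_n1\<^esub> (m::nat) \<in> \<Gamma>"
  by (induction m) (simp_all add: mat_1_mem mult_mem SU_n1_def nat_pow_def)

lemma orbit_of_eqD:
  assumes "orbit_of \<Gamma> z = orbit_of \<Gamma> w"
  obtains g where "g \<in> \<Gamma>" "w = ball_act g z"
proof -
  have "w \<in> orbit_of \<Gamma> w"
    unfolding orbit_of_def using mat_1_mem by (rule rev_image_eqI) (simp add: ball_act_mat_1)
  then have "w \<in> orbit_of \<Gamma> z" by (simp only: assms)
  then show thesis using that by (auto simp: orbit_of_def)
qed

lemma orbit_of_ball_act:
  assumes h: "h \<in> \<Gamma>" and z: "z \<in> unit_ball"
  shows "orbit_of \<Gamma> (ball_act h z) = orbit_of \<Gamma> z"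
proof -
  have orbit_subset: "orbit_of \<Gamma> (ball_act g w) \<subseteq> orbit_of \<Gamma> w" if "g \<in> \<Gamma>" "w \<in> unit_ball" for g w
    using that by (auto simp: orbit_of_def subset_U_n1 mult_mem simp flip: ball_act_mult)
  show ?thesis
    using orbit_subset[OF h z] orbit_subset[OF H_adjoint_mem[OF h], of "ball_act h z"] h z
    by (simp add: ball_act_H_adjoint_left ball_act_unit_ball subset_U_n1 subset_antisym)
qed

lemma openin_X_top_image:
  assumes "open U" "U \<subseteq> unit_ball"
  shows "openin (X_top \<Gamma>) (orbit_of \<Gamma> ` U)"
proof -
  have "{z \<in> unit_ball. orbit_of \<Gamma> z \<in> orbit_of \<Gamma> ` U} = (\<Union>g\<in>\<Gamma>. unit_ball \<inter> ball_act g -` U)"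
  proof (intro subset_antisym subsetI)
    fix z assume "z \<in> {z \<in> unit_ball. orbit_of \<Gamma> z \<in> orbit_of \<Gamma> ` U}"
    then obtain w where w: "z \<in> unit_ball" "w \<in> U" "orbit_of \<Gamma> z = orbit_of \<Gamma> w" by auto
    then show "z \<in> (\<Union>g\<in>\<Gamma>. unit_ball \<inter> ball_act g -` U)" by (auto elim!: orbit_of_eqD)
  next
    fix z assume "z \<in> (\<Union>g\<in>\<Gamma>. unit_ball \<inter> ball_act g -` U)"
    then obtain g where "g \<in> \<Gamma>" "z \<in> unit_ball" "ball_act g z \<in> U" by auto
    then show "z \<in> {z \<in> unit_ball. orbit_of \<Gamma> z \<in> orbit_of \<Gamma> ` U}"
      using orbit_of_ball_act[of g z] by (auto intro!: image_eqI[of _ _ "ball_act g z"])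
  qed
  moreover have "open (\<Union>g\<in>\<Gamma>. unit_ball \<inter> ball_act g -` U)"
    using assms
    by (intro open_UN ballI continuous_open_preimage continuous_on_ball_act open_unit_ball
        subset_U_n1)
  ultimately show ?thesis using assms by (auto simp: openin_X_top X_quot_def)
qed

lemma cocompact_radius:
  assumes "cocompact \<Gamma>"
  obtains R where "0 \<le> R" "R < 1" "\<And>z. z \<in> unit_ball \<Longrightarrow> \<exists>g\<in>\<Gamma>. norm (ball_act g z) \<le> R"
proof -
  define W where "W t = orbit_of \<Gamma> ` ball 0 t" for t
  have ball_subset: "ball 0 t \<subseteq> (unit_ball :: (complex ^ 'n) set)" if "t \<in> {0..<1}" for t
    using that by (auto simp: unit_ball_iff)
  have topspace: "topspace (X_top \<Gamma>) = orbit_of \<Gamma> ` unit_ball"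
    using quotient_map_X_top[of \<Gamma>] by (simp add: quotient_map_def)
  have "openin (X_top \<Gamma>) (W t)" if "t \<in> {0..<1}" for t
    unfolding W_def using ball_subset[OF that] by (intro openin_X_top_image) auto
  then have "\<forall>U\<in>W ` {0..<1}. openin (X_top \<Gamma>) U" by blast
  moreover have "topspace (X_top \<Gamma>) \<subseteq> \<Union>(W ` {0..<1})"
  proof
    fix x assume "x \<in> topspace (X_top \<Gamma>)"
    then obtain z where z: "norm z < 1" "x = orbit_of \<Gamma> z" by (auto simp: topspace unit_ball_iff)
    then obtain t where "norm z < t" "t < 1" using dense by blast
    then show "x \<in> \<Union>(W ` {0..<1})"
      using z(2)
      by (auto simp: W_def intro!: bexI[of _ t] less_imp_le[OF le_less_trans[OF norm_ge_zero]])
  qed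
  ultimately obtain \<F> where "finite \<F>" "\<F> \<subseteq> W ` {0..<1}" and cover: "topspace (X_top \<Gamma>) \<subseteq> \<Union>\<F>"
    using assms unfolding cocompact_def compact_space_alt by meson
  then obtain T where T: "T \<subseteq> {0..<1}" "finite T" "\<F> = W ` T" by (meson finite_subset_image)
  define R where "R = Max (insert 0 T)"
  show thesis
  proof
    show "0 \<le> R" "R < 1" using T(1,2) by (auto simp: R_def)
    fix z :: "complex ^ 'n" assume "z \<in> unit_ball"
    then obtain t w where t: "t \<in> T" "orbit_of \<Gamma> z = orbit_of \<Gamma> w" "norm w < t"
      using cover T(3) by (auto simp: topspace W_def)
    obtain g where "g \<in> \<Gamma>" "w = ball_act g z" using orbit_of_eqD[OF t(2)] by blast
    moreover have "t \<le> R" using T(2) t(1) by (simp add: R_def)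
    ultimately show "\<exists>g\<in>\<Gamma>. norm (ball_act g z) \<le> R" using t(3) by force
  qed
qed

lemma hyp_dist_orbit:
  assumes "g \<in> \<Gamma>" "h \<in> \<Gamma>" "z \<in> unit_ball"
  shows "hyp_dist (ball_act g z) (ball_act h z) = hyp_dist z (ball_act (H_adjoint g ** h) z)"
  using assms hyp_dist_ball_act[of g z "ball_act (H_adjoint g) (ball_act h z)"]
  by (simp add: ball_act_mult ball_act_H_adjoint_right ball_act_unit_ball H_adjoint_mem subset_U_n1)

lemma displacement_conjugate:
  assumes "h \<in> \<Gamma>" "g \<in> \<Gamma>" "z \<in> unit_ball"
  shows "hyp_dist (ball_act h z) (ball_act (h ** g ** H_adjoint h) (ball_act h z))
    = hyp_dist z (ball_act g z)"
  using assms
  by (simp add: ball_act_mult U_n1_mult H_adjoint_U_n1 ball_act_unit_ball ball_act_H_adjoint_left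
      hyp_dist_ball_act subset_U_n1)

lemma conjugate_eq_1_iff:
  assumes "h \<in> \<Gamma>"
  shows "h ** g ** H_adjoint h = mat 1 \<longleftrightarrow> g = mat 1"
proof
  assume "h ** g ** H_adjoint h = mat 1"
  then have "H_adjoint h ** (h ** g ** H_adjoint h) ** h = mat 1"
    using H_adjoint_mult[OF subset_U_n1[OF assms]] by simp
  then have "(H_adjoint h ** h) ** g ** (H_adjoint h ** h) = mat 1" by (simp add: matrix_mul_assoc)
  then show "g = mat 1" by (simp add: H_adjoint_mult[OF subset_U_n1[OF assms]])
qed (simp add: mult_H_adjoint[OF subset_U_n1[OF assms]])

lemma bergman_pet_le:
  assumes series_const: "bergman_series_const \<Gamma> k \<B> C" and z: "z \<in> unit_ball"
    and sum_le: "\<And>A. finite A \<Longrightarrow> A \<subseteq> \<Gamma> \<Longrightarrow> (\<Sum>g\<in>A. 1 / cosh (hyp_dist z (ball_act g z) / 2) ^ k) \<le> T"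
  shows "bergman_pet \<B> k z \<le> C * T"
proof -
  define f where "f g = complex_of_real C
    / (ball_pairing z (ball_act g z) ^ k * cnj (aut_factor g z) ^ k)" for g
  define u where "u g = 1 / cosh (hyp_dist z (ball_act g z) / 2) ^ k" for g
  define q where "q = 1 - (norm z)\<^sup>2"
  have q_pos: "q > 0" using z by (simp add: q_def unit_ball_def)
  have "C \<ge> 0" and series: "(f has_sum bergman_kernel \<B> z z) \<Gamma>"
    using series_const z by (auto simp: bergman_series_const_def f_def[abs_def])
  have norm_f: "cmod (f g) = C / q ^ k * u g" if "g \<in> \<Gamma>" for g
  proof -
    have "cmod (ball_pairing z (ball_act g z)) * cmod (aut_factor g z)
        = q * cosh (hyp_dist z (ball_act g z) / 2)"
      using q_pos cosh_half_hyp_dist_ball_act[OF subset_U_n1[OF that] z] by (simp add: q_def)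
    then show ?thesis
      using \<open>C \<ge> 0\<close>
      by (simp add: f_def u_def norm_divide norm_mult norm_power flip: power_mult_distrib)
  qed
  have "cmod (bergman_kernel \<B> z z) \<le> C / q ^ k * T"
  proof (rule Lim_norm_ubound[OF _ series[unfolded has_sum_def]])
    show "\<forall>\<^sub>F A in finite_subsets_at_top \<Gamma>. norm (sum f A) \<le> C / q ^ k * T"
    proof (rule eventually_finite_subsets_at_top_weakI)
      fix A assume A: "finite A" "A \<subseteq> \<Gamma>"
      have "norm (sum f A) \<le> (\<Sum>g\<in>A. C / q ^ k * u g)"
        using A norm_f by (intro order_trans[OF norm_sum] sum_mono) auto
      also have "\<dots> = C / q ^ k * sum u A" by (rule sum_distrib_left[symmetric])
      also have "\<dots> \<le> C / q ^ k * T"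
        using sum_le[OF A] \<open>C \<ge> 0\<close> q_pos unfolding u_def by (intro mult_left_mono) auto
      finally show "norm (sum f A) \<le> C / q ^ k * T" .
    qed
  qed simp
  then show ?thesis using q_pos by (simp add: bergman_pet_def q_def pos_le_divide_eq mult.commute)
qed

end

locale SU_n1_discrete_subgroup = SU_n1_subgroup \<Gamma> for \<Gamma> :: "('n::finite) cmat1 set" +
  assumes discrete: "discrete \<Gamma>"
begin

lemma finite_norm_le: "finite {g \<in> \<Gamma>. norm g \<le> M}"
proof -
  have "bilinear (\<lambda>(g :: 'n cmat1) (h :: 'n cmat1). g ** h)"
    by (auto simp: bilinear_def linear_iff matrix_add_ldistrib matrix_matrix_mult_def vec_eq_iff
        sum.distrib scaleR_sum_right algebra_simps)
  then interpret matrix_mult: bounded_bilinear "\<lambda>(g :: 'n cmat1) (h :: 'n cmat1). g ** h"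
    by (simp add: bilinear_conv_bounded_bilinear)
  obtain B where norm_mult_le: "B > 0"
    "\<And>(g :: 'n cmat1) (h :: 'n cmat1). norm (g ** h) \<le> norm g * norm h * B"
    using matrix_mult.pos_bounded by blast
  have "mat 1 isolated_in \<Gamma>" using discrete mat_1_mem by (rule discreteD)
  then obtain e where isolated: "e > 0" "\<And>g. g \<in> \<Gamma> \<Longrightarrow> dist (mat 1) g < e \<Longrightarrow> g = mat 1"
    unfolding isolated_in_dist_Ex_iff by blast
  define M' where "M' = max M 1"
  have "uniform_discrete {g \<in> \<Gamma>. norm g \<le> M}"
  proof (rule uniformI1)
    show "e / (M' * B) > 0" using isolated(1) norm_mult_le(1) by (simp add: M'_def)
    fix g h assume g: "g \<in> {g \<in> \<Gamma>. norm g \<le> M}" and h: "h \<in> {g \<in> \<Gamma>. norm g \<le> M}"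
      and close: "dist g h < e / (M' * B)"
    define \<gamma> where "\<gamma> = H_adjoint g ** h"
    have "\<gamma> - mat 1 = H_adjoint g ** (h - g)"
      using H_adjoint_mult[OF subset_U_n1, of g] g by (simp add: \<gamma>_def matrix_mult.diff_right)
    then have "norm (\<gamma> - mat 1) \<le> norm (H_adjoint g) * norm (h - g) * B"
      by (simp only: norm_mult_le(2))
    also have "\<dots> \<le> M' * norm (h - g) * B"
      using g norm_mult_le(1)
      by (intro mult_right_mono) (auto simp: M'_def norm_H_adjoint subset_U_n1)
    also have "\<dots> < e"
      using close norm_mult_le(1) by (simp add: M'_def dist_norm norm_minus_commute field_simps)
    finally have "\<gamma> = mat 1"
      using isolated(2)[of \<gamma>] g h
      by (simp add: \<gamma>_def mult_mem H_adjoint_mem dist_norm norm_minus_commute)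
    then have "g ** \<gamma> = g" by simp
    then show "g = h" using g by (simp add: \<gamma>_def matrix_mul_assoc mult_H_adjoint subset_U_n1)
  qed
  moreover have "bounded {g \<in> \<Gamma>. norm g \<le> M}" by (auto simp: bounded_iff)
  ultimately show ?thesis using uniform_discrete_finite_iff by blast
qed

lemma finite_displacement_le:
  assumes "R < 1"
  shows "finite {g \<in> \<Gamma>. \<exists>z. norm z \<le> R \<and> hyp_dist z (ball_act g z) \<le> d}"
proof -
  obtain M where "norm g \<le> M" if "g \<in> U_n1" "norm z \<le> R" "hyp_dist z (ball_act g z) \<le> d"
    for g :: "'n cmat1" and z
    using norm_bound_of_displacement[OF assms, of d] by blast
  then have "{g \<in> \<Gamma>. \<exists>z. norm z \<le> R \<and> hyp_dist z (ball_act g z) \<le> d} \<subseteq> {g \<in> \<Gamma>. norm g \<le> M}"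
    using subset_U_n1 by blast
  then show ?thesis using finite_norm_le by (rule finite_subset)
qed

lemma fixed_point_imp_torsion:
  assumes g: "g \<in> \<Gamma>" and z: "z \<in> unit_ball" and fixed: "ball_act g z = z"
  obtains m :: nat where "m > 0" "g [^]\<^bsub>SU_n1\<^esub> m = \<one>\<^bsub>SU_n1\<^esub>"
proof -
  interpret group SU_n1 by (rule group_SU_n1)
  have "ball_act (g [^]\<^bsub>SU_n1\<^esub> m) z = z" for m :: nat
  proof (induction m)
    case (Suc m)
    have "g [^]\<^bsub>SU_n1\<^esub> Suc m = (g [^]\<^bsub>SU_n1\<^esub> m) ** g" by (simp add: SU_n1_def nat_pow_def)
    then show ?case using Suc by (simp add: ball_act_mult subset_U_n1[OF g] z fixed)
  qed (simp add: SU_n1_def ball_act_mat_1)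
  moreover have "hyp_dist z z = 0" using z by (simp add: hyp_dist_eq_0_iff)
  ultimately have "range (\<lambda>m::nat. g [^]\<^bsub>SU_n1\<^esub> m)
      \<subseteq> {g \<in> \<Gamma>. \<exists>w. norm w \<le> norm z \<and> hyp_dist w (ball_act g w) \<le> 0}"
    using nat_pow_mem[OF g] by force
  then have "finite (range (\<lambda>m::nat. g [^]\<^bsub>SU_n1\<^esub> m))"
    using finite_displacement_le z by (auto simp: unit_ball_iff intro: finite_subset)
  then show thesis
    using that nat_pow_eq_one_of_finite_range subgroup.mem_carrier[OF subgroup g] by blast
qed

end

locale SU_n1_uniform_lattice = SU_n1_discrete_subgroup \<Gamma> for \<Gamma> :: "('n::finite) cmat1 set" +
  assumes torsion_free: "torsion_free \<Gamma>" and cocompact: "cocompact \<Gamma>"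
begin

lemma displacement_pos:
  assumes g: "g \<in> \<Gamma> - {mat 1}" and z: "z \<in> unit_ball"
  shows "0 < hyp_dist z (ball_act g z)"
proof (rule ccontr)
  have "ball_act g z \<in> unit_ball" using g z by (simp add: ball_act_unit_ball subset_U_n1)
  moreover assume "\<not> 0 < hyp_dist z (ball_act g z)"
  ultimately have "ball_act g z = z" using hyp_dist_eq_0_iff[OF z] cosh_hyp_dist(2)[OF z] by force
  then obtain m :: nat where "m > 0" "g [^]\<^bsub>SU_n1\<^esub> m = \<one>\<^bsub>SU_n1\<^esub>"
    using fixed_point_imp_torsion g z by blast
  then have "g = \<one>\<^bsub>SU_n1\<^esub>" using torsion_free g unfolding torsion_free_def by blast
  then show False using g by (simp add: SU_n1_def)
qed

lemma nontrivial: "\<Gamma> \<noteq> {mat 1}"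
proof
  assume trivial: "\<Gamma> = {mat 1}"
  obtain R where R: "0 \<le> R" "R < 1" "\<And>z. z \<in> unit_ball \<Longrightarrow> \<exists>g\<in>\<Gamma>. norm (ball_act g z) \<le> R"
    using cocompact_radius[OF cocompact] by blast
  obtain z :: "complex ^ 'n" where z: "norm z = (R + 1) / 2"
    using vector_choose_size[of "(R + 1) / 2"] R(1) by auto
  then have "norm z \<le> R" using R(2) R(3)[of z] by (simp add: trivial ball_act_mat_1 unit_ball_iff)
  then show False using z R(2) by simp
qed

lemma displacement_bounded_below_cball:
  assumes R: "0 \<le> R" "R < 1"
  obtains \<delta> where "\<delta> > 0"
    and "\<And>g z. g \<in> \<Gamma> - {mat 1} \<Longrightarrow> norm z \<le> R \<Longrightarrow> \<delta> \<le> hyp_dist z (ball_act g z)"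
proof -
  define S where "S = {g \<in> \<Gamma>. \<exists>z. norm z \<le> R \<and> hyp_dist z (ball_act g z) \<le> 1} - {mat 1}"
  have finite_S: "finite S" "S \<subseteq> \<Gamma> - {mat 1}"
    using finite_displacement_le[OF R(2)] by (auto simp: S_def)
  have cball: "cball 0 R \<subseteq> (unit_ball :: (complex ^ 'n) set)"
    using R(2) by (auto simp: unit_ball_iff)
  have "\<exists>m>0. \<forall>z\<in>cball 0 R. m \<le> hyp_dist z (ball_act g z)" if "g \<in> S" for g
  proof -
    have g: "g \<in> \<Gamma> - {mat 1}" using finite_S(2) that by blast
    then have "continuous_on (cball 0 R) (\<lambda>z. hyp_dist z (ball_act g z))"
      using continuous_on_displacement[OF subset_U_n1] cball by (blast intro: continuous_on_subset)
    moreover have "cball 0 R \<noteq> ({} :: (complex ^ 'n) set)" using R(1) by auto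
    ultimately obtain z where "z \<in> cball 0 R"
      "\<And>w. w \<in> cball 0 R \<Longrightarrow> hyp_dist z (ball_act g z) \<le> hyp_dist w (ball_act g w)"
      using continuous_attains_inf[OF compact_cball] by metis
    then show ?thesis using displacement_pos[OF g] cball by blast
  qed
  then obtain f where f: "\<And>g. g \<in> S \<Longrightarrow> f g > 0"
    "\<And>g z. g \<in> S \<Longrightarrow> z \<in> cball 0 R \<Longrightarrow> f g \<le> hyp_dist z (ball_act g z)" by metis
  show thesis
  proof (rule that[of "Min (insert 1 (f ` S))"])
    show "Min (insert 1 (f ` S)) > 0" using finite_S(1) f(1) by simp
    fix g and z :: "complex ^ 'n" assume g: "g \<in> \<Gamma> - {mat 1}" and z: "norm z \<le> R"
    show "Min (insert 1 (f ` S)) \<le> hyp_dist z (ball_act g z)"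
    proof (cases "g \<in> S")
      case True
      then show ?thesis
        using finite_S(1) f(2)[OF True, of z] z by (auto intro: order_trans[OF Min_le])
    next
      case False
      then have "1 \<le> hyp_dist z (ball_act g z)" using g z by (force simp: S_def)
      then show ?thesis using finite_S(1) by (auto intro: order_trans[OF Min_le])
    qed
  qed
qed

lemma displacement_bounded_below:
  obtains \<delta> where "\<delta> > 0"
    and "\<And>g z. g \<in> \<Gamma> - {mat 1} \<Longrightarrow> z \<in> unit_ball \<Longrightarrow> \<delta> \<le> hyp_dist z (ball_act g z)"
proof -
  obtain R where R: "0 \<le> R" "R < 1" "\<And>z. z \<in> unit_ball \<Longrightarrow> \<exists>g\<in>\<Gamma>. norm (ball_act g z) \<le> R"
    using cocompact_radius[OF cocompact] by blast
  obtain \<delta> where \<delta>: "\<delta> > 0"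
    "\<And>g z. g \<in> \<Gamma> - {mat 1} \<Longrightarrow> norm z \<le> R \<Longrightarrow> \<delta> \<le> hyp_dist z (ball_act g z)"
    using displacement_bounded_below_cball[OF R(1,2)] by blast
  show thesis
  proof
    show "\<delta> > 0" by (rule \<delta>(1))
    fix g and z :: "complex ^ 'n" assume g: "g \<in> \<Gamma> - {mat 1}" and z: "z \<in> unit_ball"
    obtain h where h: "h \<in> \<Gamma>" "norm (ball_act h z) \<le> R" using R(3)[OF z] by blast
    have "h ** g ** H_adjoint h \<in> \<Gamma> - {mat 1}"
      using conjugate_eq_1_iff[of h g] g h by (simp add: mult_mem H_adjoint_mem)
    then show "\<delta> \<le> hyp_dist z (ball_act g z)"
      using \<delta>(2)[of "h ** g ** H_adjoint h", OF _ h(2)] displacement_conjugate[of h g z] g h z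
      by simp
  qed
qed

lemma inj_radius_pos: "0 < inj_radius \<Gamma>"
proof -
  obtain \<delta> where \<delta>: "\<delta> > 0"
    "\<And>g z. g \<in> \<Gamma> - {mat 1} \<Longrightarrow> z \<in> unit_ball \<Longrightarrow> \<delta> \<le> hyp_dist z (ball_act g z)"
    using displacement_bounded_below by blast
  obtain g where "g \<in> \<Gamma> - {mat 1}" using nontrivial mat_1_mem by blast
  moreover have "0 \<in> (unit_ball :: (complex ^ 'n) set)" by (simp add: unit_ball_def)
  ultimately have "\<delta> \<le> inj_radius \<Gamma>"
    unfolding inj_radius_def using \<delta>(2) by (intro cInf_greatest) auto
  then show ?thesis using \<delta>(1) by simp
qed

lemma inj_radius_le:
  assumes "g \<in> \<Gamma> - {mat 1}" "z \<in> unit_ball"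
  shows "inj_radius \<Gamma> \<le> hyp_dist z (ball_act g z)"
  unfolding inj_radius_def
proof (rule cInf_lower)
  show "bdd_below {hyp_dist z (ball_act g z) |z g. z \<in> unit_ball \<and> g \<in> \<Gamma> - {mat 1}}"
    using displacement_pos by (intro bdd_belowI[of _ 0]) (auto intro: less_imp_le)
qed (use assms in blast)

lemma inj_radius_le_hyp_dist_orbit:
  assumes "g \<in> \<Gamma>" "h \<in> \<Gamma>" "g \<noteq> h" "z \<in> unit_ball"
  shows "inj_radius \<Gamma> \<le> hyp_dist (ball_act g z) (ball_act h z)"
proof -
  have "H_adjoint g ** h \<noteq> mat 1"
  proof
    assume "H_adjoint g ** h = mat 1"
    then have "g ** (H_adjoint g ** h) = g" by simp
    then show False using assms by (simp add: matrix_mul_assoc mult_H_adjoint subset_U_n1)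
  qed
  then show ?thesis
    unfolding hyp_dist_orbit[OF assms(1,2,4)] using assms
    by (intro inj_radius_le) (simp_all add: mult_mem H_adjoint_mem)
qed

lemma orbit_sum_le:
  assumes "CARD('n) \<ge> 2" "k \<ge> 2 * CARD('n) + 2" "z \<in> unit_ball" "finite A" "A \<subseteq> \<Gamma>"
  shows "(\<Sum>g\<in>A. 1 / cosh (hyp_dist z (ball_act g z) / 2) ^ k)
    \<le> orbit_sum_bound CARD('n) k (inj_radius \<Gamma> / 4)"
proof -
  interpret separated_points z A "\<lambda>g. ball_act g z" "inj_radius \<Gamma> / 4"
  proof
    show "0 < inj_radius \<Gamma> / 4" using inj_radius_pos by simp
    show "4 * (inj_radius \<Gamma> / 4) \<le> hyp_dist (ball_act g z) (ball_act h z)"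
      if "g \<in> A" "h \<in> A" "g \<noteq> h" for g h
      using that inj_radius_le_hyp_dist_orbit[of g h z] assms by auto
  qed (use assms in \<open>auto intro: ball_act_unit_ball subset_U_n1\<close>)
  show ?thesis using assms by (intro sum_inverse_power_cosh_le)
qed

end

theorem theorem4p2:
  fixes \<Gamma> :: "('n::finite) cmat1 set"
    and F :: "(complex ^ 'n) set"
    and \<B> :: "(complex ^ 'n \<Rightarrow> complex) set"
    and k :: nat and C :: real
  defines "n \<equiv> CARD('n)" and "r \<equiv> inj_radius \<Gamma>"
  assumes "n \<ge> 2"
    and "subgroup \<Gamma> SU_n1" and "discrete \<Gamma>" and "torsion_free \<Gamma>" and "cocompact \<Gamma>"
    and "k \<ge> 2 * n + 2"
    and "fundamental_domain \<Gamma> F"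
    and "petersson_onb \<Gamma> F k \<B>"
    and "bergman_series_const \<Gamma> k \<B> C"
  shows "(SUP x\<in>X_quot \<Gamma>. SUP z\<in>x. ereal (bergman_pet \<B> k z))
    \<le> ereal (C + C * cosh (r / 4) ^ (2 * n) / ((real k - 2 * real n - 1) * sinh (r / 4) ^ (2 * n))
               + C * sinh (5 * r / 8) ^ (2 * n) / (sinh (r / 4) ^ (2 * n) * cosh (3 * r / 8) ^ k))"
proof (intro SUP_least)
  interpret SU_n1_uniform_lattice \<Gamma>
    by (intro SU_n1_uniform_lattice.intro SU_n1_uniform_lattice_axioms.intro assms(4-7)
        SU_n1_discrete_subgroup.intro SU_n1_discrete_subgroup_axioms.intro SU_n1_subgroup.intro)
  fix x z assume "x \<in> X_quot \<Gamma>" "z \<in> x"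
  then have "z \<in> unit_ball"
    by (auto simp: X_quot_def orbit_of_def intro: ball_act_unit_ball subset_U_n1)
  then have "bergman_pet \<B> k z \<le> C * orbit_sum_bound n k (r / 4)"
    using assms(3,8) unfolding n_def r_def by (intro bergman_pet_le[OF assms(11)] orbit_sum_le)
  then show "ereal (bergman_pet \<B> k z)
    \<le> ereal (C + C * cosh (r / 4) ^ (2 * n) / ((real k - 2 * real n - 1) * sinh (r / 4) ^ (2 * n))
               + C * sinh (5 * r / 8) ^ (2 * n) / (sinh (r / 4) ^ (2 * n) * cosh (3 * r / 8) ^ k))"
    by (simp add: orbit_sum_bound_def distrib_left)
qed

end
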